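(* For $\vec{x}=(a,b,c,d,e,f,g)^T\in V$, $$S(f-e)\,A(1-a,1-b,1+c-g,1+d-g)\,A(b,1+b-e,1+b-f,1+b-g)\,A(1-a,e-a,f-a,g-a)\,K_{p_0}(\vec{x})$$ $$-\,A(1+a-e,1+b-e,f-c,f-d)\,B_5(a,b,c,d,f,e,g)\,K_{n_4}(\vec{x})+A(1+a-f,1+b-f,e-c,e-d)\,B_5(\vec{x})\,K_{n_8}(\vec{x})=0.$$
   Context: $V=\{(a,b,c,d,e,f,g)^T\in\mathbb{C}^7: e+f+g-a-b-c-d=1\}$. ${}_4F_3\left[\begin{smallmatrix}a,b,c,d\\ e,f,g\end{smallmatrix};1\right]=\sum_{n\ge0}\frac{(a)_n(b)_n(c)_n(d)_n}{n!(e)_n(f)_n(g)_n}$, with $(a)_n$ the rising factorial. For $(a,b,c,d,e,f,g)^T\in V$, $$K(a;b,c,d;e,f,g)=\frac{{}_4F_3\left[\begin{smallmatrix}a,b,c,d\\ e,f,g\end{smallmatrix};1\right]}{\sin\pi a\,\Gamma(a)\Gamma(1+a-e)\Gamma(1+a-f)\Gamma(1+a-g)\Gamma(e)\Gamma(f)\Gamma(g)}+\frac{{}_4F_3\left[\begin{smallmatrix}a,1+a-e,1+a-f,1+a-g\\ 1+a-b,1+a-c,1+a-d\end{smallmatrix};1\right]}{\sin\pi a\,\Gamma(a)\Gamma(b)\Gamma(c)\Gamma(d)\Gamma(1+a-b)\Gamma(1+a-c)\Gamma(1+a-d)}.$$ Notation: $S(a_1,\dots,a_n)=\sin\pi a_1\cdots\sin\pi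 a_n$; $A(x,y,z,w)=\frac{1}{\Gamma(x)\Gamma(y)\Gamma(z)\Gamma(w)}$ (with $1/\Gamma=0$ at nonpositive integers). The relation is asserted for those $\vec{x}\in V$ at which the $K$ functions occurring are defined (no lower parameter of an occurring series is a nonpositive integer, no sine in an occurring denominator vanishes). Here $K_{p_0}(\vec{x})=K(a;b,c,d;e,f,g)$, $K_{n_4}(\vec{x})=K(e-a;e-b,e-c,e-d;1+e-f,1+e-g,e)$, $K_{n_8}(\vec{x})=K(f-a;f-b,f-c,f-d;1+f-g,f,1+f-e)$, and $B_5(\vec{x})=B_5(a,b,c,d,e,f,g)=\pi^{-4}S(b,e-b)\,[S(b-a,c-a,d-a)+S(e-2a,f-a,g-a)]$. *)

theory Defs
  imports "HOL-Analysis.Analysis"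
begin

definition V :: "(complex \<times> complex \<times> complex \<times> complex \<times> complex \<times> complex \<times> complex) set" where
  "V = {(a, b, c, d, e, f, g). e + f + g - a - b - c - d = 1}"

(* The 4F3 series at unit argument.  Where it is used below, the lower parameters minus the
   upper ones sum to 1, so it converges absolutely and suminf is its actual value. *)
definition hyp4F3_1 :: "complex \<Rightarrow> complex \<Rightarrow> complex \<Rightarrow> complex \<Rightarrow> complex \<Rightarrow> complex \<Rightarrow> complex \<Rightarrow> complex" where
  "hyp4F3_1 a b c d e f g =
     (\<Sum>n. (pochhammer a n * pochhammer b n * pochhammer c n * pochhammer d n) /
           (fact n * pochhammer e n * pochhammer f n * pochhammer g n))"

definition sinpi_prod :: "complex list \<Rightarrow> complex" where
  "sinpi_prod xs = (\<Prod>x\<leftarrow>xs. sin (of_real pi * x))"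

(* rGamma is the entire function 1/Gamma, equal to 0 at the nonpositive integers. *)
definition rGamma4 :: "complex \<Rightarrow> complex \<Rightarrow> complex \<Rightarrow> complex \<Rightarrow> complex" where
  "rGamma4 x y z w = rGamma x * rGamma y * rGamma z * rGamma w"

definition K :: "complex \<Rightarrow> complex \<Rightarrow> complex \<Rightarrow> complex \<Rightarrow> complex \<Rightarrow> complex \<Rightarrow> complex \<Rightarrow> complex" where
  "K a b c d e f g =
     hyp4F3_1 a b c d e f g / sin (of_real pi * a)
       * rGamma a * rGamma (1 + a - e) * rGamma (1 + a - f) * rGamma (1 + a - g)
       * rGamma e * rGamma f * rGamma g
     + hyp4F3_1 a (1 + a - e) (1 + a - f) (1 + a - g) (1 + a - b) (1 + a - c) (1 + a - d)
         / sin (of_real pi * a)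
       * rGamma a * rGamma b * rGamma c * rGamma d
       * rGamma (1 + a - b) * rGamma (1 + a - c) * rGamma (1 + a - d)"

(* Both series in K have admissible lower parameters and the sine in K does not vanish. *)
definition K_defined :: "complex \<Rightarrow> complex \<Rightarrow> complex \<Rightarrow> complex \<Rightarrow> complex \<Rightarrow> complex \<Rightarrow> complex \<Rightarrow> bool" where
  "K_defined a b c d e f g \<longleftrightarrow>
     sin (of_real pi * a) \<noteq> 0 \<and>
     e \<notin> \<int>\<^sub>\<le>\<^sub>0 \<and> f \<notin> \<int>\<^sub>\<le>\<^sub>0 \<and> g \<notin> \<int>\<^sub>\<le>\<^sub>0 \<and>
     1 + a - b \<notin> \<int>\<^sub>\<le>\<^sub>0 \<and> 1 + a - c \<notin> \<int>\<^sub>\<le>\<^sub>0 \<and> 1 + a - d \<notin> \<int>\<^sub>\<le>\<^sub>0"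

definition B5 :: "complex \<Rightarrow> complex \<Rightarrow> complex \<Rightarrow> complex \<Rightarrow> complex \<Rightarrow> complex \<Rightarrow> complex \<Rightarrow> complex" where
  "B5 a b c d e f g =
     1 / of_real pi ^ 4 * sinpi_prod [b, e - b] *
       (sinpi_prod [b - a, c - a, d - a] + sinpi_prod [e - 2 * a, f - a, g - a])"

end

theory Submission
  imports Defs "HOL-Complex_Analysis.Complex_Analysis" "HOL-Real_Asymp.Real_Asymp"
begin

text \<open>
  The integral of \<open>x\<^sup>s\<^sup>-\<^sup>1 (1 - x)\<^sup>h\<^sup>-\<^sup>1\<close> times a local solution at 1 of one Gauss equation and a local
  solution at 0 of another one is a balanced \<open>4F3(1)\<close>. The connection formulas between 0 and 1
  express all these integrals by the three integrals \<open>P\<close>, \<open>Q\<close>, \<open>X\<close> over products of two local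
  solutions at 1, with exponents \<open>(0, 0)\<close>, \<open>(1 - h, 1 - h)\<close> and mixed exponents. The integral \<open>P\<close> is symmetric in the
  two equations, which gives a two-term relation between combinations of two \<open>4F3(1)\<close> series;
  applied twice it leads from the parameters of \<open>K\<^sub>p\<^sub>0\<close> to those of \<open>K\<^sub>n\<^sub>4\<close> and \<open>K\<^sub>n\<^sub>8\<close>. The function
  \<open>K\<close> is the combination of its two series from which \<open>X\<close> cancels, so it is a combination of \<open>P\<close> and
  \<open>Q\<close>. Hence all three \<open>K\<close> functions are explicit combinations of the same two functions, and the
  relation becomes a trigonometric identity. The analytic part is done for real parameters in a small box
  where everything converges and is positive; the regularised series are entire in the parameters,
  so the identities extend to all complex parameters.
\<close>

section \<open>Gauss series\<close>

text \<open>\<open>V\<close> has dimension six, and \<open>(a, b, c, d, h, s)\<close> are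
  coordinates on it: two Gauss equations with upper parameters \<open>a, b\<close> and
  \<open>c, d\<close> that share the exponent \<open>1 - h\<close> at 1, and the Mellin variable
  \<open>s\<close>. In these coordinates the balancing condition holds automatically, so each
  variable can be continued separately. In a box of positive parameters the termwise integrands are
  nonnegative, and monotone convergence alone exchanges sums and integrals. The final relation
  involves three values \<open>x\<close>, \<open>y\<close>, \<open>z\<close> of one normalised
  function: \<open>K_p0\<close> combines \<open>x\<close> and \<open>z\<close>, whereas
  \<open>K_n4\<close> and \<open>K_n8\<close> both combine \<open>x\<close> and \<open>y\<close>. A
  three-term relation eliminates \<open>z\<close>; afterwards the coefficients of \<open>x\<close>
  and of \<open>y\<close> vanish separately, by two trigonometric identities. The obstacle is
  division: the normalised function and the intermediate formulas divide by sines that the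
  hypotheses do not keep away from zero. Hence 1/Gamma is used throughout, the relation is cleared
  of its denominators, and the nine sines needed on the way are removed at the end by
  continuity.\<close>

definition gauss_coeff :: "real \<Rightarrow> real \<Rightarrow> real \<Rightarrow> nat \<Rightarrow> real" where
  "gauss_coeff a b h n = pochhammer a n * pochhammer b n / fact n * rGamma (h + of_nat n)"

text \<open>This is 2F1(a, b; h; x) / Gamma(h). The factor \<open>rGamma (h + of_nat n)\<close> in
  the coefficients replaces the division by Gamma(h) and by the Pochhammer symbol of
  \<open>h\<close>, and stays meaningful at nonpositive integers.\<close>

definition hyp2F1_reg :: "real \<Rightarrow> real \<Rightarrow> real \<Rightarrow> real \<Rightarrow> real" where
  "hyp2F1_reg a b h x = (\<Sum>n. gauss_coeff a b h n * x ^ n)"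

lemma gauss_coeff_Suc:
  "(real n + 1) * (h + real n) * gauss_coeff a b h (Suc n) = (a + real n) * (b + real n) * gauss_coeff a b h n"
proof -
  define R where "R = rGamma (h + real (Suc n))"
  have "rGamma (h + real n) = (h + real n) * R"
    using rGamma_plus1[of "h + real n"] by (simp add: R_def add_ac)
  then have "gauss_coeff a b h n = pochhammer a n * pochhammer b n / fact n * ((h + real n) * R)"
    by (simp add: gauss_coeff_def)
  moreover have "gauss_coeff a b h (Suc n)
      = (a + real n) * (b + real n) * (pochhammer a n * pochhammer b n / fact n) * R / (real n + 1)"
    by (simp add: gauss_coeff_def pochhammer_Suc R_def mult_ac add.commute[of 1 "real n"])
  moreover have "real n + 1 \<noteq> 0" by linarith
  ultimately show ?thesis by (simp add: mult_ac)
qed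

lemma diffs_gauss_coeff: "diffs (gauss_coeff a b h) n = a * b * gauss_coeff (a + 1) (b + 1) (h + 1) n"
proof -
  define R where "R = rGamma (h + real (Suc n))"
  have "gauss_coeff a b h (Suc n) = a * b * (pochhammer (a + 1) n * pochhammer (b + 1) n / fact n * R) / real (Suc n)"
    by (simp add: gauss_coeff_def pochhammer_rec R_def mult_ac)
  moreover have "gauss_coeff (a + 1) (b + 1) (h + 1) n = pochhammer (a + 1) n * pochhammer (b + 1) n / fact n * R"
    by (simp add: gauss_coeff_def R_def add_ac)
  ultimately show ?thesis by (simp add: diffs_def del: of_nat_Suc)
qed

lemma summable_gauss_coeff:
  assumes "\<bar>x\<bar> < 1"
  shows "summable (\<lambda>n. gauss_coeff a b h n * x ^ n)"
proof -
  have "(\<lambda>n. (a + real n) * (b + real n) / ((real n + 1) * (h + real n))) \<longlonglongrightarrow> 1"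
    by real_asymp
  then have "(\<lambda>n. \<bar>(a + real n) * (b + real n) / ((real n + 1) * (h + real n))\<bar> * \<bar>x\<bar>) \<longlonglongrightarrow> \<bar>1\<bar> * \<bar>x\<bar>"
    by (intro tendsto_intros)
  moreover obtain c where c: "\<bar>x\<bar> < c" "c < 1" using assms dense by blast
  ultimately have "\<forall>\<^sub>F n in sequentially. \<bar>(a + real n) * (b + real n) / ((real n + 1) * (h + real n))\<bar> * \<bar>x\<bar> < c"
    by (intro order_tendstoD(2)) auto
  moreover have "\<forall>\<^sub>F n in sequentially. h + real n > 0" by real_asymp
  ultimately have "\<forall>\<^sub>F n in sequentially. norm (gauss_coeff a b h (Suc n) * x ^ Suc n) \<le> c * norm (gauss_coeff a b h n * x ^ n)"
  proof eventually_elim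
    case (elim n)
    have "gauss_coeff a b h (Suc n) = (a + real n) * (b + real n) / ((real n + 1) * (h + real n)) * gauss_coeff a b h n"
      using gauss_coeff_Suc[of n h a b] elim(2) by (simp add: divide_simps mult_ac)
    then have "norm (gauss_coeff a b h (Suc n) * x ^ Suc n)
      = (\<bar>(a + real n) * (b + real n) / ((real n + 1) * (h + real n))\<bar> * \<bar>x\<bar>) * norm (gauss_coeff a b h n * x ^ n)"
      by (simp add: abs_mult)
    also have "\<dots> \<le> c * norm (gauss_coeff a b h n * x ^ n)"
      using elim(1) by (intro mult_right_mono) auto
    finally show ?case .
  qed
  then obtain N where "\<And>n. n \<ge> N \<Longrightarrow> norm (gauss_coeff a b h (Suc n) * x ^ Suc n) \<le> c * norm (gauss_coeff a b h n * x ^ n)"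
    unfolding eventually_sequentially by blast
  then show ?thesis using c by (intro summable_ratio_test[of c N]) auto
qed

lemma hyp2F1_reg_sums:
  "\<bar>x\<bar> < 1 \<Longrightarrow> (\<lambda>n. gauss_coeff a b h n * x ^ n) sums hyp2F1_reg a b h x"
  unfolding hyp2F1_reg_def by (rule summable_sums[OF summable_gauss_coeff])

lemma hyp2F1_reg_deriv:
  assumes "\<bar>x\<bar> < 1"
  shows "(hyp2F1_reg a b h has_real_derivative a * b * hyp2F1_reg (a + 1) (b + 1) (h + 1) x) (at x)"
proof -
  have "((\<lambda>z. \<Sum>n. gauss_coeff a b h n * z ^ n) has_real_derivative (\<Sum>n. diffs (gauss_coeff a b h) n * x ^ n)) (at x)"
    by (rule termdiffs_strong'[of 1]) (use assms summable_gauss_coeff in auto)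
  also have "(\<Sum>n. diffs (gauss_coeff a b h) n * x ^ n) = a * b * hyp2F1_reg (a + 1) (b + 1) (h + 1) x"
    unfolding hyp2F1_reg_def diffs_gauss_coeff
    by (subst suminf_mult[symmetric]) (use assms summable_gauss_coeff in \<open>auto simp: mult_ac\<close>)
  finally show ?thesis unfolding hyp2F1_reg_def[abs_def] .
qed

lemma hyp2F1_reg_0: "hyp2F1_reg a b h 0 = rGamma h"
proof -
  have "hyp2F1_reg a b h 0 = gauss_coeff a b h 0"
    unfolding hyp2F1_reg_def by (rule powser_zero)
  then show ?thesis by (simp add: gauss_coeff_def)
qed

text \<open>\<open>y1\<close> and \<open>y2\<close> are the first two derivatives, by
  \<open>hyp2F1_reg_deriv\<close>. Gauss's equation is the recurrence \<open>gauss_coeff_Suc\<close>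
  read coefficientwise.\<close>

lemma hyp2F1_reg_ode:
  fixes a b h x :: real
  assumes "\<bar>x\<bar> < 1"
  defines "y1 \<equiv> a * b * hyp2F1_reg (a + 1) (b + 1) (h + 1) x"
    and "y2 \<equiv> a * b * ((a + 1) * (b + 1) * hyp2F1_reg (a + 1 + 1) (b + 1 + 1) (h + 1 + 1) x)"
  shows "x * (1 - x) * y2 + (h - (a + b + 1) * x) * y1 - a * b * hyp2F1_reg a b h x = 0"
proof -
  define c where "c = gauss_coeff a b h"
  define d where "d = diffs c"
  have d: "d = (\<lambda>n. a * b * gauss_coeff (a + 1) (b + 1) (h + 1) n)"
    unfolding d_def c_def diffs_gauss_coeff ..
  have dd: "diffs d = (\<lambda>n. a * b * ((a + 1) * (b + 1) * gauss_coeff (a + 1 + 1) (b + 1 + 1) (h + 1 + 1) n))"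
    using diffs_gauss_coeff[of "a + 1" "b + 1" "h + 1"] by (auto simp: d diffs_def fun_eq_iff mult_ac)
  have s0: "(\<lambda>n. c n * x ^ n) sums hyp2F1_reg a b h x"
    unfolding c_def by (rule hyp2F1_reg_sums[OF assms(1)])
  have s1: "(\<lambda>n. d n * x ^ n) sums y1"
    unfolding d y1_def using sums_mult[OF hyp2F1_reg_sums[OF assms(1)], of "a * b"] by (simp add: mult_ac)
  have s2: "(\<lambda>n. diffs d n * x ^ n) sums y2"
    unfolding dd y2_def using sums_mult[OF hyp2F1_reg_sums[OF assms(1)], of "a * b * (a + 1) * (b + 1)"]
    by (simp add: mult_ac)
  have lift: "(\<lambda>n. real n * u n * x ^ n) sums (x * U)" if "(\<lambda>n. diffs u n * x ^ n) sums U" for u U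
  proof -
    have "(\<lambda>n. real n * u n * x ^ (n - Suc 0)) sums U"
      using diffs_equiv[of u x] that by (simp add: sums_iff)
    then have "(\<lambda>n. x * (real n * u n * x ^ (n - Suc 0))) sums (x * U)" by (rule sums_mult)
    moreover have "x * (real n * u n * x ^ (n - Suc 0)) = real n * u n * x ^ n" for n
      by (cases n) simp_all
    ultimately show ?thesis by simp
  qed
  have t1: "(\<lambda>n. real n * c n * x ^ n) sums (x * y1)"
    using lift s1 unfolding d_def by blast
  have t2: "(\<lambda>n. real n * d n * x ^ n) sums (x * y2)"
    using lift s2 by blast
  \<comment> \<open>The index is shifted by one more; the term at 0 added by \<open>sums_Suc\<close>
    vanishes because of the factor \<open>real n\<close>.\<close>
  have "(\<lambda>n. (\<lambda>n. (real n - 1) * real n * c n * x ^ n) (Suc n)) sums (x * (x * y2))"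
    using sums_mult[OF t2, of x] by (simp add: d_def diffs_def mult_ac)
  from sums_Suc[OF this] have t3: "(\<lambda>n. (real n - 1) * real n * c n * x ^ n) sums (x * (x * y2))"
    by simp
  have "(\<lambda>n. real n * d n * x ^ n + h * (d n * x ^ n)
      - ((real n - 1) * real n * c n * x ^ n + (a + b + 1) * (real n * c n * x ^ n) + a * b * (c n * x ^ n)))
     sums (x * y2 + h * y1 - (x * (x * y2) + (a + b + 1) * (x * y1) + a * b * hyp2F1_reg a b h x))"
    by (intro sums_diff sums_add sums_mult s0 s1 t1 t2 t3)
  moreover have "real n * d n * x ^ n + h * (d n * x ^ n)
      - ((real n - 1) * real n * c n * x ^ n + (a + b + 1) * (real n * c n * x ^ n) + a * b * (c n * x ^ n)) = 0" for n
  proof -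
    have "(real n + h) * d n = (a + real n) * (b + real n) * c n"
      using gauss_coeff_Suc[of n h a b] by (simp add: d_def c_def diffs_def algebra_simps)
    then have "((real n + h) * d n - (a + real n) * (b + real n) * c n) * x ^ n = 0" by simp
    then show ?thesis by (simp add: algebra_simps)
  qed
  ultimately have "x * y2 + h * y1 - (x * (x * y2) + (a + b + 1) * (x * y1) + a * b * hyp2F1_reg a b h x) = 0"
    by (simp add: sums_iff)
  then show ?thesis by (simp add: algebra_simps)
qed

section \<open>Behaviour of power series at the endpoint 1\<close>

lemma sums_pochhammer_powr:
  fixes x H :: real
  assumes "\<bar>x\<bar> < 1"
  shows "(\<lambda>n. pochhammer H n / fact n * x ^ n) sums (1 - x) powr (- H)"
proof -
  have "(- H gchoose n) * (- x) ^ n = pochhammer H n / fact n * x ^ n" for n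
  proof -
    have "(- x) ^ n = (- 1) ^ n * x ^ n" by (rule power_minus)
    moreover have "(- 1) ^ n * (- 1) ^ n = (1::real)" by (simp flip: power_mult_distrib)
    ultimately show ?thesis by (simp add: gbinomial_pochhammer)
  qed
  then show ?thesis using gen_binomial_real[of "- x" "- H"] assms by simp
qed

text \<open>Comparison with the binomial series of (1 - x)^(-H), whose coefficients are
  \<open>b n\<close>. Write \<open>f n = (L + r n) * b n\<close> with \<open>r\<close> tending to 0:
  the tail of the error is at most e/2 times the comparison series, and the head is bounded by a
  constant \<open>C\<close>, which the factor (1 - x)^H sends to 0.\<close>

lemma abelian_powr_limit:
  fixes f :: "nat \<Rightarrow> real"
  assumes H: "H > 0" and lim: "(\<lambda>n. f n / (pochhammer H n / fact n)) \<longlonglongrightarrow> L"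
  shows "((\<lambda>x. (1 - x) powr H * (\<Sum>n. f n * x ^ n)) \<longlongrightarrow> L) (at_left 1)"
proof -
  define b where "b n = pochhammer H n / fact n" for n
  define r where "r n = f n / b n - L" for n
  have b: "b n > 0" for n using H by (simp add: b_def pochhammer_pos)
  have f: "f n = (L + r n) * b n" for n using b[of n] by (simp add: r_def field_simps)
  have r: "r \<longlonglongrightarrow> 0" unfolding r_def using lim by (subst LIM_zero_iff) (simp add: b_def)
  then obtain R where R: "\<And>n. \<bar>r n\<bar> \<le> R"
    using convergent_imp_Bseq[of r] by (auto simp: convergent_def Bseq_def)
  have bs: "(\<lambda>n. b n * x ^ n) sums (1 - x) powr (- H)" if "0 < x" "x < 1" for x
    using sums_pochhammer_powr[of x H] that by (simp add: b_def)
  have rs: "summable (\<lambda>n. \<bar>r n\<bar> * (b n * x ^ n))" if "0 < x" "x < 1" for x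
  proof (rule summable_comparison_test')
    show "summable (\<lambda>n. R * (b n * x ^ n))" using bs[OF that] by (intro summable_mult) (rule sums_summable)
    show "norm (\<bar>r n\<bar> * (b n * x ^ n)) \<le> R * (b n * x ^ n)" if "n \<ge> 0" for n
      using R[of n] b[of n] \<open>0 < x\<close> by (simp add: abs_mult mult_right_mono)
  qed
  show ?thesis
  proof (rule tendstoI)
    fix e :: real assume e: "e > 0"
    from r e obtain N where N: "\<And>n. n \<ge> N \<Longrightarrow> \<bar>r n\<bar> < e / 2"
      unfolding LIMSEQ_iff by (metis diff_zero half_gt_zero real_norm_def)
    define C where "C = (\<Sum>n<N. \<bar>r n\<bar> * b n)"
    have C: "C \<ge> 0" unfolding C_def using b by (intro sum_nonneg) (simp add: less_imp_le)
    have bound: "\<bar>(1 - x) powr H * (\<Sum>n. f n * x ^ n) - L\<bar> \<le> C * (1 - x) powr H + e / 2"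
      if x: "0 < x" "x < 1" for x
    proof -
      have p: "(1 - x) powr H * (1 - x) powr (- H) = 1"
        using x by (simp flip: powr_add)
      have s1: "summable (\<lambda>n. r n * (b n * x ^ n))"
        by (rule summable_rabs_cancel) (use rs[OF x] b x in \<open>simp add: abs_mult less_imp_le\<close>)
      have "(\<lambda>n. L * (b n * x ^ n) + r n * (b n * x ^ n)) sums (L * (1 - x) powr (- H) + (\<Sum>n. r n * (b n * x ^ n)))"
        by (intro sums_add sums_mult bs[OF x] summable_sums s1)
      then have "(\<Sum>n. f n * x ^ n) = L * (1 - x) powr (- H) + (\<Sum>n. r n * (b n * x ^ n))"
        by (simp add: f algebra_simps sums_iff)
      then have eq: "(1 - x) powr H * (\<Sum>n. f n * x ^ n) - L = (1 - x) powr H * (\<Sum>n. r n * (b n * x ^ n))"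
        using p by (simp add: algebra_simps)
      have "\<bar>\<Sum>n. r n * (b n * x ^ n)\<bar> \<le> (\<Sum>n. \<bar>r n\<bar> * (b n * x ^ n))"
        using summable_rabs[of "\<lambda>n. r n * (b n * x ^ n)"] rs[OF x] b x by (simp add: abs_mult less_imp_le)
      also have "\<dots> \<le> (\<Sum>n. (if n < N then \<bar>r n\<bar> * b n else 0) + e / 2 * (b n * x ^ n))"
      proof (rule suminf_le)
        fix n
        have "\<bar>r n\<bar> * (b n * x ^ n) \<le> \<bar>r n\<bar> * b n"
          using x b[of n] by (intro mult_left_mono mult_right_le_one_le) (auto intro: power_le_one less_imp_le)
        moreover have "\<bar>r n\<bar> * (b n * x ^ n) \<le> e / 2 * (b n * x ^ n)" if "n \<ge> N"
          using N[OF that] x b[of n] by (intro mult_right_mono) auto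
        moreover have "e / 2 * (b n * x ^ n) \<ge> 0" using e x b[of n] by simp
        ultimately show "\<bar>r n\<bar> * (b n * x ^ n) \<le> (if n < N then \<bar>r n\<bar> * b n else 0) + e / 2 * (b n * x ^ n)"
          by (cases "n < N") auto
      next
        show "summable (\<lambda>n. (if n < N then \<bar>r n\<bar> * b n else 0) + e / 2 * (b n * x ^ n))"
          by (intro summable_add summable_mult sums_summable[OF bs[OF x]])
             (rule summable_finite[of "{..<N}"], auto)
      qed (use rs[OF x] in simp)
      also have "\<dots> = C + e / 2 * (1 - x) powr (- H)"
      proof -
        have "(\<lambda>n. if n < N then \<bar>r n\<bar> * b n else 0) sums C"
          unfolding C_def using sums_If_finite[of "\<lambda>n. n < N" "\<lambda>n. \<bar>r n\<bar> * b n"] by (simp add: lessThan_def)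
        then have "(\<lambda>n. (if n < N then \<bar>r n\<bar> * b n else 0) + e / 2 * (b n * x ^ n)) sums (C + e / 2 * (1 - x) powr (- H))"
          by (intro sums_add sums_mult bs[OF x])
        then show ?thesis by (simp add: sums_iff)
      qed
      finally have "(1 - x) powr H * \<bar>\<Sum>n. r n * (b n * x ^ n)\<bar> \<le> (1 - x) powr H * (C + e / 2 * (1 - x) powr (- H))"
        by (intro mult_left_mono) auto
      also have "\<dots> = C * (1 - x) powr H + e / 2 * ((1 - x) powr H * (1 - x) powr (- H))"
        by (simp add: algebra_simps)
      finally show ?thesis unfolding eq p by (simp add: abs_mult)
    qed
    have "((\<lambda>x. C * (1 - x) powr H) \<longlongrightarrow> C * 0) (at_left 1)"
    proof (rule tendsto_mult[OF tendsto_const])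
      show "((\<lambda>x. (1 - x) powr H) \<longlongrightarrow> 0) (at_left 1)"
        using H by real_asymp
    qed
    then have "\<forall>\<^sub>F x in at_left 1. C * (1 - x) powr H < e / 2"
      using e by (intro order_tendstoD(2)) auto
    moreover have "\<forall>\<^sub>F x in at_left 1. x \<in> {0<..<1::real}"
      by (rule eventually_at_left_real) simp
    ultimately show "\<forall>\<^sub>F x in at_left 1. dist ((1 - x) powr H * (\<Sum>n. f n * x ^ n)) L < e"
    proof eventually_elim
      case (elim x)
      then show ?case using bound[of x] by (auto simp: dist_real_def)
    qed
  qed
qed

text \<open>A quotient of Euler's limits for 1/Gamma: the powers of \<open>n\<close> cancel because
  \<open>a + b = c + d\<close>. Since \<open>rGamma_series a n\<close> contains the Pochhammer
  symbol of index \<open>n + 1\<close>, the limit is taken along the shifted sequence.\<close>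

lemma pochhammer_quotient_limit:
  fixes a b c d :: real
  assumes "a + b = c + d" "c \<notin> \<int>\<^sub>\<le>\<^sub>0" "d \<notin> \<int>\<^sub>\<le>\<^sub>0"
  shows "(\<lambda>n. pochhammer a n * pochhammer b n / (pochhammer c n * pochhammer d n))
           \<longlonglongrightarrow> Gamma c * Gamma d * rGamma a * rGamma b"
proof (rule LIMSEQ_offset[where k = 1])
  have "(\<lambda>n. rGamma_series a n * rGamma_series b n / (rGamma_series c n * rGamma_series d n))
         \<longlonglongrightarrow> rGamma a * rGamma b / (rGamma c * rGamma d)"
    using assms by (intro tendsto_intros) (auto simp: rGamma_eq_zero_iff)
  moreover have "\<forall>\<^sub>F n in sequentially. rGamma_series a n * rGamma_series b n / (rGamma_series c n * rGamma_series d n)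
    = pochhammer a (n + 1) * pochhammer b (n + 1) / (pochhammer c (n + 1) * pochhammer d (n + 1))"
    using eventually_gt_at_top[of 0]
  proof eventually_elim
    case (elim n)
    have e: "exp (a * ln (real n)) * exp (b * ln (real n)) = exp (c * ln (real n)) * exp (d * ln (real n))"
      using assms(1) by (simp flip: exp_add distrib_right)
    have "rGamma_series a n * rGamma_series b n / (rGamma_series c n * rGamma_series d n)
      = pochhammer a (n + 1) * pochhammer b (n + 1) / (pochhammer c (n + 1) * pochhammer d (n + 1))
        * ((exp (c * ln (real n)) * exp (d * ln (real n))) / (exp (a * ln (real n)) * exp (b * ln (real n))))"
      by (simp add: rGamma_series_def field_simps del: pochhammer_Suc)
    then show ?case unfolding e by simp
  qed
  ultimately have "(\<lambda>n. pochhammer a (n + 1) * pochhammer b (n + 1) / (pochhammer c (n + 1) * pochhammer d (n + 1)))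
         \<longlonglongrightarrow> rGamma a * rGamma b / (rGamma c * rGamma d)"
    by (rule Lim_transform_eventually)
  also have "rGamma a * rGamma b / (rGamma c * rGamma d) = Gamma c * Gamma d * rGamma a * rGamma b"
    by (simp add: Gamma_def field_simps)
  finally show "(\<lambda>n. pochhammer a (n + 1) * pochhammer b (n + 1) / (pochhammer c (n + 1) * pochhammer d (n + 1)))
    \<longlonglongrightarrow> Gamma c * Gamma d * rGamma a * rGamma b" .
qed

section \<open>Connection formula between 0 and 1\<close>

lemma rGamma_mult_Gamma:
  fixes x :: real
  assumes "x > 0"
  shows "rGamma x * Gamma x = 1"
  using Gamma_real_pos[OF assms] by (simp add: rGamma_inverse_Gamma)

lemma rGamma_reflection_real: "rGamma x * rGamma (1 - x) = sin (pi * x) / pi" for x :: real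
proof -
  have "complex_of_real (rGamma x * rGamma (1 - x)) = of_real (sin (pi * x) / pi)"
    using rGamma_complex_of_real[of x] rGamma_complex_of_real[of "1 - x"]
      rGamma_reflection_complex[of "of_real x"] sin_of_real[of "pi * x", where 'a = complex]
    by simp
  then show ?thesis by (simp only: of_real_eq_iff)
qed

lemma hyp2F1_reg_at_left_1:
  assumes H: "a + b - g > 0" and g: "g \<notin> \<int>\<^sub>\<le>\<^sub>0"
  shows "((\<lambda>x. (1 - x) powr (a + b - g) * hyp2F1_reg a b g x)
            \<longlongrightarrow> Gamma (a + b - g) * rGamma a * rGamma b) (at_left 1)"
  unfolding hyp2F1_reg_def
proof (rule abelian_powr_limit[OF H])
  have "(\<lambda>n. rGamma g * (pochhammer a n * pochhammer b n / (pochhammer g n * pochhammer (a + b - g) n)))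
          \<longlonglongrightarrow> rGamma g * (Gamma g * Gamma (a + b - g) * rGamma a * rGamma b)"
    using H g by (intro tendsto_intros pochhammer_quotient_limit) auto
  moreover have "rGamma g * Gamma g = 1"
    using g by (simp add: Gamma_def rGamma_eq_zero_iff)
  moreover have "rGamma g * (pochhammer a n * pochhammer b n / (pochhammer g n * pochhammer (a + b - g) n))
      = gauss_coeff a b g n / (pochhammer (a + b - g) n / fact n)" for n
  proof -
    have "pochhammer g n \<noteq> 0" using g by (auto simp: pochhammer_eq_0_iff)
    then show ?thesis using pochhammer_rGamma[of g n] by (simp add: gauss_coeff_def)
  qed
  ultimately show "(\<lambda>n. gauss_coeff a b g n / (pochhammer (a + b - g) n / fact n))
      \<longlonglongrightarrow> Gamma (a + b - g) * rGamma a * rGamma b"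
    by (simp add: mult.assoc[symmetric])
qed

text \<open>One more power of 1 - x than in \<open>hyp2F1_reg_at_left_1\<close>, which covers
  exponents \<open>a + b - g\<close> between -1 and 0, where that lemma does not apply. Writing the
  Pochhammer symbol of \<open>b\<close> through that of \<open>b + 1\<close> restores the balance
  needed for the quotient limit and leaves a factor \<open>b / (b + real n)\<close> that tends to
  0.\<close>

lemma hyp2F1_reg_at_left_1_zero:
  assumes H: "a + b - g + 1 > 0" and g: "g \<notin> \<int>\<^sub>\<le>\<^sub>0"
  shows "((\<lambda>x. (1 - x) powr (a + b - g + 1) * hyp2F1_reg a b g x) \<longlongrightarrow> 0) (at_left 1)"
  unfolding hyp2F1_reg_def
proof (rule abelian_powr_limit[OF H])
  define H where "H = a + b - g + 1"
  have "(\<lambda>n. pochhammer a n * pochhammer (b + 1) n / (pochhammer g n * pochhammer H n))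
          \<longlonglongrightarrow> Gamma g * Gamma H * rGamma a * rGamma (b + 1)"
    using H g by (intro pochhammer_quotient_limit) (auto simp: H_def)
  moreover have "(\<lambda>n. b / (b + real n)) \<longlonglongrightarrow> 0" by real_asymp
  ultimately have "(\<lambda>n. rGamma g * (pochhammer a n * pochhammer (b + 1) n / (pochhammer g n * pochhammer H n) * (b / (b + real n))))
      \<longlonglongrightarrow> rGamma g * (Gamma g * Gamma H * rGamma a * rGamma (b + 1) * 0)"
    by (intro tendsto_intros)
  then have "(\<lambda>n. rGamma g * (pochhammer a n * pochhammer (b + 1) n / (pochhammer g n * pochhammer H n) * (b / (b + real n))))
      \<longlonglongrightarrow> 0" by simp
  moreover have "\<forall>\<^sub>F n in sequentially. b + real n > 0" by real_asymp
  then have "\<forall>\<^sub>F n in sequentially.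
      rGamma g * (pochhammer a n * pochhammer (b + 1) n / (pochhammer g n * pochhammer H n) * (b / (b + real n)))
      = gauss_coeff a b g n / (pochhammer (a + b - g + 1) n / fact n)"
  proof eventually_elim
    case (elim n)
    have "pochhammer g n \<noteq> 0" using g by (auto simp: pochhammer_eq_0_iff)
    moreover have "pochhammer b n = pochhammer (b + 1) n * b / (b + real n)"
      using pochhammer_rec[of b n] pochhammer_rec'[of b n] elim by (simp add: field_simps)
    ultimately show ?case using pochhammer_rGamma[of g n] by (simp add: gauss_coeff_def H_def mult_ac)
  qed
  ultimately show "(\<lambda>n. gauss_coeff a b g n / (pochhammer (a + b - g + 1) n / fact n)) \<longlonglongrightarrow> 0"
    by (rule Lim_transform_eventually)
qed

text \<open>Abel's identity. The weight has logarithmic derivative g/x - h/(1 - x), opposite to that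
  of the Wronskian. Writing the first-order coefficient through \<open>g\<close> and
  \<open>h\<close> makes the equation symmetric under exchanging x with 1 - x and \<open>g\<close>
  with \<open>h\<close>.\<close>

lemma hypergeometric_wronskian_constant:
  fixes y z y' z' y'' z'' :: "real \<Rightarrow> real"
  assumes dy: "\<And>x. x \<in> {0<..<1} \<Longrightarrow> (y has_real_derivative y' x) (at x)"
    and dy': "\<And>x. x \<in> {0<..<1} \<Longrightarrow> (y' has_real_derivative y'' x) (at x)"
    and dz: "\<And>x. x \<in> {0<..<1} \<Longrightarrow> (z has_real_derivative z' x) (at x)"
    and dz': "\<And>x. x \<in> {0<..<1} \<Longrightarrow> (z' has_real_derivative z'' x) (at x)"
    and oy: "\<And>x. x \<in> {0<..<1} \<Longrightarrow> x * (1 - x) * y'' x + (g - (g + h) * x) * y' x - k * y x = 0"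
    and oz: "\<And>x. x \<in> {0<..<1} \<Longrightarrow> x * (1 - x) * z'' x + (g - (g + h) * x) * z' x - k * z x = 0"
  shows "\<exists>C. \<forall>x\<in>{0<..<1}. x powr g * (1 - x) powr h * (y x * z' x - y' x * z x) = C"
proof (rule has_field_derivative_zero_constant)
  fix x :: real assume x: "x \<in> {0<..<1}"
  define W where "W = y x * z' x - y' x * z x"
  define D where "D = y x * z'' x - y'' x * z x"
  have "x * (1 - x) * D = - ((g - (g + h) * x) * W)"
    using arg_cong[OF oy[OF x], of "\<lambda>t. t * z x"] arg_cong[OF oz[OF x], of "\<lambda>t. t * y x"]
    by (simp add: W_def D_def algebra_simps)
  then have D: "D = - ((g / x - h / (1 - x)) * W)"
    using x by (simp add: field_simps)
  have "((\<lambda>x. x powr g * (1 - x) powr h) has_real_derivative (g / x - h / (1 - x)) * (x powr g * (1 - x) powr h)) (at x)"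
    using x by (auto intro!: derivative_eq_intros simp: powr_diff field_simps)
  moreover have "((\<lambda>x. y x * z' x - y' x * z x) has_real_derivative D) (at x)"
    using x by (auto intro!: derivative_eq_intros dy dy' dz dz' simp: D_def)
  ultimately have "((\<lambda>x. x powr g * (1 - x) powr h * (y x * z' x - y' x * z x)) has_real_derivative
      (g / x - h / (1 - x)) * (x powr g * (1 - x) powr h) * W + D * (x powr g * (1 - x) powr h)) (at x)"
    unfolding W_def by (rule DERIV_mult)
  then show "((\<lambda>x. x powr g * (1 - x) powr h * (y x * z' x - y' x * z x)) has_real_derivative 0)
      (at x within {0<..<1})"
    by (auto simp: D algebra_simps intro: has_field_derivative_at_within)
qed auto

lemma constant_eq_limit:
  fixes f :: "real \<Rightarrow> real"
  assumes "\<And>x. x \<in> {0<..<1} \<Longrightarrow> f x = C" "(f \<longlongrightarrow> L) F" "F = at_left 1 \<or> F = at_right 0"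
  shows "C = L"
proof -
  have "\<forall>\<^sub>F x in F. x \<in> {0<..<1::real}"
    using assms(3) eventually_at_left_real[of 0 1] eventually_at_right_real[of 0 1] by auto
  then have "\<forall>\<^sub>F x in F. f x = C" by eventually_elim (rule assms(1))
  then have "(f \<longlongrightarrow> C) F" by (rule tendsto_eventually)
  moreover have "F \<noteq> bot" using assms(3) trivial_limit_at_left_real trivial_limit_at_right_real by metis
  ultimately show ?thesis using assms(2) tendsto_unique by blast
qed

text \<open>\<open>w\<close>, \<open>y\<close>, \<open>z\<close> solve the same second-order
  equation, so their pairwise weighted Wronskians are constants, and these are the coefficients of
  the linear relation. \<open>Cyz\<close> is evaluated at 0, where both series are known;
  \<open>Cwy\<close> and \<open>Cwz\<close> are evaluated at 1, where \<open>w\<close> is regular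
  and the growth of the other two is known.\<close>

lemma hyp2F1_reg_connection:
  fixes c d g h x :: real
  assumes sum: "g + h = 1 + c + d" and h: "h > 0" and g: "g \<notin> \<int>" and x: "0 < x" "x < 1"
  shows "sin (pi * g) / pi * hyp2F1_reg c d h (1 - x)
    = rGamma (1 + c - g) * rGamma (1 + d - g) * hyp2F1_reg c d g x
      - rGamma c * rGamma d * (x powr (1 - g) * hyp2F1_reg (1 + c - g) (1 + d - g) (2 - g) x)"
proof -
  define c' d' g' where "c' = 1 + c - g" and "d' = 1 + d - g" and "g' = 2 - g"
  have gint: "g \<notin> \<int>\<^sub>\<le>\<^sub>0" "g + 1 \<notin> \<int>\<^sub>\<le>\<^sub>0" "g' \<notin> \<int>\<^sub>\<le>\<^sub>0" "g' + 1 \<notin> \<int>\<^sub>\<le>\<^sub>0"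
  proof -
    have *: "t \<in> \<int>" if "t \<in> \<int>\<^sub>\<le>\<^sub>0" for t :: real using that nonpos_Ints_subset_Ints by blast
    show "g \<notin> \<int>\<^sub>\<le>\<^sub>0" using g * by blast
    show "g + 1 \<notin> \<int>\<^sub>\<le>\<^sub>0" using g *[of "g + 1"] by (metis Ints_1 Ints_diff add_diff_cancel_right')
    have **: "t \<notin> \<int>\<^sub>\<le>\<^sub>0" if "k - t = g" "k \<in> \<int>" for k t :: real
      using g * that by (metis Ints_diff)
    show "g' \<notin> \<int>\<^sub>\<le>\<^sub>0" by (rule **[of 2]) (auto simp: g'_def)
    show "g' + 1 \<notin> \<int>\<^sub>\<le>\<^sub>0" by (rule **[of 3]) (auto simp: g'_def)
  qed
  let ?F = hyp2F1_reg
  define y where "y = ?F c d g"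
  define y' where "y' x = c * d * ?F (c + 1) (d + 1) (g + 1) x" for x
  define y'' where "y'' x = c * d * ((c + 1) * (d + 1) * ?F (c + 1 + 1) (d + 1 + 1) (g + 1 + 1) x)" for x
  define w where "w x = ?F c d h (1 - x)" for x
  define w' where "w' x = - (c * d * ?F (c + 1) (d + 1) (h + 1) (1 - x))" for x
  define w'' where "w'' x = c * d * ((c + 1) * (d + 1) * ?F (c + 1 + 1) (d + 1 + 1) (h + 1 + 1) (1 - x))" for x
  define f where "f = ?F c' d' g'"
  define f' where "f' x = c' * d' * ?F (c' + 1) (d' + 1) (g' + 1) x" for x
  define f'' where "f'' x = c' * d' * ((c' + 1) * (d' + 1) * ?F (c' + 1 + 1) (d' + 1 + 1) (g' + 1 + 1) x)" for x
  define z where "z x = x powr (1 - g) * f x" for x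
  define z' where "z' x = x powr (- g) * ((1 - g) * f x + x * f' x)" for x
  define z'' where "z'' x = x powr (- g) * (x * f'' x + 2 * (1 - g) * f' x - g * (1 - g) * f x / x)" for x
  have dy: "(y has_real_derivative y' x) (at x)" "(y' has_real_derivative y'' x) (at x)"
    and df: "(f has_real_derivative f' x) (at x)" "(f' has_real_derivative f'' x) (at x)"
    if "\<bar>x\<bar> < 1" for x
    unfolding y_def y'_def y''_def f_def f'_def f''_def
    by (intro DERIV_cmult hyp2F1_reg_deriv that)+
  have dw: "(w has_real_derivative w' x) (at x)" "(w' has_real_derivative w'' x) (at x)"
    if x: "\<bar>1 - x\<bar> < 1" for x
  proof -
    have *: "((\<lambda>x. ?F a b k (1 - x)) has_real_derivative a * b * ?F (a + 1) (b + 1) (k + 1) (1 - x) * (- 1)) (at x)"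
      for a b k
      by (rule DERIV_chain2[OF hyp2F1_reg_deriv]) (use x in \<open>auto intro!: derivative_eq_intros\<close>)
    show "(w has_real_derivative w' x) (at x)" using *[of c d h] by (simp add: w_def[abs_def] w'_def)
    show "(w' has_real_derivative w'' x) (at x)"
      using DERIV_cmult[OF *[of "c + 1" "d + 1" "h + 1"], of "- (c * d)"]
      by (simp add: w'_def[abs_def] w''_def mult_ac)
  qed
  have dz: "(z has_real_derivative z' x) (at x)" "(z' has_real_derivative z'' x) (at x)"
    if x: "x \<in> {0<..<1}" for x
  proof -
    have x1: "\<bar>x\<bar> < 1" using x by auto
    have p: "x powr (1 - g) = x powr (- g) * x" using x by (simp add: powr_diff powr_minus divide_simps)
    have p': "x powr (- g - 1) = x powr (- g) / x" using x by (simp add: powr_diff)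
    have "(z has_real_derivative (1 - g) * x powr (- g) * f x + x powr (1 - g) * f' x) (at x)"
      unfolding z_def using x df(1)[OF x1] by (auto intro!: derivative_eq_intros simp: algebra_simps)
    also have "(1 - g) * x powr (- g) * f x + x powr (1 - g) * f' x = z' x"
      unfolding z'_def p by (simp add: algebra_simps)
    finally show "(z has_real_derivative z' x) (at x)" .
    have "(z' has_real_derivative (- g) * x powr (- g - 1) * ((1 - g) * f x + x * f' x)
        + x powr (- g) * ((1 - g) * f' x + (f' x + x * f'' x))) (at x)"
      unfolding z'_def using x df[OF x1] by (auto intro!: derivative_eq_intros simp: algebra_simps)
    also have "(- g) * x powr (- g - 1) * ((1 - g) * f x + x * f' x)
        + x powr (- g) * ((1 - g) * f' x + (f' x + x * f'' x)) = z'' x"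
      unfolding z''_def p' using x by (simp add: field_simps)
    finally show "(z' has_real_derivative z'' x) (at x)" .
  qed
  have oy: "x * (1 - x) * y'' x + (g - (g + h) * x) * y' x - c * d * y x = 0"
    and ow: "x * (1 - x) * w'' x + (g - (g + h) * x) * w' x - c * d * w x = 0"
    and oz: "x * (1 - x) * z'' x + (g - (g + h) * x) * z' x - c * d * z x = 0"
    if x: "x \<in> {0<..<1}" for x
  proof -
    have x1: "\<bar>x\<bar> < 1" "\<bar>1 - x\<bar> < 1" using x by auto
    have gh: "g + h = c + d + 1" using sum by simp
    show "x * (1 - x) * y'' x + (g - (g + h) * x) * y' x - c * d * y x = 0"
      using hyp2F1_reg_ode[OF x1(1), of c d g] unfolding gh y_def y'_def y''_def by simp
    have "(1 - x) * (1 - (1 - x)) * w'' x + (h - (c + d + 1) * (1 - x)) * (- w' x) - c * d * w x = 0"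
      using hyp2F1_reg_ode[OF x1(2), of c d h] unfolding w_def w'_def w''_def minus_minus .
    moreover have "h = c + d + 1 - g" using gh by simp
    ultimately show "x * (1 - x) * w'' x + (g - (g + h) * x) * w' x - c * d * w x = 0"
      by (simp add: algebra_simps)
    have p: "x powr (1 - g) = x powr (- g) * x" using x by (simp add: powr_diff powr_minus divide_simps)
    have of: "x * (1 - x) * f'' x + (g' - (c' + d' + 1) * x) * f' x - c' * d' * f x = 0"
      using hyp2F1_reg_ode[OF x1(1), of c' d' g'] unfolding f_def f'_def f''_def .
    have "x * (1 - x) * z'' x + (g - (g + h) * x) * z' x - c * d * z x
      = x powr (- g) * (x * (x * (1 - x) * f'' x + (g' - (c' + d' + 1) * x) * f' x - c' * d' * f x))"
      unfolding z_def z'_def z''_def p using x gh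
      by (simp add: c'_def d'_def g'_def field_simps)
    then show "x * (1 - x) * z'' x + (g - (g + h) * x) * z' x - c * d * z x = 0"
      unfolding of by simp
  qed
  let ?E = "\<lambda>u u' v v' x. x powr g * (1 - x) powr h * (u x * v' x - u' x * v x)"
  obtain Cyz where Cyz: "\<And>x. x \<in> {0<..<1} \<Longrightarrow> ?E y y' z z' x = Cyz"
    using hypergeometric_wronskian_constant[of y y' y'' z z' z'' g h "c * d"] dy dz oy oz by fastforce
  obtain Cwz where Cwz: "\<And>x. x \<in> {0<..<1} \<Longrightarrow> ?E w w' z z' x = Cwz"
    using hypergeometric_wronskian_constant[of w w' w'' z z' z'' g h "c * d"] dw dz ow oz by fastforce
  obtain Cwy where Cwy: "\<And>x. x \<in> {0<..<1} \<Longrightarrow> ?E w w' y y' x = Cwy"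
    using hypergeometric_wronskian_constant[of w w' w'' y y' y'' g h "c * d"] dw dy ow oy by fastforce
  have Gh: "rGamma h * Gamma h = 1"
    by (rule rGamma_mult_Gamma[OF h])
  have cont: "isCont u x0 \<Longrightarrow> (u \<longlongrightarrow> u x0) (at x0 within S)" for u :: "real \<Rightarrow> real" and x0 S
    by (meson continuous_at_imp_continuous_at_within continuous_within)
  have "Cyz = sin (pi * g) / pi"
  proof (rule constant_eq_limit)
    \<comment> \<open>The powers of \<open>x\<close> cancel, so the expression is continuous at 0,
      with value \<open>rGamma g * ((1 - g) * rGamma (2 - g))\<close>; the reflection formula then
      applies.\<close>
    define G where "G x = (1 - x) powr h * (y x * ((1 - g) * f x + x * f' x) - x * y' x * f x)" for x
    show "G x = Cyz" if x: "x \<in> {0<..<1}" for x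
    proof -
      have "x powr g * (x powr (- g)) = 1" "x powr g * (x powr (1 - g)) = x"
        using x by (simp_all flip: powr_add)
      then have "?E y y' z z' x = G x"
        unfolding z_def z'_def G_def by (simp add: algebra_simps) algebra
      then show ?thesis using Cyz[OF x] by simp
    qed
    have "isCont G 0" unfolding G_def
      using dy[of 0] df[of 0] by (intro continuous_intros) (auto intro: DERIV_isCont)
    then have "(G \<longlongrightarrow> G 0) (at_right 0)" by (rule cont)
    moreover have "G 0 = sin (pi * g) / pi"
      using rGamma_plus1[of "1 - g"] rGamma_reflection_real[of g] by (simp add: G_def y_def f_def hyp2F1_reg_0 g'_def)
    ultimately show "(G \<longlongrightarrow> sin (pi * g) / pi) (at_right 0)" by simp
  qed simp
  moreover have wlim: "(w \<longlongrightarrow> rGamma h) (at_left 1)" "(w' \<longlongrightarrow> w' 1) (at_left 1)"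
    using cont[OF DERIV_isCont[OF dw(1)], of 1] cont[OF DERIV_isCont[OF dw(2)], of 1]
    by (simp_all add: w_def hyp2F1_reg_0)
  \<comment> \<open>The derivative series have exponent exactly \<open>h\<close> at 1, the series
    themselves only \<open>h - 1\<close>. Under the weight (1 - x)^h only the terms with a
    differentiated \<open>y\<close> or \<open>f\<close> survive.\<close>
  have e1: "c + 1 + (d + 1) - (g + 1) = h" "c + d - g + 1 = h"
    "c' + 1 + (d' + 1) - (g' + 1) = h" "c' + d' - g' + 1 = h"
    using sum by (simp_all add: c'_def d'_def g'_def)
  have lim: "((\<lambda>x. (1 - x) powr h * y' x) \<longlongrightarrow> Gamma h * rGamma c * rGamma d) (at_left 1)"
    "((\<lambda>x. (1 - x) powr h * f' x) \<longlongrightarrow> Gamma h * rGamma c' * rGamma d') (at_left 1)"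
    using tendsto_mult[OF tendsto_const hyp2F1_reg_at_left_1[of "c + 1" "d + 1" "g + 1"], of "c * d"]
      tendsto_mult[OF tendsto_const hyp2F1_reg_at_left_1[of "c' + 1" "d' + 1" "g' + 1"], of "c' * d'"]
      gint h rGamma_plus1[of c, symmetric] rGamma_plus1[of d, symmetric]
      rGamma_plus1[of c', symmetric] rGamma_plus1[of d', symmetric]
    unfolding e1 y'_def f'_def by (simp_all add: mult_ac)
  have lim0: "((\<lambda>x. (1 - x) powr h * y x) \<longlongrightarrow> 0) (at_left 1)"
    "((\<lambda>x. (1 - x) powr h * f x) \<longlongrightarrow> 0) (at_left 1)"
    using hyp2F1_reg_at_left_1_zero[of c d g] hyp2F1_reg_at_left_1_zero[of c' d' g'] gint h
    unfolding e1 y_def f_def by simp_all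
  have "Cwy = rGamma c * rGamma d"
  proof (rule constant_eq_limit)
    show "x powr g * (w x * ((1 - x) powr h * y' x) - w' x * ((1 - x) powr h * y x)) = Cwy"
      if x: "x \<in> {0<..<1}" for x
      using Cwy[OF x] by (simp add: algebra_simps)
    have "((\<lambda>x. x powr g * (w x * ((1 - x) powr h * y' x) - w' x * ((1 - x) powr h * y x)))
      \<longlongrightarrow> 1 powr g * (rGamma h * (Gamma h * rGamma c * rGamma d) - w' 1 * 0)) (at_left 1)"
      by (intro tendsto_intros wlim lim lim0) auto
    then show "((\<lambda>x. x powr g * (w x * ((1 - x) powr h * y' x) - w' x * ((1 - x) powr h * y x)))
      \<longlongrightarrow> rGamma c * rGamma d) (at_left 1)"
      using Gh by (simp add: mult.assoc[symmetric])
  qed simp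
  moreover have "Cwz = rGamma c' * rGamma d'"
  proof (rule constant_eq_limit)
    define G where "G x = w x * ((1 - g) * ((1 - x) powr h * f x) + x * ((1 - x) powr h * f' x))
        - w' x * (x * ((1 - x) powr h * f x))" for x
    show "G x = Cwz" if x: "x \<in> {0<..<1}" for x
    proof -
      have "x powr g * (x powr (- g)) = 1" "x powr g * (x powr (1 - g)) = x"
        using x by (simp_all flip: powr_add)
      then have "?E w w' z z' x = G x"
        unfolding z_def z'_def G_def by (simp add: algebra_simps) algebra
      then show ?thesis using Cwz[OF x] by simp
    qed
    have "(G \<longlongrightarrow> rGamma h * ((1 - g) * 0 + 1 * (Gamma h * rGamma c' * rGamma d')) - w' 1 * (1 * 0)) (at_left 1)"
      unfolding G_def by (intro tendsto_intros wlim lim lim0)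
    then show "(G \<longlongrightarrow> rGamma c' * rGamma d') (at_left 1)"
      using Gh by (simp add: mult.assoc[symmetric])
  qed simp
  \<comment> \<open>For any three functions W(y,z) w - W(w,z) y + W(w,y) z = 0: it is the expansion
    of a determinant with a repeated row.\<close>
  moreover have "Cyz * w x = Cwz * y x - Cwy * z x"
    using Cyz[of x] Cwz[of x] Cwy[of x] x by (simp add: algebra_simps flip: Cyz Cwz Cwy)
  ultimately show ?thesis
    by (simp add: w_def y_def z_def f_def c'_def d'_def g'_def)
qed

section \<open>Regularised balanced series\<close>

text \<open>Dividing by the Gamma functions of the lower parameters makes the series an entire function
  of the parameters on the hyperplane of balanced series.\<close>

definition hyp4F3_term :: "'a::Gamma \<Rightarrow> 'a \<Rightarrow> 'a \<Rightarrow> 'a \<Rightarrow> 'a \<Rightarrow> 'a \<Rightarrow> 'a \<Rightarrow> nat \<Rightarrow> 'a" where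
  "hyp4F3_term a b c d e f g n =
     pochhammer a n * pochhammer b n * pochhammer c n * pochhammer d n / fact n
       * (rGamma (e + of_nat n) * rGamma (f + of_nat n) * rGamma (g + of_nat n))"

definition hyp4F3_reg :: "'a::Gamma \<Rightarrow> 'a \<Rightarrow> 'a \<Rightarrow> 'a \<Rightarrow> 'a \<Rightarrow> 'a \<Rightarrow> 'a \<Rightarrow> 'a" where
  "hyp4F3_reg a b c d e f g = (\<Sum>n. hyp4F3_term a b c d e f g n)"

lemma hyp4F3_term_Suc:
  "(1 + of_nat n) * (e + of_nat n) * (f + of_nat n) * (g + of_nat n) * hyp4F3_term a b c d e f g (Suc n)
   = (a + of_nat n) * (b + of_nat n) * (c + of_nat n) * (d + of_nat n) * hyp4F3_term a b c d e f g n"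
proof -
  define P where "P = pochhammer a n * pochhammer b n * pochhammer c n * pochhammer d n / fact n"
  have r: "rGamma (x + of_nat n) = (x + of_nat n) * rGamma (x + of_nat (Suc n))" for x :: 'a
    using rGamma_plus1[of "x + of_nat n"] by (simp add: add_ac)
  have "hyp4F3_term a b c d e f g n = P * ((e + of_nat n) * (f + of_nat n) * (g + of_nat n)
      * (rGamma (e + of_nat (Suc n)) * rGamma (f + of_nat (Suc n)) * rGamma (g + of_nat (Suc n))))"
    unfolding hyp4F3_term_def P_def r[of e] r[of f] r[of g] by (simp only: mult_ac)
  moreover have "hyp4F3_term a b c d e f g (Suc n)
      = (a + of_nat n) * (b + of_nat n) * (c + of_nat n) * (d + of_nat n) * P
        * (rGamma (e + of_nat (Suc n)) * rGamma (f + of_nat (Suc n)) * rGamma (g + of_nat (Suc n))) / (1 + of_nat n)"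
    unfolding hyp4F3_term_def P_def pochhammer_Suc fact_Suc of_nat_Suc by (simp add: mult_ac)
  moreover have "1 + of_nat n \<noteq> (0 :: 'a)"
    by (metis of_nat_Suc of_nat_neq_0)
  ultimately show ?thesis by (simp add: mult_ac)
qed

text \<open>The linear term is \<open>Re w\<close> and not \<open>norm w\<close>: in a product of
  such factors the linear terms can then add up to the balancing condition.\<close>

lemma norm_one_plus_le_exp: "norm (1 + w) \<le> exp (Re w + (norm w)\<^sup>2 / 2)" for w :: complex
proof (rule power2_le_imp_le)
  have "(norm (1 + w))\<^sup>2 = 1 + (2 * Re w + (norm w)\<^sup>2)"
    by (simp add: cmod_power2 power2_sum)
  also have "\<dots> \<le> exp (2 * Re w + (norm w)\<^sup>2)" by (rule exp_ge_add_one_self)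
  also have "\<dots> = (exp (Re w + (norm w)\<^sup>2 / 2))\<^sup>2"
    by (simp flip: exp_of_nat_mult exp_double add: algebra_simps)
  finally show "(norm (1 + w))\<^sup>2 \<le> (exp (Re w + (norm w)\<^sup>2 / 2))\<^sup>2" .
qed simp

text \<open>The previous bound is applied to \<open>v\<close> with 1 + v = 1/(1 + w). The constant 4
  is 2 from the second-order term of \<open>v\<close> plus 2 from
  \<open>(norm v)\<^sup>2 / 2\<close>.\<close>

lemma inverse_norm_one_plus_le_exp:
  fixes w :: complex
  assumes "norm w \<le> 1 / 2"
  shows "1 / norm (1 + w) \<le> exp (- Re w + 4 * (norm w)\<^sup>2)"
proof -
  have n: "norm (1 + w) \<ge> 1 / 2"
    using norm_triangle_ineq2[of 1 "- w"] assms by simp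
  then have nz: "1 + w \<noteq> 0" by auto
  define v where "v = - w / (1 + w)"
  have v: "1 + v = 1 / (1 + w)" "v = - w + w\<^sup>2 / (1 + w)"
    using nz by (simp_all add: v_def field_simps power2_eq_square)
  have i: "1 / norm (1 + w) \<le> 2"
    using n le_imp_inverse_le[OF n] by (simp add: inverse_eq_divide)
  have "norm v = norm w * (1 / norm (1 + w))" by (simp add: v_def norm_divide)
  also have "\<dots> \<le> norm w * 2" by (intro mult_left_mono i) auto
  finally have "(norm v)\<^sup>2 \<le> (norm w * 2)\<^sup>2" by (intro power_mono) auto
  then have nv: "(norm v)\<^sup>2 / 2 \<le> 2 * (norm w)\<^sup>2" by (simp add: power_mult_distrib)
  have "Re (w\<^sup>2 / (1 + w)) \<le> norm (w\<^sup>2 / (1 + w))" by (rule complex_Re_le_cmod)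
  also have "\<dots> = (norm w)\<^sup>2 * (1 / norm (1 + w))" by (simp add: norm_divide norm_power)
  also have "\<dots> \<le> (norm w)\<^sup>2 * 2" by (intro mult_left_mono i) auto
  finally have "Re v \<le> - Re w + 2 * (norm w)\<^sup>2" unfolding v(2) by simp
  then have "exp (Re v + (norm v)\<^sup>2 / 2) \<le> exp (- Re w + 4 * (norm w)\<^sup>2)"
    using nv by simp
  moreover have "1 / norm (1 + w) = norm (1 + v)" by (simp add: v(1) norm_divide)
  ultimately show ?thesis using norm_one_plus_le_exp[of v] by linarith
qed

text \<open>The ratio of consecutive terms is \<open>1 - 2/n + O(1/n\<^sup>2)\<close> uniformly for bounded parameters; giving
  up part of the exponent absorbs the error term.\<close>

lemma hyp4F3_term_bound:
  fixes a b c d e f g :: complex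
  assumes M: "M \<ge> 1" "norm a \<le> M" "norm b \<le> M" "norm c \<le> M" "norm d \<le> M" "norm e \<le> M" "norm f \<le> M" "norm g \<le> M"
    and V: "e + f + g - a - b - c - d = 1"
    and N: "36 * M\<^sup>2 \<le> real N" and n: "n \<ge> N"
  shows "norm (hyp4F3_term a b c d e f g n)
           \<le> norm (hyp4F3_term a b c d e f g N) * real N powr (3/2) * real n powr (- (3/2))"
proof -
  define T where "T n = norm (hyp4F3_term a b c d e f g n)" for n
  have N1: "N \<ge> 1" using N M(1) by (metis Suc_leI gr0I linorder_not_le mult_pos_pos of_nat_0 of_nat_1 zero_less_numeral zero_less_power less_le_trans zero_less_one One_nat_def)
  have step: "T (Suc n) * real (Suc n) powr (3/2) \<le> T n * real n powr (3/2)" if n: "n \<ge> N" for n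
  proof -
    define x where "x = complex_of_real (1 / real n)"
    have n1: "n \<ge> 1" using n N1 by simp
    have nN: "36 * M\<^sup>2 \<le> real n" using N n by linarith
    have nM: "2 * M \<le> real n"
    proof -
      have "2 * M \<le> 36 * M * M" using M(1) by (intro mult_mono) auto
      then show ?thesis using nN by (simp add: power2_eq_square)
    qed
    have nx: "of_nat n * x = 1" "norm x = 1 / real n" using n1 by (simp_all add: x_def norm_divide)
    have small: "norm (p * x) \<le> M / n" "norm (p * x) \<le> 1 / 2" "(norm (p * x))\<^sup>2 \<le> M\<^sup>2 / real n ^ 2"
      if "norm p \<le> M" for p
    proof -
      show 1: "norm (p * x) \<le> M / n" using that n1 by (simp add: norm_mult nx divide_right_mono)
      also have "\<dots> \<le> 1 / 2" using nM n1 by (simp add: field_simps)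
      finally show "norm (p * x) \<le> 1 / 2" .
      show "(norm (p * x))\<^sup>2 \<le> M\<^sup>2 / real n ^ 2"
        using power_mono[OF 1, of 2] by (simp add: power_divide)
    qed
    have num: "norm (1 + p * x) \<le> exp (Re p / n + M\<^sup>2 / real n ^ 2 / 2)" if "norm p \<le> M" for p
      using norm_one_plus_le_exp[of "p * x"] small(3)[OF that]
      by (intro order.trans[OF norm_one_plus_le_exp]) (simp add: x_def)
    have den: "1 / norm (1 + p * x) \<le> exp (- Re p / n + 4 * (M\<^sup>2 / real n ^ 2))" if "norm p \<le> M" for p
      using small(3)[OF that]
      by (intro order.trans[OF inverse_norm_one_plus_le_exp[OF small(2)[OF that]]]) (simp add: x_def)
    have sc: "p + of_nat n = of_nat n * (1 + p * x)" for p
      using nx(1) by (simp add: algebra_simps)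
    have pos: "norm (1 + p * x) > 0" if "norm p \<le> M" for p
    proof -
      have "norm (p * x) < 1" using small(2)[OF that] by simp
      then have "1 + p * x \<noteq> 0" by (metis add_eq_0_iff norm_minus_cancel norm_one less_irrefl)
      then show ?thesis by simp
    qed
    have n0: "norm (1::complex) \<le> M" using M by simp
    let ?A = "norm (1 + a * x) * norm (1 + b * x) * (norm (1 + c * x) * norm (1 + d * x))"
    let ?B = "norm (1 + 1 * x) * norm (1 + e * x) * (norm (1 + f * x) * norm (1 + g * x))"
    have "norm ((1 + of_nat n) * (e + of_nat n) * (f + of_nat n) * (g + of_nat n) * hyp4F3_term a b c d e f g (Suc n))
      = norm ((a + of_nat n) * (b + of_nat n) * (c + of_nat n) * (d + of_nat n) * hyp4F3_term a b c d e f g n)"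
      by (simp only: hyp4F3_term_Suc)
    then have "real n ^ 4 * ?B * T (Suc n) = real n ^ 4 * ?A * T n"
      unfolding sc norm_mult T_def by (simp add: power4_eq_xxxx mult_ac)
    then have "?B * T (Suc n) = ?A * T n" using n1 by simp
    moreover have "?B > 0" by (intro mult_pos_pos pos n0 M)
    ultimately have "T (Suc n) = ?A * T n / ?B" by (simp only: field_simps)
    also have "\<dots> = ?A * (1 / norm (1 + 1 * x) * (1 / norm (1 + e * x)) * (1 / norm (1 + f * x) * (1 / norm (1 + g * x)))) * T n"
      by simp
    also have "\<dots> \<le> (exp (Re a / n + M\<^sup>2 / real n ^ 2 / 2) * exp (Re b / n + M\<^sup>2 / real n ^ 2 / 2)
          * (exp (Re c / n + M\<^sup>2 / real n ^ 2 / 2) * exp (Re d / n + M\<^sup>2 / real n ^ 2 / 2)))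
        * (exp (- Re 1 / n + 4 * (M\<^sup>2 / real n ^ 2)) * exp (- Re e / n + 4 * (M\<^sup>2 / real n ^ 2))
          * (exp (- Re f / n + 4 * (M\<^sup>2 / real n ^ 2)) * exp (- Re g / n + 4 * (M\<^sup>2 / real n ^ 2)))) * T n"
      by (intro mult_mono num den n0 M mult_nonneg_nonneg) (auto simp: T_def)
    also have "\<dots> = exp (Re (a + b + c + d - 1 - e - f - g) / n + 18 * (M\<^sup>2 / real n ^ 2)) * T n"
      by (simp add: add_divide_distrib diff_divide_distrib flip: exp_add)
    also have "a + b + c + d - 1 - e - f - g = - 2" using V by (simp add: algebra_simps)
    \<comment> \<open>The 18 collects four numerator errors of 1/2 and four denominator errors of 4;
      the factorial supplies the fourth denominator factor. The threshold
      \<open>36 * M\<^sup>2\<close> makes the total error at most 1/(2n), which leaves -3/2 of the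
      exponent -2.\<close>
    also have "exp (Re (- 2) / n + 18 * (M\<^sup>2 / real n ^ 2)) \<le> exp (- (3 / 2) / n)"
    proof -
      have "18 * (M\<^sup>2 / real n ^ 2) = (36 * M\<^sup>2) / real n ^ 2 / 2" by simp
      also have "\<dots> \<le> real n / real n ^ 2 / 2" using nN by (intro divide_right_mono) auto
      also have "\<dots> = 1 / 2 / n" using n1 by (simp add: power2_eq_square)
      finally show ?thesis using n1 by (simp add: field_simps)
    qed
    finally have TS: "T (Suc n) \<le> exp (- (3 / 2) / n) * T n" by (simp add: T_def mult_right_mono)
    have "real (Suc n) = real n * (1 + 1 / n)" using n1 by (simp add: distrib_left)
    then have "real (Suc n) powr (3/2) = real n powr (3/2) * (1 + 1 / n) powr (3/2)"
      by (simp only: powr_mult)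
    also have "(1 + 1 / real n) powr (3/2) \<le> exp (1 / n) powr (3/2)"
      by (intro powr_mono2) auto
    also have "\<dots> = exp ((3 / 2) / n)" by (simp add: powr_def)
    finally have "real (Suc n) powr (3/2) \<le> real n powr (3/2) * exp ((3 / 2) / n)"
      by (simp add: mult_left_mono)
    then have "T (Suc n) * real (Suc n) powr (3/2) \<le> (exp (- (3 / 2) / n) * T n) * (real n powr (3/2) * exp ((3 / 2) / n))"
      using TS by (intro mult_mono) (auto simp: T_def)
    also have "\<dots> = (exp (- (3 / 2) / n) * exp ((3 / 2) / n)) * (T n * real n powr (3/2))" by (simp only: mult_ac)
    also have "\<dots> = T n * real n powr (3/2)" by (simp flip: exp_add)
    finally show ?thesis .
  qed
  have "T n * real n powr (3/2) \<le> T N * real N powr (3/2)" using n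
    by (induction rule: dec_induct) (use step in \<open>force intro: order.trans\<close>)+
  then have "T n * real n powr (3/2) * real n powr (- (3/2)) \<le> T N * real N powr (3/2) * real n powr (- (3/2))"
    by (intro mult_right_mono) auto
  moreover have "real n powr (3/2) * real n powr (- (3/2)) = 1" using n N1 by (simp flip: powr_add)
  ultimately show ?thesis unfolding T_def by (simp add: mult.assoc)
qed

lemma summable_powr_three_halves: "summable (\<lambda>n. B * real n powr (- (3/2)))"
  by (intro summable_mult) (simp add: summable_real_powr_iff)

lemma hyp4F3_reg_sums:
  fixes a b c d e f g :: complex
  assumes V: "e + f + g - a - b - c - d = 1"
  shows "hyp4F3_term a b c d e f g sums hyp4F3_reg a b c d e f g"
proof -
  define M where "M = 1 + norm a + norm b + norm c + norm d + norm e + norm f + norm g"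
  obtain N where N: "36 * M\<^sup>2 \<le> real N" using real_arch_simple by blast
  have "summable (hyp4F3_term a b c d e f g)"
    by (rule summable_comparison_test'[OF summable_powr_three_halves, of N])
       (rule hyp4F3_term_bound[OF _ _ _ _ _ _ _ _ V N], auto simp: M_def)
  then show ?thesis unfolding hyp4F3_reg_def by (rule summable_sums)
qed

lemma holomorphic_hyp4F3_term:
  assumes "a holomorphic_on A" "b holomorphic_on A" "c holomorphic_on A" "d holomorphic_on A"
    "e holomorphic_on A" "f holomorphic_on A" "g holomorphic_on A"
  shows "(\<lambda>z. hyp4F3_term (a z) (b z) (c z) (d z) (e z) (f z) (g z) n) holomorphic_on A"
  unfolding hyp4F3_term_def pochhammer_prod by (intro holomorphic_intros assms) auto

text \<open>Formulated along entire curves in the balanced hyperplane, because later arguments move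
  one variable at a time or along a line. On a unit disc \<open>M\<close>, and hence
  \<open>N\<close>, can be chosen uniformly, so the tail has a common summable majorant and the
  Weierstrass test applies.\<close>

lemma holomorphic_hyp4F3_reg:
  assumes hol: "a holomorphic_on UNIV" "b holomorphic_on UNIV" "c holomorphic_on UNIV" "d holomorphic_on UNIV"
    "e holomorphic_on UNIV" "f holomorphic_on UNIV" "g holomorphic_on UNIV"
    and V: "\<And>z. e z + f z + g z - a z - b z - c z - d z = 1"
  shows "(\<lambda>z. hyp4F3_reg (a z) (b z) (c z) (d z) (e z) (f z) (g z)) holomorphic_on UNIV"
proof (rule holomorphic_uniform_sequence[OF open_UNIV])
  let ?T = "\<lambda>n z. hyp4F3_term (a z) (b z) (c z) (d z) (e z) (f z) (g z) n"
  show "(\<lambda>z. \<Sum>i<n. ?T i z) holomorphic_on UNIV" for n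
    by (intro holomorphic_on_sum holomorphic_hyp4F3_term hol)
  fix z0 :: complex
  have bdd: "\<exists>B. \<forall>z\<in>cball z0 1. norm (u z) \<le> B" if "u holomorphic_on UNIV" for u :: "complex \<Rightarrow> complex"
  proof -
    have "compact (u ` cball z0 1)"
      by (intro compact_continuous_image holomorphic_on_imp_continuous_on holomorphic_on_subset[OF that]) auto
    then show ?thesis by (auto dest!: compact_imp_bounded simp: bounded_iff)
  qed
  obtain Ba Bb Bc Bd Be Bf Bg where B:
    "\<And>z. z \<in> cball z0 1 \<Longrightarrow> norm (a z) \<le> Ba \<and> norm (b z) \<le> Bb \<and> norm (c z) \<le> Bc \<and> norm (d z) \<le> Bd
      \<and> norm (e z) \<le> Be \<and> norm (f z) \<le> Bf \<and> norm (g z) \<le> Bg"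
    using hol[THEN bdd] by metis
  define M where "M = 1 + \<bar>Ba\<bar> + \<bar>Bb\<bar> + \<bar>Bc\<bar> + \<bar>Bd\<bar> + \<bar>Be\<bar> + \<bar>Bf\<bar> + \<bar>Bg\<bar>"
  obtain N where N: "36 * M\<^sup>2 \<le> real N" using real_arch_simple by blast
  obtain C where C: "\<And>z. z \<in> cball z0 1 \<Longrightarrow> norm (?T N z) \<le> C"
    using bdd[OF holomorphic_hyp4F3_term[OF hol]] by blast
  have "norm (?T n z) \<le> C * real N powr (3/2) * real n powr (- (3/2))" if z: "z \<in> cball z0 1" and n: "n \<ge> N" for n z
  proof -
    have "norm (?T n z) \<le> norm (?T N z) * real N powr (3/2) * real n powr (- (3/2))"
      by (rule hyp4F3_term_bound[OF _ _ _ _ _ _ _ _ V N n]) (use B[OF z] in \<open>auto simp: M_def\<close>)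
    also have "\<dots> \<le> C * real N powr (3/2) * real n powr (- (3/2))"
      by (intro mult_right_mono C z) auto
    finally show ?thesis .
  qed
  then have "uniform_limit (cball z0 1) (\<lambda>n z. \<Sum>i<n. ?T i z) (\<lambda>z. \<Sum>i. ?T i z) sequentially"
    by (intro Weierstrass_m_test_ev[OF _ summable_powr_three_halves])
       (auto intro!: eventually_sequentiallyI[of N])
  then show "\<exists>r. 0 < r \<and> cball z0 r \<subseteq> UNIV \<and> uniform_limit (cball z0 r) (\<lambda>n z. \<Sum>i<n. ?T i z)
      (\<lambda>z. hyp4F3_reg (a z) (b z) (c z) (d z) (e z) (f z) (g z)) sequentially"
    unfolding hyp4F3_reg_def by (intro exI[of _ 1]) auto
qed

lemma hyp4F3_term_of_real:
  "hyp4F3_term (complex_of_real a) (of_real b) (of_real c) (of_real d) (of_real e) (of_real f) (of_real g) n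
     = of_real (hyp4F3_term a b c d e f g n)"
proof -
  have "rGamma (complex_of_real x + of_nat n) = of_real (rGamma (x + real n))" for x
    using rGamma_complex_of_real[of "x + real n"] by simp
  then show ?thesis by (simp add: hyp4F3_term_def pochhammer_of_real)
qed

lemma
  fixes a b c d e f g :: real
  assumes V: "e + f + g - a - b - c - d = 1"
  shows hyp4F3_reg_sums_real: "hyp4F3_term a b c d e f g sums hyp4F3_reg a b c d e f g"
    and hyp4F3_reg_of_real: "hyp4F3_reg (complex_of_real a) (of_real b) (of_real c) (of_real d) (of_real e) (of_real f) (of_real g)
     = of_real (hyp4F3_reg a b c d e f g)"
proof -
  have "complex_of_real e + of_real f + of_real g - of_real a - of_real b - of_real c - of_real d = of_real (e + f + g - a - b - c - d)"
    by simp
  also have "\<dots> = 1" using V by simp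
  finally have s: "(\<lambda>n. of_real (hyp4F3_term a b c d e f g n)) sums
      hyp4F3_reg (complex_of_real a) (of_real b) (of_real c) (of_real d) (of_real e) (of_real f) (of_real g)"
    using hyp4F3_reg_sums by (simp add: hyp4F3_term_of_real[abs_def, symmetric])
  then show "hyp4F3_term a b c d e f g sums hyp4F3_reg a b c d e f g"
    unfolding hyp4F3_reg_def using sums_summable summable_complex_of_real by (blast intro: summable_sums)
  then have "(\<lambda>n. complex_of_real (hyp4F3_term a b c d e f g n)) sums of_real (hyp4F3_reg a b c d e f g)"
    by (simp add: sums_of_real_iff)
  with s show "hyp4F3_reg (complex_of_real a) (of_real b) (of_real c) (of_real d) (of_real e) (of_real f) (of_real g)
     = of_real (hyp4F3_reg a b c d e f g)"
    by (rule sums_unique2)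
qed

section \<open>Integral representation\<close>

text \<open>Monotone convergence, used when the series of integrals is known to converge: it yields
  integrability of the sum.\<close>

lemma has_integral_nonneg_sums:
  fixes f :: "nat \<Rightarrow> real \<Rightarrow> real"
  assumes "\<And>n x. x \<in> S \<Longrightarrow> f n x \<ge> 0" "\<And>n. (f n has_integral c n) S"
    and "\<And>x. x \<in> S \<Longrightarrow> (\<lambda>n. f n x) sums g x" "c sums C"
  shows "(g has_integral C) S"
proof (rule has_integral_monotone_convergence_increasing)
  show "((\<lambda>x. \<Sum>n<k. f n x) has_integral (\<Sum>n<k. c n)) S" for k
    using assms(2) by (intro has_integral_sum) auto
qed (use assms in \<open>auto simp: sums_def\<close>)

text \<open>Monotone convergence in the opposite direction: the known integral of the sum bounds the
  partial sums, and thereby evaluates a series in closed form.\<close>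

lemma nonneg_sums_of_has_integral:
  fixes f :: "nat \<Rightarrow> real \<Rightarrow> real"
  assumes nn: "\<And>n x. x \<in> S \<Longrightarrow> f n x \<ge> 0" and f: "\<And>n. (f n has_integral c n) S"
    and s: "\<And>x. x \<in> S \<Longrightarrow> (\<lambda>n. f n x) sums g x" and g: "(g has_integral G) S"
  shows "c sums G"
proof -
  have F: "((\<lambda>x. \<Sum>n<k. f n x) has_integral (\<Sum>n<k. c n)) S" for k
    using f by (intro has_integral_sum) auto
  have i: "integral S (\<lambda>x. \<Sum>n<k. f n x) = (\<Sum>n<k. c n)" for k
    by (rule integral_unique[OF F])
  have "g integrable_on S \<and> (\<lambda>k. integral S (\<lambda>x. \<Sum>n<k. f n x)) \<longlonglongrightarrow> integral S g"
  proof (rule monotone_convergence_increasing)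
    have "\<bar>\<Sum>n<k. c n\<bar> \<le> G" for k
    proof -
      have "(\<Sum>n<k. c n) \<ge> 0" using F by (rule has_integral_nonneg) (auto intro: sum_nonneg nn)
      moreover have "(\<Sum>n<k. c n) \<le> G"
      proof (rule has_integral_le[OF F g])
        fix x assume x: "x \<in> S"
        have "(\<Sum>n<k. f n x) \<le> (\<Sum>n. f n x)"
          using s[OF x] nn[OF x] by (intro sum_le_suminf) (auto simp: sums_iff)
        then show "(\<Sum>n<k. f n x) \<le> g x" using sums_unique[OF s[OF x]] by simp
      qed
      ultimately show ?thesis by simp
    qed
    then show "bounded (range (\<lambda>k. integral S (\<lambda>x. \<Sum>n<k. f n x)))"
      unfolding i by (auto simp: bounded_iff)
  qed (use F s nn in \<open>auto simp: sums_def\<close>)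
  then show ?thesis unfolding i integral_unique[OF g] sums_def by blast
qed

lemma has_integral_Beta_Ioo:
  fixes s t :: real
  assumes "s > 0" "t > 0"
  shows "((\<lambda>x. x powr (s - 1) * (1 - x) powr (t - 1)) has_integral Gamma s * Gamma t * rGamma (s + t)) {0<..<1}"
  using has_integral_Beta_real[OF assms] by (simp add: has_integral_Icc_iff_Ioo Beta_altdef)

lemma powr_minus_one_mult_power:
  fixes x s :: real
  assumes "x > 0"
  shows "x powr (s - 1) * x ^ n = x powr (s + real n - 1)"
  using assms by (simp add: powr_diff powr_add powr_realpow)

lemma Gamma_eq_pochhammer:
  fixes b :: real
  assumes "b > 0"
  shows "Gamma (b + real n) = pochhammer b n * Gamma b"
proof -
  have "b \<notin> \<int>\<^sub>\<le>\<^sub>0" using assms by auto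
  then show ?thesis using pochhammer_Gamma[of b n] Gamma_real_pos[OF assms] by (simp add: field_simps)
qed

text \<open>Gauss's summation theorem for positive parameters. Expanding (1 - x)^(-a) inside a Beta
  integral and integrating termwise produces the coefficients; the unexpanded integrand is a Beta
  integral again.\<close>

lemma gauss_coeff_sums:
  fixes a b h :: real
  assumes "a > 0" "b > 0" "h - a - b > 0"
  shows "gauss_coeff a b h sums (Gamma (h - a - b) * rGamma (h - a) * rGamma (h - b))"
proof -
  let ?f = "\<lambda>n x. pochhammer a n / fact n * x ^ n * (x powr (b - 1) * (1 - x) powr (h - b - 1))"
  have f: "(?f n has_integral Gamma b * Gamma (h - b) * gauss_coeff a b h n) {0<..<1}" for n
  proof -
    have "((\<lambda>x. pochhammer a n / fact n * (x powr (b + real n - 1) * (1 - x) powr (h - b - 1)))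
        has_integral pochhammer a n / fact n * (Gamma (b + real n) * Gamma (h - b) * rGamma (b + real n + (h - b)))) {0<..<1}"
      by (intro has_integral_mult_right has_integral_Beta_Ioo) (use assms in auto)
    moreover have "pochhammer a n / fact n * (Gamma (b + real n) * Gamma (h - b) * rGamma (b + real n + (h - b)))
        = Gamma b * Gamma (h - b) * gauss_coeff a b h n"
      using assms by (simp add: gauss_coeff_def Gamma_eq_pochhammer add.commute)
    ultimately show ?thesis
      by (simp only:) (erule has_integral_eq[rotated], simp add: powr_minus_one_mult_power[symmetric] mult_ac)
  qed
  have "((\<lambda>x. x powr (b - 1) * (1 - x) powr (h - a - b - 1)) has_integral Gamma b * Gamma (h - a - b) * rGamma (b + (h - a - b))) {0<..<1}"
    by (intro has_integral_Beta_Ioo) (use assms in auto)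
  moreover have "(\<lambda>n. ?f n x) sums (x powr (b - 1) * (1 - x) powr (h - a - b - 1))" if x: "x \<in> {0<..<1}" for x
  proof -
    have "(\<lambda>n. ?f n x) sums ((1 - x) powr (- a) * (x powr (b - 1) * (1 - x) powr (h - b - 1)))"
      by (intro sums_mult2 sums_pochhammer_powr) (use x in auto)
    also have "(1 - x) powr (- a) * (x powr (b - 1) * (1 - x) powr (h - b - 1))
        = x powr (b - 1) * ((1 - x) powr (- a) * (1 - x) powr (h - b - 1))" by (simp only: mult_ac)
    also have "(1 - x) powr (- a) * (1 - x) powr (h - b - 1) = (1 - x) powr (h - a - b - 1)"
      by (simp flip: powr_add add: algebra_simps)
    finally show ?thesis .
  qed
  ultimately have "(\<lambda>n. Gamma b * Gamma (h - b) * gauss_coeff a b h n) sums (Gamma b * Gamma (h - a - b) * rGamma (b + (h - a - b)))"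
    using assms by (intro nonneg_sums_of_has_integral[OF _ f]) (auto simp: pochhammer_nonneg)
  then have "(\<lambda>n. rGamma b * rGamma (h - b) * (Gamma b * Gamma (h - b) * gauss_coeff a b h n))
      sums (rGamma b * rGamma (h - b) * (Gamma b * Gamma (h - a - b) * rGamma (b + (h - a - b))))"
    by (rule sums_mult)
  moreover have r: "rGamma b * Gamma b = 1" "rGamma (h - b) * Gamma (h - b) = 1"
    using assms by (auto intro!: rGamma_mult_Gamma)
  have "rGamma b * rGamma (h - b) * (Gamma b * Gamma (h - b) * gauss_coeff a b h n) = gauss_coeff a b h n" for n
    using r by algebra
  moreover have "b + (h - a - b) = h - a" by simp
  then have "rGamma b * rGamma (h - b) * (Gamma b * Gamma (h - a - b) * rGamma (b + (h - a - b)))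
      = Gamma (h - a - b) * rGamma (h - a) * rGamma (h - b)"
    using r by (simp only:) algebra
  ultimately show ?thesis by (simp only:)
qed

lemma gauss_coeff_nonneg:
  "a > 0 \<Longrightarrow> b > 0 \<Longrightarrow> h > 0 \<Longrightarrow> gauss_coeff a b h n \<ge> 0"
  by (simp add: gauss_coeff_def pochhammer_nonneg rGamma_inverse_Gamma Gamma_real_pos less_imp_le)

lemma hyp2F1_reg_nonneg:
  assumes "a > 0" "b > 0" "h > 0" "0 \<le> x" "x < 1"
  shows "hyp2F1_reg a b h x \<ge> 0"
  unfolding hyp2F1_reg_def
  by (intro suminf_nonneg summable_gauss_coeff mult_nonneg_nonneg gauss_coeff_nonneg) (use assms in auto)

text \<open>Termwise integration in powers of 1 - x replaces \<open>rGamma (h + real n)\<close> by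
  \<open>rGamma (s + h + real n)\<close>, that is, \<open>h\<close> by \<open>s + h\<close> in the
  coefficients; Gauss's theorem sums the result.\<close>

lemma hyp2F1_reg_mellin:
  fixes a b h s :: real
  assumes "a > 0" "b > 0" "h > 0" "s > 0" "s + h - a - b > 0"
  shows "((\<lambda>x. x powr (s - 1) * (1 - x) powr (h - 1) * hyp2F1_reg a b h (1 - x))
     has_integral Gamma s * Gamma (s + h - a - b) * rGamma (s + h - a) * rGamma (s + h - b)) {0<..<1}"
proof (rule has_integral_nonneg_sums)
  let ?f = "\<lambda>n x. x powr (s - 1) * (1 - x) powr (h - 1) * (gauss_coeff a b h n * (1 - x) ^ n)"
  show "?f n x \<ge> 0" if "x \<in> {0<..<1}" for n x
    using that assms by (auto intro!: mult_nonneg_nonneg gauss_coeff_nonneg)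
  show "(?f n has_integral Gamma s * gauss_coeff a b (s + h) n) {0<..<1}" for n
  proof -
    have "((\<lambda>x. gauss_coeff a b h n * (x powr (s - 1) * (1 - x) powr (h + real n - 1)))
        has_integral gauss_coeff a b h n * (Gamma s * Gamma (h + real n) * rGamma (s + (h + real n)))) {0<..<1}"
      by (intro has_integral_mult_right has_integral_Beta_Ioo) (use assms in auto)
    moreover have "rGamma (h + real n) * Gamma (h + real n) = 1"
      using assms by (intro rGamma_mult_Gamma) auto
    then have "gauss_coeff a b h n * (Gamma s * Gamma (h + real n) * rGamma (s + (h + real n)))
        = Gamma s * gauss_coeff a b (s + h) n"
      by (simp add: gauss_coeff_def add.assoc)
    ultimately show ?thesis
      by (simp only:) (erule has_integral_eq[rotated], simp add: powr_minus_one_mult_power[symmetric] mult_ac)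
  qed
  show "(\<lambda>n. ?f n x) sums (x powr (s - 1) * (1 - x) powr (h - 1) * hyp2F1_reg a b h (1 - x))"
    if "x \<in> {0<..<1}" for x
    by (intro sums_mult hyp2F1_reg_sums) (use that in auto)
  show "(\<lambda>n. Gamma s * gauss_coeff a b (s + h) n) sums
      (Gamma s * Gamma (s + h - a - b) * rGamma (s + h - a) * rGamma (s + h - b))"
    using sums_mult[OF gauss_coeff_sums[of a b "s + h"], of "Gamma s"] assms by (simp add: mult.assoc)
qed

text \<open>The second Gauss series is expanded in powers of x. A factor x^n shifts \<open>s\<close>
  to \<open>s + real n\<close> in \<open>hyp2F1_reg_mellin\<close>, so its four Gamma factors become
  the upper parameters \<open>s\<close>, \<open>t\<close> and two lower ones. The relation between
  \<open>g\<close> and \<open>h\<close> is what makes the series balanced.\<close>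

lemma hyp2F1_reg_product_integral:
  fixes a b c d g h s t :: real
  assumes pos: "a > 0" "b > 0" "c > 0" "d > 0" "g > 0" "h > 0" "s > 0" "t > 0"
    and eqs: "g + h = 1 + c + d" "t = s + h - a - b"
  shows "((\<lambda>x. x powr (s - 1) * (1 - x) powr (h - 1) * hyp2F1_reg a b h (1 - x) * hyp2F1_reg c d g x)
     has_integral Gamma s * Gamma t * hyp4F3_reg c d s t g (s + h - a) (s + h - b)) {0<..<1}"
proof (rule has_integral_nonneg_sums)
  let ?f = "\<lambda>n x. x powr (s - 1) * (1 - x) powr (h - 1) * hyp2F1_reg a b h (1 - x) * (gauss_coeff c d g n * x ^ n)"
  show "?f n x \<ge> 0" if "x \<in> {0<..<1}" for n x
    using that pos by (auto intro!: mult_nonneg_nonneg gauss_coeff_nonneg hyp2F1_reg_nonneg)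
  show "(?f n has_integral Gamma s * Gamma t * hyp4F3_term c d s t g (s + h - a) (s + h - b) n) {0<..<1}" for n
  proof -
    have "((\<lambda>x. gauss_coeff c d g n * (x powr (s + real n - 1) * (1 - x) powr (h - 1) * hyp2F1_reg a b h (1 - x)))
        has_integral gauss_coeff c d g n * (Gamma (s + real n) * Gamma (s + real n + h - a - b)
          * rGamma (s + real n + h - a) * rGamma (s + real n + h - b))) {0<..<1}"
      by (intro has_integral_mult_right hyp2F1_reg_mellin) (use pos eqs in auto)
    moreover have "gauss_coeff c d g n * (Gamma (s + real n) * Gamma (s + real n + h - a - b)
          * rGamma (s + real n + h - a) * rGamma (s + real n + h - b))
       = Gamma s * Gamma t * hyp4F3_term c d s t g (s + h - a) (s + h - b) n"
    proof -
      have e: "s + real n + h - a - b = t + real n" "s + real n + h - a = s + h - a + real n"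
        "s + real n + h - b = s + h - b + real n" using eqs by simp_all
      show ?thesis unfolding e(1) unfolding e(2,3)
        by (simp add: hyp4F3_term_def gauss_coeff_def Gamma_eq_pochhammer pos)
    qed
    ultimately show ?thesis
      by (simp only:) (erule has_integral_eq[rotated], simp add: powr_minus_one_mult_power[symmetric] mult_ac)
  qed
  show "(\<lambda>n. ?f n x) sums (x powr (s - 1) * (1 - x) powr (h - 1) * hyp2F1_reg a b h (1 - x) * hyp2F1_reg c d g x)"
    if "x \<in> {0<..<1}" for x
    by (intro sums_mult hyp2F1_reg_sums) (use that in auto)
  show "(\<lambda>n. Gamma s * Gamma t * hyp4F3_term c d s t g (s + h - a) (s + h - b) n) sums
      (Gamma s * Gamma t * hyp4F3_reg c d s t g (s + h - a) (s + h - b))"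
    by (intro sums_mult hyp4F3_reg_sums_real) (use eqs in auto)
qed

section \<open>Relations in a box of real parameters\<close>

text \<open>Up to a factor, \<open>lam4F3\<close> is the integral \<open>gauss_pair_integral\<close> below, and \<open>kap4F3\<close> is \<open>sin (\<pi> a) \<Gamma>(a) K\<close> with
  removable singularities removed.\<close>

definition lam4F3 :: "'a::Gamma \<Rightarrow> 'a \<Rightarrow> 'a \<Rightarrow> 'a \<Rightarrow> 'a \<Rightarrow> 'a \<Rightarrow> 'a \<Rightarrow> 'a" where
  "lam4F3 a b c d e f g =
     hyp4F3_reg a b c d e f g
       * (rGamma (1 + a - e) * rGamma (1 + b - e) * rGamma (1 + c - e) * rGamma (1 + d - e))
     - hyp4F3_reg (1 + a - e) (1 + b - e) (1 + c - e) (1 + d - e) (2 - e) (1 + f - e) (1 + g - e)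
       * (rGamma a * rGamma b * rGamma c * rGamma d)"

definition kap4F3 :: "'a::Gamma \<Rightarrow> 'a \<Rightarrow> 'a \<Rightarrow> 'a \<Rightarrow> 'a \<Rightarrow> 'a \<Rightarrow> 'a \<Rightarrow> 'a" where
  "kap4F3 a b c d e f g =
     rGamma (1 + a - e) * rGamma (1 + a - f) * rGamma (1 + a - g) * hyp4F3_reg a b c d e f g
     + rGamma b * rGamma c * rGamma d
       * hyp4F3_reg a (1 + a - e) (1 + a - f) (1 + a - g) (1 + a - b) (1 + a - c) (1 + a - d)"

definition gauss_pair_integral :: "real \<Rightarrow> real \<Rightarrow> real \<Rightarrow> real \<Rightarrow> real \<Rightarrow> real \<Rightarrow> real" where
  "gauss_pair_integral a b c d h s = integral {0<..<1}
     (\<lambda>x. x powr (s - 1) * (1 - x) powr (h - 1) * hyp2F1_reg a b h (1 - x) * hyp2F1_reg c d h (1 - x))"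

lemma gauss_pair_integral_commute: "gauss_pair_integral a b c d h s = gauss_pair_integral c d a b h s"
  by (simp add: gauss_pair_integral_def mult_ac)

lemma nonint_between: "n < x \<Longrightarrow> x < n + 1 \<Longrightarrow> n \<in> \<int> \<Longrightarrow> x \<notin> \<int>" for x n :: real
  by (auto elim!: Ints_cases)

lemma sin_pi_eq_0_real: "sin (pi * x) = 0 \<longleftrightarrow> x \<in> \<int>" for x :: real
  by (auto simp: sin_zero_iff_int2 Ints_def)

text \<open>The connection formula replaces the factor with \<open>c, d\<close> by two local
  solutions at 0, which give the two series of \<open>lam4F3\<close>; the factor x^(1-g) of the
  second is absorbed by moving \<open>s\<close> to \<open>1 + s - g\<close>. Since
  \<open>integral\<close> has a default value on non-integrable functions, \<open>?A\<close> records
  that the integral really exists.\<close>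

lemma gauss_pair_integral_eq_lam4F3:
  fixes a b c d g h s t :: real
  assumes pos: "a > 0" "b > 0" "c > 0" "d > 0" "g > 0" "h > 0" "s > 0" "t > 0"
    "h - c > 0" "h - d > 0" "2 - g > 0" "1 + s - g > 0" "1 + t - g > 0"
    and g: "g \<notin> \<int>"
    and eqs: "g + h = 1 + c + d" "t = s + h - a - b"
  shows "((\<lambda>x. x powr (s - 1) * (1 - x) powr (h - 1) * hyp2F1_reg a b h (1 - x) * hyp2F1_reg c d h (1 - x))
      has_integral gauss_pair_integral a b c d h s) {0<..<1}" (is ?A)
    and "sin (pi * g) / pi * gauss_pair_integral a b c d h s
      = Gamma s * Gamma t * Gamma (1 + s - g) * Gamma (1 + t - g) * lam4F3 c d s t g (s + h - a) (s + h - b)" (is ?B)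
proof -
  let ?S = "sin (pi * g) / pi"
  have S: "?S \<noteq> 0" using g by (simp add: sin_pi_eq_0_real)
  have e: "1 + c - g = h - d" "1 + d - g = h - c" using eqs by simp_all
  let ?u = "\<lambda>x. x powr (s - 1) * (1 - x) powr (h - 1) * hyp2F1_reg a b h (1 - x)"
  let ?u2 = "\<lambda>x. x powr (1 + s - g - 1) * (1 - x) powr (h - 1) * hyp2F1_reg a b h (1 - x)"
  have i1: "((\<lambda>x. ?u x * hyp2F1_reg c d g x) has_integral Gamma s * Gamma t * hyp4F3_reg c d s t g (s + h - a) (s + h - b)) {0<..<1}"
    by (rule hyp2F1_reg_product_integral) (use pos eqs in auto)
  have i2: "((\<lambda>x. ?u2 x * hyp2F1_reg (1 + c - g) (1 + d - g) (2 - g) x) has_integral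
      Gamma (1 + s - g) * Gamma (1 + t - g) * hyp4F3_reg (1 + c - g) (1 + d - g) (1 + s - g) (1 + t - g) (2 - g) (1 + s - g + h - a) (1 + s - g + h - b)) {0<..<1}"
    by (rule hyp2F1_reg_product_integral) (use pos eqs in auto)
  define J where "J = rGamma (1 + c - g) * rGamma (1 + d - g) * (Gamma s * Gamma t * hyp4F3_reg c d s t g (s + h - a) (s + h - b))
     - rGamma c * rGamma d * (Gamma (1 + s - g) * Gamma (1 + t - g) * hyp4F3_reg (1 + c - g) (1 + d - g) (1 + s - g) (1 + t - g) (2 - g) (1 + s - g + h - a) (1 + s - g + h - b))"
  have "((\<lambda>x. rGamma (1 + c - g) * rGamma (1 + d - g) * (?u x * hyp2F1_reg c d g x)
      - rGamma c * rGamma d * (?u2 x * hyp2F1_reg (1 + c - g) (1 + d - g) (2 - g) x)) has_integral J) {0<..<1}"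
    unfolding J_def by (intro has_integral_diff has_integral_mult_right i1 i2)
  then have "((\<lambda>x. ?S * (?u x * hyp2F1_reg c d h (1 - x))) has_integral J) {0<..<1}"
  proof (rule has_integral_eq[rotated])
    fix x :: real assume x: "x \<in> {0<..<1}"
    have "?S * (?u x * hyp2F1_reg c d h (1 - x)) = ?u x * (?S * hyp2F1_reg c d h (1 - x))" by (simp only: mult_ac)
    also have "?S * hyp2F1_reg c d h (1 - x) = rGamma (1 + c - g) * rGamma (1 + d - g) * hyp2F1_reg c d g x
      - rGamma c * rGamma d * (x powr (1 - g) * hyp2F1_reg (1 + c - g) (1 + d - g) (2 - g) x)"
      by (rule hyp2F1_reg_connection) (use x pos g eqs in auto)
    also have "x powr (1 + s - g - 1) = x powr (s - 1) * x powr (1 - g)"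
      by (simp flip: powr_add)
    ultimately show "rGamma (1 + c - g) * rGamma (1 + d - g) * (?u x * hyp2F1_reg c d g x)
      - rGamma c * rGamma d * (?u2 x * hyp2F1_reg (1 + c - g) (1 + d - g) (2 - g) x) = ?S * (?u x * hyp2F1_reg c d h (1 - x))"
      by (simp only: ring_distribs mult_ac)
  qed
  from has_integral_mult_right[OF this, of "1 / ?S"] S
  have i: "((\<lambda>x. ?u x * hyp2F1_reg c d h (1 - x)) has_integral 1 / ?S * J) {0<..<1}"
    by (simp add: mult.assoc[symmetric])
  then have u: "gauss_pair_integral a b c d h s = 1 / ?S * J" unfolding gauss_pair_integral_def by (rule integral_unique)
  show ?A using i unfolding u .
  have r: "rGamma s * Gamma s = 1" "rGamma t * Gamma t = 1"
    "rGamma (1 + s - g) * Gamma (1 + s - g) = 1" "rGamma (1 + t - g) * Gamma (1 + t - g) = 1"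
    using pos by (auto intro!: rGamma_mult_Gamma)
  have e2: "1 + s - g + h - a = 1 + (s + h - a) - g" "1 + s - g + h - b = 1 + (s + h - b) - g" by simp_all
  have "?S * gauss_pair_integral a b c d h s = J" unfolding u using S by (simp add: mult.assoc[symmetric])
  also have "J = Gamma s * Gamma t * Gamma (1 + s - g) * Gamma (1 + t - g) * lam4F3 c d s t g (s + h - a) (s + h - b)"
    unfolding J_def lam4F3_def e2 using r by algebra
  finally show ?B .
qed

text \<open>Either of the two factors at \<open>1 - x\<close> can be expanded at \<open>x\<close>. In the box below all
  parameters of the occurring Gauss series and Beta integrals are positive.\<close>

lemma lam4F3_swap_real:
  fixes a b c d h s :: real
  assumes box: "{a, b, c, d} \<subseteq> {0.7<..<0.8}" "h \<in> {1.2<..<1.3}" "s \<in> {1<..<2}"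
  shows "sin (pi * (1 + a + b - h)) * lam4F3 c d s (s + h - a - b) (1 + c + d - h) (s + h - a) (s + h - b)
    = sin (pi * (1 + c + d - h)) * lam4F3 a b s (s + h - c - d) (1 + a + b - h) (s + h - c) (s + h - d)"
proof -
  have bd: "a > 0.7" "a < 0.8" "b > 0.7" "b < 0.8" "c > 0.7" "c < 0.8" "d > 0.7" "d < 0.8"
    "h > 1.2" "h < 1.3" "s > 1" using box by auto
  define P where "P = gauss_pair_integral a b c d h s"
  \<comment> \<open>The Gamma factors of both expansions, which agree after the rewriting in
    \<open>e\<close>.\<close>
  define Q where "Q = Gamma s * Gamma (s + h - a - b) * Gamma (s + h - c - d) * Gamma (s + 2 * h - a - b - c - d)"
  \<comment> \<open>The box keeps both lower parameters strictly between 1 and 2, away from the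
    zeros of the sine. The tightest positivity condition is that of
    \<open>s + 2 * h - a - b - c - d\<close>, which stays above 0.2.\<close>
  have ni: "1 + a + b - h \<notin> \<int>" "1 + c + d - h \<notin> \<int>"
    by (rule nonint_between[of 1]; use bd in simp)+
  have "Q > 0" unfolding Q_def by (intro mult_pos_pos Gamma_real_pos) (use bd in simp_all)
  have e: "1 + s - (1 + c + d - h) = s + h - c - d" "1 + s - (1 + a + b - h) = s + h - a - b"
    "1 + (s + h - a - b) - (1 + c + d - h) = s + 2 * h - a - b - c - d"
    "1 + (s + h - c - d) - (1 + a + b - h) = s + 2 * h - a - b - c - d"
    by simp_all
  have "sin (pi * (1 + c + d - h)) / pi * P = Gamma s * Gamma (s + h - a - b) * Gamma (1 + s - (1 + c + d - h))
      * Gamma (1 + (s + h - a - b) - (1 + c + d - h)) * lam4F3 c d s (s + h - a - b) (1 + c + d - h) (s + h - a) (s + h - b)"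
    unfolding P_def by (rule gauss_pair_integral_eq_lam4F3(2)) (use bd ni in simp_all)
  moreover have "sin (pi * (1 + a + b - h)) / pi * P = Gamma s * Gamma (s + h - c - d) * Gamma (1 + s - (1 + a + b - h))
      * Gamma (1 + (s + h - c - d) - (1 + a + b - h)) * lam4F3 a b s (s + h - c - d) (1 + a + b - h) (s + h - c) (s + h - d)"
    unfolding P_def gauss_pair_integral_commute[of a] by (rule gauss_pair_integral_eq_lam4F3(2)) (use bd ni in simp_all)
  ultimately have "sin (pi * (1 + c + d - h)) / pi * P = Q * lam4F3 c d s (s + h - a - b) (1 + c + d - h) (s + h - a) (s + h - b)"
    "sin (pi * (1 + a + b - h)) / pi * P = Q * lam4F3 a b s (s + h - c - d) (1 + a + b - h) (s + h - c) (s + h - d)"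
    unfolding e Q_def by (simp_all only: mult_ac)
  then have "Q * (sin (pi * (1 + a + b - h)) * lam4F3 c d s (s + h - a - b) (1 + c + d - h) (s + h - a) (s + h - b))
    = Q * (sin (pi * (1 + c + d - h)) * lam4F3 a b s (s + h - c - d) (1 + a + b - h) (s + h - c) (s + h - d))"
    by (metis mult.left_commute times_divide_eq_left)
  with \<open>Q > 0\<close> show ?thesis by simp
qed

text \<open>Both series in \<open>kap4F3\<close> are integrals of a local solution at 0 times one at 1. Expanding
  the former at 1, both contain the same mixed integral \<open>X\<close>, which cancels.\<close>

lemma kap4F3_eq_lam4F3_real:
  fixes a b c d h s :: real
  assumes box: "{a, b, c, d} \<subseteq> {0.7<..<0.8}" "h \<in> {1.2<..<1.3}" "s \<in> {1<..<2}"
  defines "g \<equiv> 1 + c + d - h" and "k \<equiv> 1 + a + b - h" and "t \<equiv> s + h - a - b"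
  shows "sin (pi * h) * sin (pi * g) * sin (pi * k) * rGamma (1 + t - g) * kap4F3 s c d t g (s + h - a) (s + h - b)
    = pi\<^sup>2 * (sin (pi * k) * (rGamma (1 + a - h) * rGamma (1 + b - h) * rGamma (1 + c - h) * rGamma (1 + d - h))
             * lam4F3 c d s t g (s + h - a) (s + h - b)
           - sin (pi * g) * (rGamma a * rGamma b * rGamma c * rGamma d)
             * lam4F3 (1 + a - h) (1 + b - h) s (1 + s - g) k (1 + s - c) (1 + s - d))"
proof -
  have bd: "a > 0.7" "a < 0.8" "b > 0.7" "b < 0.8" "c > 0.7" "c < 0.8" "d > 0.7" "d < 0.8"
    "h > 1.2" "h < 1.3" "s > 1" using box by auto
  have ni: "k \<notin> \<int>" "g \<notin> \<int>" "h \<notin> \<int>"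
    by (rule nonint_between[of 1]; use bd in \<open>simp add: g_def k_def\<close>)+
  have ni': "2 - h \<notin> \<int>"
    by (rule nonint_between[of 0]; use bd in simp)
  \<comment> \<open>Parameters of the second local solutions at 1, those with exponent
    \<open>1 - h\<close>.\<close>
  define a' b' c' d' h' where "a' = 1 + a - h" and "b' = 1 + b - h" and "c' = 1 + c - h" and "d' = 1 + d - h" and "h' = 2 - h"
  note defs = a'_def b'_def c'_def d'_def h'_def g_def k_def t_def
  define P where "P = gauss_pair_integral a b c d h s"
  \<comment> \<open>Two factors (1 - x)^(1-h) turn the weight (1 - x)^(h-1) into (1 - x)^(h'-1), so
    this is again an integral of the same type.\<close>
  define Q where "Q = gauss_pair_integral c' d' a' b' h' s"
  let ?w = "\<lambda>x. x powr (s - 1) * (1 - x) powr (h - 1) * hyp2F1_reg a b h (1 - x)"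
  let ?w' = "\<lambda>x. x powr (s - 1) * (1 - x) powr (h' - 1) * hyp2F1_reg c' d' h' (1 - x)"
  \<comment> \<open>In the mixed product the two powers of 1 - x cancel.\<close>
  let ?W = "\<lambda>x. x powr (s - 1) * hyp2F1_reg a b h (1 - x) * hyp2F1_reg c' d' h' (1 - x)"
  define X where "X = integral {0<..<1} ?W"
  define R where "R = Gamma s * Gamma t * hyp4F3_reg c d s t g (s + h - a) (s + h - b)"
  define L where "L = Gamma s * Gamma (1 + s - g) * hyp4F3_reg a' b' s (1 + s - g) k (1 + s - c) (1 + s - d)"
  have e1: "1 + s - c = s + h' - c'" "1 + s - d = s + h' - d'" by (simp_all add: defs)
  have iR: "((\<lambda>x. ?w x * hyp2F1_reg c d g x) has_integral R) {0<..<1}"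
    unfolding R_def by (rule hyp2F1_reg_product_integral) (use bd in \<open>simp_all add: defs\<close>)
  have iL: "((\<lambda>x. ?w' x * hyp2F1_reg a' b' k x) has_integral L) {0<..<1}"
    unfolding L_def e1 by (rule hyp2F1_reg_product_integral) (use bd in \<open>simp_all add: defs\<close>)
  have iP: "((\<lambda>x. ?w x * hyp2F1_reg c d h (1 - x)) has_integral P) {0<..<1}"
    unfolding P_def by (rule gauss_pair_integral_eq_lam4F3(1)[where g = g and t = t]) (use bd ni in \<open>simp_all add: defs\<close>)
  have iQ: "((\<lambda>x. ?w' x * hyp2F1_reg a' b' h' (1 - x)) has_integral Q) {0<..<1}"
    unfolding Q_def by (rule gauss_pair_integral_eq_lam4F3(1)[where g = k and t = "1 + s - g"]) (use bd ni in \<open>simp_all add: defs\<close>)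
  have nz: "rGamma c > 0" "rGamma d > 0" "rGamma a' > 0" "rGamma b' > 0"
    by (simp_all add: rGamma_inverse_Gamma Gamma_real_pos) (use bd in \<open>simp_all add: defs\<close>)
  have "((\<lambda>x. rGamma c' * rGamma d' * (?w x * hyp2F1_reg c d h (1 - x)) - sin (pi * h) / pi * (?w x * hyp2F1_reg c d g x))
     has_integral rGamma c' * rGamma d' * P - sin (pi * h) / pi * R) {0<..<1}"
    by (intro has_integral_diff has_integral_mult_right iR iP)
  then have "((\<lambda>x. (rGamma c * rGamma d) * ?W x) has_integral rGamma c' * rGamma d' * P - sin (pi * h) / pi * R) {0<..<1}"
  proof (rule has_integral_eq[rotated])
    fix x :: real assume x: "x \<in> {0<..<1}"
    \<comment> \<open>The connection formula at 1 - x with \<open>g\<close> and \<open>h\<close>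
      exchanged: it expands a local solution at 0 in local solutions at 1.\<close>
    have "sin (pi * h) / pi * hyp2F1_reg c d g (1 - (1 - x))
      = rGamma (1 + c - h) * rGamma (1 + d - h) * hyp2F1_reg c d h (1 - x)
        - rGamma c * rGamma d * ((1 - x) powr (1 - h) * hyp2F1_reg (1 + c - h) (1 + d - h) (2 - h) (1 - x))"
      by (rule hyp2F1_reg_connection) (use x bd ni in \<open>simp_all add: defs\<close>)
    then have *: "sin (pi * h) / pi * hyp2F1_reg c d g x
      = rGamma c' * rGamma d' * hyp2F1_reg c d h (1 - x)
        - rGamma c * rGamma d * ((1 - x) powr (1 - h) * hyp2F1_reg c' d' h' (1 - x))"
      by (simp add: defs)
    have "(1 - x) powr (h - 1) * (1 - x) powr (1 - h) = 1" using x by (simp flip: powr_add)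
    with * show "rGamma c' * rGamma d' * (?w x * hyp2F1_reg c d h (1 - x)) - sin (pi * h) / pi * (?w x * hyp2F1_reg c d g x)
      = (rGamma c * rGamma d) * ?W x"
      by algebra
  qed
  \<comment> \<open>Existence of the mixed integral is inherited from the other two; no separate
    convergence argument is made for it.\<close>
  from has_integral_mult_right[OF this, of "1 / (rGamma c * rGamma d)"] nz
  have iX: "(?W has_integral X) {0<..<1}"
    unfolding X_def by (simp add: mult.assoc[symmetric] has_integral_integrable_integral has_integral_iff)
  have X1: "(rGamma c * rGamma d) * X = rGamma c' * rGamma d' * P - sin (pi * h) / pi * R"
    by (rule has_integral_unique[OF has_integral_mult_right[OF iX]]) fact
  have "((\<lambda>x. rGamma a * rGamma b * (?w' x * hyp2F1_reg a' b' h' (1 - x)) - (rGamma a' * rGamma b') * ?W x)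
     has_integral rGamma a * rGamma b * Q - (rGamma a' * rGamma b') * X) {0<..<1}"
    by (intro has_integral_diff has_integral_mult_right iQ iX)
  then have "((\<lambda>x. sin (pi * h') / pi * (?w' x * hyp2F1_reg a' b' k x)) has_integral
      rGamma a * rGamma b * Q - (rGamma a' * rGamma b') * X) {0<..<1}"
  proof (rule has_integral_eq[rotated])
    fix x :: real assume x: "x \<in> {0<..<1}"
    have "sin (pi * h') / pi * hyp2F1_reg a' b' k (1 - (1 - x))
      = rGamma (1 + a' - h') * rGamma (1 + b' - h') * hyp2F1_reg a' b' h' (1 - x)
        - rGamma a' * rGamma b' * ((1 - x) powr (1 - h') * hyp2F1_reg (1 + a' - h') (1 + b' - h') (2 - h') (1 - x))"
      by (rule hyp2F1_reg_connection) (use x bd ni' in \<open>simp_all add: defs\<close>)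
    then have *: "sin (pi * h') / pi * hyp2F1_reg a' b' k x
      = rGamma a * rGamma b * hyp2F1_reg a' b' h' (1 - x)
        - rGamma a' * rGamma b' * ((1 - x) powr (1 - h') * hyp2F1_reg a b h (1 - x))"
      by (simp add: defs)
    have "(1 - x) powr (h' - 1) * (1 - x) powr (1 - h') = 1" using x by (simp flip: powr_add)
    with * show "rGamma a * rGamma b * (?w' x * hyp2F1_reg a' b' h' (1 - x)) - (rGamma a' * rGamma b') * ?W x
      = sin (pi * h') / pi * (?w' x * hyp2F1_reg a' b' k x)"
      by algebra
  qed
  then have "sin (pi * h') / pi * L = rGamma a * rGamma b * Q - (rGamma a' * rGamma b') * X"
    by (rule has_integral_unique[OF has_integral_mult_right[OF iL]])
  moreover have "sin (pi * h') = - sin (pi * h)"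
    using sin_periodic[of "- (pi * h)"] by (simp add: h'_def algebra_simps)
  ultimately have main: "sin (pi * h) / pi * (R * (rGamma a' * rGamma b') + L * (rGamma c * rGamma d))
      = P * (rGamma a' * rGamma b' * rGamma c' * rGamma d') - Q * (rGamma a * rGamma b * rGamma c * rGamma d)"
    using X1 by algebra
  define G where "G = Gamma s * Gamma t * Gamma (1 + s - g)"
  have e2: "1 + s - k = t" "1 + (1 + s - g) - k = 1 + t - g" by (simp_all add: defs)
  have "sin (pi * g) / pi * P = Gamma s * Gamma t * Gamma (1 + s - g) * Gamma (1 + t - g) * lam4F3 c d s t g (s + h - a) (s + h - b)"
    unfolding P_def by (rule gauss_pair_integral_eq_lam4F3(2)) (use bd ni in \<open>simp_all add: defs\<close>)
  then have P: "sin (pi * g) * P = pi * (G * Gamma (1 + t - g) * lam4F3 c d s t g (s + h - a) (s + h - b))"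
    unfolding G_def by (simp add: field_simps)
  have "sin (pi * k) / pi * Q = Gamma s * Gamma (1 + s - g) * Gamma (1 + s - k) * Gamma (1 + (1 + s - g) - k)
      * lam4F3 a' b' s (1 + s - g) k (s + h' - c') (s + h' - d')"
    unfolding Q_def by (rule gauss_pair_integral_eq_lam4F3(2)) (use bd ni in \<open>simp_all add: defs\<close>)
  then have Q: "sin (pi * k) * Q = pi * (G * Gamma (1 + t - g) * lam4F3 a' b' s (1 + s - g) k (1 + s - c) (1 + s - d))"
    unfolding G_def e1 e2 by (simp add: field_simps)
  have r: "rGamma t * Gamma t = 1" "rGamma (1 + s - g) * Gamma (1 + s - g) = 1" "rGamma (1 + t - g) * Gamma (1 + t - g) = 1"
    by (rule rGamma_mult_Gamma; use bd in \<open>simp add: defs\<close>)+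
  have G: "G > 0" unfolding G_def by (intro mult_pos_pos Gamma_real_pos) (use bd in \<open>simp_all add: defs\<close>)
  have K: "R * (rGamma a' * rGamma b') + L * (rGamma c * rGamma d) = G * kap4F3 s c d t g (s + h - a) (s + h - b)"
  proof -
    have e3: "1 + s - (s + h - a) = a'" "1 + s - (s + h - b) = b'" "1 + s - t = k" by (simp_all add: defs)
    have p1: "hyp4F3_reg s c d t g (s + h - a) (s + h - b) = hyp4F3_reg c d s t g (s + h - a) (s + h - b)"
      by (simp add: hyp4F3_reg_def hyp4F3_term_def mult_ac)
    have p2: "hyp4F3_reg s (1 + s - g) a' b' (1 + s - c) (1 + s - d) k = hyp4F3_reg a' b' s (1 + s - g) k (1 + s - c) (1 + s - d)"
      by (simp add: hyp4F3_reg_def hyp4F3_term_def mult_ac)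
    show ?thesis
      unfolding kap4F3_def e3 p1 p2 G_def R_def L_def using r by algebra
  qed
  have "sin (pi * h) * (G * kap4F3 s c d t g (s + h - a) (s + h - b))
      = pi * (P * (rGamma a' * rGamma b' * rGamma c' * rGamma d') - Q * (rGamma a * rGamma b * rGamma c * rGamma d))"
    using main unfolding K by (simp add: field_simps)
  then have "(sin (pi * h) * (G * kap4F3 s c d t g (s + h - a) (s + h - b))) * (sin (pi * g) * sin (pi * k))
      = pi * (P * (rGamma a' * rGamma b' * rGamma c' * rGamma d') - Q * (rGamma a * rGamma b * rGamma c * rGamma d))
         * (sin (pi * g) * sin (pi * k))"
    by simp
  then have "G * (sin (pi * h) * sin (pi * g) * sin (pi * k) * kap4F3 s c d t g (s + h - a) (s + h - b))
      = pi * ((sin (pi * g) * P) * sin (pi * k) * (rGamma a' * rGamma b' * rGamma c' * rGamma d')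
          - (sin (pi * k) * Q) * sin (pi * g) * (rGamma a * rGamma b * rGamma c * rGamma d))"
    by (simp only: ring_distribs right_diff_distrib left_diff_distrib mult_ac)
  also have "\<dots> = G * (pi\<^sup>2 * Gamma (1 + t - g) * (sin (pi * k) * (rGamma a' * rGamma b' * rGamma c' * rGamma d')
             * lam4F3 c d s t g (s + h - a) (s + h - b)
           - sin (pi * g) * (rGamma a * rGamma b * rGamma c * rGamma d)
             * lam4F3 a' b' s (1 + s - g) k (1 + s - c) (1 + s - d)))"
    unfolding P Q by (simp add: power2_eq_square algebra_simps)
  finally have "sin (pi * h) * sin (pi * g) * sin (pi * k) * kap4F3 s c d t g (s + h - a) (s + h - b)
     = pi\<^sup>2 * Gamma (1 + t - g) * (sin (pi * k) * (rGamma a' * rGamma b' * rGamma c' * rGamma d')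
             * lam4F3 c d s t g (s + h - a) (s + h - b)
           - sin (pi * g) * (rGamma a * rGamma b * rGamma c * rGamma d)
             * lam4F3 a' b' s (1 + s - g) k (1 + s - c) (1 + s - d))"
    using G by simp
  then show ?thesis
    unfolding a'_def[symmetric] b'_def[symmetric] c'_def[symmetric] d'_def[symmetric] using r(3) by algebra
qed

section \<open>Analytic continuation\<close>

lemma holomorphic_zero_on_real_interval:
  fixes f :: "complex \<Rightarrow> complex"
  assumes f: "f holomorphic_on UNIV" and lr: "l < r"
    and z: "\<And>x. x \<in> {l<..<r} \<Longrightarrow> f (of_real x) = 0"
  shows "f w = 0"
proof -
  define m where "m = (l + r) / 2"
  have lim: "of_real m islimpt (complex_of_real ` {l<..<r})"
    unfolding islimpt_approachable
  proof (intro allI impI)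
    fix e :: real assume e: "e > 0"
    define x where "x = m + min (e / 2) ((r - l) / 4)"
    have "x \<in> {l<..<r}" "x \<noteq> m" "\<bar>x - m\<bar> < e" using e lr by (auto simp: x_def m_def min_def field_simps)
    then show "\<exists>x'\<in>complex_of_real ` {l<..<r}. x' \<noteq> of_real m \<and> dist x' (of_real m) < e"
      by (intro bexI[of _ "of_real x"]) (auto simp: dist_norm simp flip: of_real_diff)
  qed
  show ?thesis
    by (rule analytic_continuation[OF f open_UNIV connected_UNIV subset_UNIV UNIV_I lim]) (use z in auto)
qed

text \<open>The variables are freed from their intervals one at a time by the one-variable identity
  theorem, so holomorphy in each variable separately suffices.\<close>

lemma six_variable_identity:
  fixes F :: "complex \<Rightarrow> complex \<Rightarrow> complex \<Rightarrow> complex \<Rightarrow> complex \<Rightarrow> complex \<Rightarrow> complex"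
  assumes hol: "\<And>b c d h s. (\<lambda>a. F a b c d h s) holomorphic_on UNIV"
    "\<And>a c d h s. (\<lambda>b. F a b c d h s) holomorphic_on UNIV"
    "\<And>a b d h s. (\<lambda>c. F a b c d h s) holomorphic_on UNIV"
    "\<And>a b c h s. (\<lambda>d. F a b c d h s) holomorphic_on UNIV"
    "\<And>a b c d s. (\<lambda>h. F a b c d h s) holomorphic_on UNIV"
    "\<And>a b c d h. (\<lambda>s. F a b c d h s) holomorphic_on UNIV"
    and zero: "\<And>a b c d h s. {a, b, c, d} \<subseteq> {0.7<..<0.8} \<Longrightarrow> h \<in> {1.2<..<1.3} \<Longrightarrow> s \<in> {1<..<2} \<Longrightarrow>
       F (of_real a) (of_real b) (of_real c) (of_real d) (of_real h) (of_real s) = 0"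
  shows "F a b c d h s = 0"
proof -
  note cont = holomorphic_zero_on_real_interval
  let ?I = "{0.7<..<0.8::real}" and ?J = "{1.2<..<1.3::real}" and ?K = "{1<..<2::real}"
  have 1: "F a (of_real b) (of_real c) (of_real d) (of_real h) (of_real s) = 0"
    if "b \<in> ?I" "c \<in> ?I" "d \<in> ?I" "h \<in> ?J" "s \<in> ?K" for a b c d h s
    by (rule cont[OF hol(1), of "0.7" "0.8"]) (use zero that in auto)
  have 2: "F a b (of_real c) (of_real d) (of_real h) (of_real s) = 0"
    if "c \<in> ?I" "d \<in> ?I" "h \<in> ?J" "s \<in> ?K" for a b c d h s
    by (rule cont[OF hol(2), of "0.7" "0.8"]) (use 1 that in auto)
  have 3: "F a b c (of_real d) (of_real h) (of_real s) = 0"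
    if "d \<in> ?I" "h \<in> ?J" "s \<in> ?K" for a b c d h s
    by (rule cont[OF hol(3), of "0.7" "0.8"]) (use 2 that in auto)
  have 4: "F a b c d (of_real h) (of_real s) = 0" if "h \<in> ?J" "s \<in> ?K" for a b c d h s
    by (rule cont[OF hol(4), of "0.7" "0.8"]) (use 3 that in auto)
  have 5: "F a b c d h (of_real s) = 0" if "s \<in> ?K" for a b c d h s
    by (rule cont[OF hol(5), of "1.2" "1.3"]) (use 4 that in auto)
  show ?thesis by (rule cont[OF hol(6), of 1 2]) (use 5 in auto)
qed

lemma lam4F3_of_real:
  fixes a b c d e f g :: real
  assumes "e + f + g - a - b - c - d = 1"
  shows "lam4F3 (complex_of_real a) (of_real b) (of_real c) (of_real d) (of_real e) (of_real f) (of_real g)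
    = of_real (lam4F3 a b c d e f g)"
proof -
  have "1 + complex_of_real x - of_real e = of_real (1 + x - e)" "2 - complex_of_real e = of_real (2 - e)" for x
    by simp_all
  then show ?thesis
    using assms by (simp add: lam4F3_def rGamma_complex_of_real hyp4F3_reg_of_real del: of_real_add of_real_diff) simp
qed

lemma kap4F3_of_real:
  fixes a b c d e f g :: real
  assumes "e + f + g - a - b - c - d = 1"
  shows "kap4F3 (complex_of_real a) (of_real b) (of_real c) (of_real d) (of_real e) (of_real f) (of_real g)
    = of_real (kap4F3 a b c d e f g)"
proof -
  have "1 + complex_of_real a - of_real x = of_real (1 + a - x)" for x
    by simp
  then show ?thesis
    using assms by (simp add: kap4F3_def rGamma_complex_of_real hyp4F3_reg_of_real del: of_real_add of_real_diff) simp
qed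

lemma holomorphic_lam4F3:
  assumes hol: "a holomorphic_on UNIV" "b holomorphic_on UNIV" "c holomorphic_on UNIV" "d holomorphic_on UNIV"
    "e holomorphic_on UNIV" "f holomorphic_on UNIV" "g holomorphic_on UNIV"
    and V: "\<And>z. e z + f z + g z - a z - b z - c z - d z = 1"
  shows "(\<lambda>z. lam4F3 (a z) (b z) (c z) (d z) (e z) (f z) (g z)) holomorphic_on UNIV"
proof -
  have V': "2 - e z + (1 + f z - e z) + (1 + g z - e z) - (1 + a z - e z) - (1 + b z - e z) - (1 + c z - e z) - (1 + d z - e z) = 1" for z
    using V[of z] by (simp add: algebra_simps)
  show ?thesis unfolding lam4F3_def
    by (intro holomorphic_intros holomorphic_hyp4F3_reg hol V V')
qed

lemma holomorphic_kap4F3: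
  assumes hol: "a holomorphic_on UNIV" "b holomorphic_on UNIV" "c holomorphic_on UNIV" "d holomorphic_on UNIV"
    "e holomorphic_on UNIV" "f holomorphic_on UNIV" "g holomorphic_on UNIV"
    and V: "\<And>z. e z + f z + g z - a z - b z - c z - d z = 1"
  shows "(\<lambda>z. kap4F3 (a z) (b z) (c z) (d z) (e z) (f z) (g z)) holomorphic_on UNIV"
proof -
  have V': "1 + a z - b z + (1 + a z - c z) + (1 + a z - d z) - a z - (1 + a z - e z) - (1 + a z - f z) - (1 + a z - g z) = 1" for z
    using V[of z] by (simp add: algebra_simps)
  show ?thesis unfolding kap4F3_def
    by (intro holomorphic_intros holomorphic_hyp4F3_reg hol V V')
qed

lemma lam4F3_swap:
  fixes a b c d h s :: complex
  shows "sin (of_real pi * (1 + a + b - h)) * lam4F3 c d s (s + h - a - b) (1 + c + d - h) (s + h - a) (s + h - b)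
    = sin (of_real pi * (1 + c + d - h)) * lam4F3 a b s (s + h - c - d) (1 + a + b - h) (s + h - c) (s + h - d)"
    (is "?L a b c d h s = ?R a b c d h s")
proof -
  have "?L a b c d h s - ?R a b c d h s = 0"
  proof (rule six_variable_identity[where F = "\<lambda>a b c d h s. ?L a b c d h s - ?R a b c d h s"])
    fix a b c d h s :: real
    assume box: "{a, b, c, d} \<subseteq> {0.7<..<0.8}" "h \<in> {1.2<..<1.3}" "s \<in> {1<..<2}"
    have "lam4F3 (complex_of_real c) (of_real d) (of_real s) (of_real (s + h - a - b)) (of_real (1 + c + d - h)) (of_real (s + h - a)) (of_real (s + h - b))
        = of_real (lam4F3 c d s (s + h - a - b) (1 + c + d - h) (s + h - a) (s + h - b))"
      "lam4F3 (complex_of_real a) (of_real b) (of_real s) (of_real (s + h - c - d)) (of_real (1 + a + b - h)) (of_real (s + h - c)) (of_real (s + h - d))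
        = of_real (lam4F3 a b s (s + h - c - d) (1 + a + b - h) (s + h - c) (s + h - d))"
      by (rule lam4F3_of_real; simp)+
    moreover have "complex_of_real (sin (pi * (1 + x + y - h))) = sin (of_real pi * (1 + of_real x + of_real y - of_real h))" for x y
      using sin_of_real[of "pi * (1 + x + y - h)", where 'a = complex] by simp
    ultimately show "?L (of_real a) (of_real b) (of_real c) (of_real d) (of_real h) (of_real s)
        - ?R (of_real a) (of_real b) (of_real c) (of_real d) (of_real h) (of_real s) = 0"
      using arg_cong[OF lam4F3_swap_real[OF box], of complex_of_real]
      by (simp only: of_real_mult of_real_add of_real_diff of_real_1 diff_self)
  qed (intro holomorphic_intros holomorphic_lam4F3; simp)+
  then show ?thesis by simp
qed

lemma kap4F3_eq_lam4F3:
  fixes a b c d h s :: complex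
  shows "sin (of_real pi * h) * sin (of_real pi * (1 + c + d - h)) * sin (of_real pi * (1 + a + b - h))
      * rGamma (1 + (s + h - a - b) - (1 + c + d - h)) * kap4F3 s c d (s + h - a - b) (1 + c + d - h) (s + h - a) (s + h - b)
    = of_real pi ^ 2 * (sin (of_real pi * (1 + a + b - h)) * (rGamma (1 + a - h) * rGamma (1 + b - h) * rGamma (1 + c - h) * rGamma (1 + d - h))
             * lam4F3 c d s (s + h - a - b) (1 + c + d - h) (s + h - a) (s + h - b)
           - sin (of_real pi * (1 + c + d - h)) * (rGamma a * rGamma b * rGamma c * rGamma d)
             * lam4F3 (1 + a - h) (1 + b - h) s (1 + s - (1 + c + d - h)) (1 + a + b - h) (1 + s - c) (1 + s - d))"
    (is "?L a b c d h s = ?R a b c d h s")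
proof -
  have "?L a b c d h s - ?R a b c d h s = 0"
  proof (rule six_variable_identity[where F = "\<lambda>a b c d h s. ?L a b c d h s - ?R a b c d h s"])
    fix a b c d h s :: real
    assume box: "{a, b, c, d} \<subseteq> {0.7<..<0.8}" "h \<in> {1.2<..<1.3}" "s \<in> {1<..<2}"
    have "lam4F3 (complex_of_real c) (of_real d) (of_real s) (of_real (s + h - a - b)) (of_real (1 + c + d - h)) (of_real (s + h - a)) (of_real (s + h - b))
        = of_real (lam4F3 c d s (s + h - a - b) (1 + c + d - h) (s + h - a) (s + h - b))"
      "kap4F3 (complex_of_real s) (of_real c) (of_real d) (of_real (s + h - a - b)) (of_real (1 + c + d - h)) (of_real (s + h - a)) (of_real (s + h - b))
        = of_real (kap4F3 s c d (s + h - a - b) (1 + c + d - h) (s + h - a) (s + h - b))"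
      "lam4F3 (complex_of_real (1 + a - h)) (of_real (1 + b - h)) (of_real s) (of_real (1 + s - (1 + c + d - h))) (of_real (1 + a + b - h)) (of_real (1 + s - c)) (of_real (1 + s - d))
        = of_real (lam4F3 (1 + a - h) (1 + b - h) s (1 + s - (1 + c + d - h)) (1 + a + b - h) (1 + s - c) (1 + s - d))"
      by ((rule lam4F3_of_real kap4F3_of_real; simp)+)
    moreover have "complex_of_real (sin (pi * x)) = sin (of_real pi * of_real x)" for x
      using sin_of_real[of "pi * x", where 'a = complex] by simp
    ultimately show "?L (of_real a) (of_real b) (of_real c) (of_real d) (of_real h) (of_real s)
        - ?R (of_real a) (of_real b) (of_real c) (of_real d) (of_real h) (of_real s) = 0"
      using arg_cong[OF kap4F3_eq_lam4F3_real[OF box], of complex_of_real]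
      by (simp only: of_real_mult of_real_add of_real_diff of_real_1 of_real_power rGamma_complex_of_real[symmetric] diff_self)
  qed (intro holomorphic_intros holomorphic_lam4F3 holomorphic_kap4F3; simp)+
  then show ?thesis by simp
qed

text \<open>The compound arguments become variables with defining equations, so that the identity
  can be matched against other parametrisations of \<open>V\<close>.\<close>

lemma lam4F3_swap_eq:
  fixes a b c d h s :: complex
  assumes "t = s + h - a - b" "u = s + h - c - d" "g = 1 + c + d - h" "k = 1 + a + b - h"
    "p = s + h - a" "p' = s + h - b" "q = s + h - c" "q' = s + h - d"
  shows "sin (of_real pi * k) * lam4F3 c d s t g p p' = sin (of_real pi * g) * lam4F3 a b s u k q q'"
  unfolding assms by (rule lam4F3_swap)

lemma kap4F3_eq_lam4F3_eq:
  fixes a b c d h s :: complex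
  assumes "t = s + h - a - b" "g = 1 + c + d - h" "k = 1 + a + b - h" "p = s + h - a" "p' = s + h - b"
    "a' = 1 + a - h" "b' = 1 + b - h" "c' = 1 + c - h" "d' = 1 + d - h"
  shows "sin (of_real pi * h) * sin (of_real pi * g) * sin (of_real pi * k) * rGamma (1 + t - g) * kap4F3 s c d t g p p'
    = of_real pi ^ 2 * (sin (of_real pi * k) * (rGamma a' * rGamma b' * rGamma c' * rGamma d') * lam4F3 c d s t g p p'
           - sin (of_real pi * g) * (rGamma a * rGamma b * rGamma c * rGamma d)
             * lam4F3 a' b' s (1 + s - g) k (1 + s - c) (1 + s - d))"
  unfolding assms by (rule kap4F3_eq_lam4F3)

text \<open>In the box this is the symmetric integral \<open>gauss_pair_integral\<close> up to Gamma
  factors common to both expansions, so that \<open>lam4F3_swap\<close> becomes plain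
  invariance.\<close>

definition ell4F3 :: "complex \<Rightarrow> complex \<Rightarrow> complex \<Rightarrow> complex \<Rightarrow> complex \<Rightarrow> complex \<Rightarrow> complex \<Rightarrow> complex" where
  "ell4F3 a b c d e f g = lam4F3 a b c d e f g / sin (of_real pi * e)"

text \<open>Both sides are one swap away from the same third family.\<close>

lemma ell4F3_transform:
  fixes a b c d e f g :: complex
  assumes V: "e + f + g - a - b - c - d = 1"
    and nz: "sin (of_real pi * e) \<noteq> 0" "sin (of_real pi * (1 + g - f)) \<noteq> 0" "sin (of_real pi * (1 + d - c)) \<noteq> 0"
  shows "ell4F3 a b c d e f g = ell4F3 (g - a) (g - b) (g - c) (g - d) (1 + g - f) (1 + g - e) g"
proof -
  have g: "g = 1 + a + b + c + d - e - f" using V by (simp add: algebra_simps)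
  define m where "m = lam4F3 (g - c) (f - c) d (1 + d - e) (1 + d - c) (1 + b + d - e) (1 + a + d - e)"
  have p: "lam4F3 a b d c e f g = lam4F3 a b c d e f g"
    "lam4F3 (1 + d - e) d (g - c) (f - c) (1 + d - c) (1 + a + d - e) (1 + b + d - e) = m"
    "lam4F3 (g - a) (g - b) (g - c) (g - d) (1 + g - f) g (1 + g - e) = lam4F3 (g - a) (g - b) (g - c) (g - d) (1 + g - f) (1 + g - e) g"
    by (simp_all add: m_def lam4F3_def hyp4F3_reg_def hyp4F3_term_def mult_ac)
  \<comment> \<open>Here and in the second swap, \<open>h\<close> is forced by the fifth slot, which
    must be 1 plus the first two arguments minus \<open>h\<close>.\<close>
  have "sin (of_real pi * (1 + d - c)) * lam4F3 a b d c e f g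
      = sin (of_real pi * e) * lam4F3 (g - c) (f - c) d (1 + d - e) (1 + d - c) (1 + b + d - e) (1 + a + d - e)"
    by (rule lam4F3_swap_eq[where h = "f + g - c - d"]) (simp_all add: g algebra_simps)
  moreover have "sin (of_real pi * (1 + d - c)) * lam4F3 (g - a) (g - b) (g - c) (g - d) (1 + g - f) g (1 + g - e)
      = sin (of_real pi * (1 + g - f)) * lam4F3 (1 + d - e) d (g - c) (f - c) (1 + d - c) (1 + a + d - e) (1 + b + d - e)"
    by (rule lam4F3_swap_eq[where h = "f + g - a - b"]) (simp_all add: g algebra_simps)
  ultimately have "sin (of_real pi * (1 + d - c)) * lam4F3 a b c d e f g = sin (of_real pi * e) * m"
    "sin (of_real pi * (1 + d - c)) * lam4F3 (g - a) (g - b) (g - c) (g - d) (1 + g - f) (1 + g - e) g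
      = sin (of_real pi * (1 + g - f)) * m"
    unfolding p m_def[symmetric] by auto
  then show ?thesis unfolding ell4F3_def using nz by (simp add: frac_eq_eq) algebra
qed

text \<open>\<open>kap4F3\<close> is symmetric in \<open>b, c, d\<close> and in
  \<open>e, f, g\<close>, but the right-hand side singles out \<open>d\<close> and \<open>e\<close>.
  The same function thus has several such expansions, and comparing two of them yields relations
  among values of \<open>ell4F3\<close>.\<close>

lemma kap4F3_eq_ell4F3:
  fixes a b c d e f g :: complex
  assumes V: "e + f + g - a - b - c - d = 1"
    and nz: "sin (of_real pi * e) \<noteq> 0" "sin (of_real pi * (1 + a - d)) \<noteq> 0"
  shows "sin (of_real pi * (e - b - c)) * (kap4F3 a b c d e f g * rGamma (1 + d - e))
    = of_real pi ^ 2 *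
      ((rGamma (1 + a - f) * rGamma (1 + a - g) * rGamma (e - b) * rGamma (e - c)) * ell4F3 a b c d e f g
       - (rGamma b * rGamma c * rGamma (f - d) * rGamma (g - d))
           * ell4F3 a (1 + a - e) (1 + a - f) (1 + a - g) (1 + a - d) (1 + a - b) (1 + a - c))"
proof -
  have g: "g = 1 + a + b + c + d - e - f" using V by (simp add: algebra_simps)
  have p: "lam4F3 b c a d e f g = lam4F3 a b c d e f g"
    "lam4F3 (1 + a - f) (1 + a - g) a (1 + a - e) (1 + a - d) (1 + a - b) (1 + a - c)
      = lam4F3 a (1 + a - e) (1 + a - f) (1 + a - g) (1 + a - d) (1 + a - b) (1 + a - c)"
    by (simp_all add: lam4F3_def hyp4F3_reg_def hyp4F3_term_def mult_ac)
  have s: "sin (of_real pi * (1 + b + c - e)) = sin (of_real pi * (e - b - c))"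
  proof -
    have "of_real pi * (1 + b + c - e) = of_real pi - of_real pi * (e - b - c)" by (simp add: algebra_simps)
    then show ?thesis by (simp add: sin_diff)
  qed
  have main: "sin (of_real pi * (1 + b + c - e)) * sin (of_real pi * e) * sin (of_real pi * (1 + a - d))
      * rGamma (1 + d - e) * kap4F3 a b c d e f g
    = of_real pi ^ 2 * (sin (of_real pi * (1 + a - d)) * (rGamma (1 + a - f) * rGamma (1 + a - g) * rGamma (e - c) * rGamma (e - b))
        * lam4F3 b c a d e f g
      - sin (of_real pi * e) * (rGamma (g - d) * rGamma (f - d) * rGamma b * rGamma c)
        * lam4F3 (1 + a - f) (1 + a - g) a (1 + a - e) (1 + a - d) (1 + a - b) (1 + a - c))"
    by (rule kap4F3_eq_lam4F3_eq) (simp_all add: g algebra_simps)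
  have "lam4F3 a b c d e f g = sin (of_real pi * e) * ell4F3 a b c d e f g"
    "lam4F3 a (1 + a - e) (1 + a - f) (1 + a - g) (1 + a - d) (1 + a - b) (1 + a - c)
      = sin (of_real pi * (1 + a - d)) * ell4F3 a (1 + a - e) (1 + a - f) (1 + a - g) (1 + a - d) (1 + a - b) (1 + a - c)"
    using nz by (simp_all add: ell4F3_def)
  then have "(sin (of_real pi * e) * sin (of_real pi * (1 + a - d))) * (sin (of_real pi * (e - b - c)) * (kap4F3 a b c d e f g * rGamma (1 + d - e)))
    = (sin (of_real pi * e) * sin (of_real pi * (1 + a - d))) * (of_real pi ^ 2 *
      ((rGamma (1 + a - f) * rGamma (1 + a - g) * rGamma (e - b) * rGamma (e - c)) * ell4F3 a b c d e f g
       - (rGamma b * rGamma c * rGamma (f - d) * rGamma (g - d))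
           * ell4F3 a (1 + a - e) (1 + a - f) (1 + a - g) (1 + a - d) (1 + a - b) (1 + a - c)))"
    using main unfolding p s by (simp add: algebra_simps)
  then show ?thesis using nz by simp
qed

section \<open>Trigonometric identities\<close>

definition sp :: "complex \<Rightarrow> complex" where "sp x = sin (of_real pi * x)"

text \<open>Multiplication by the two exponentials clears the denominators: a sine becomes a
  difference of squares, and products of sines become polynomials in these squares.\<close>

lemma sp_diff_exp:
  "sp (x - y) * (exp (\<i> * of_real pi * x) * exp (\<i> * of_real pi * y))
     = (exp (\<i> * of_real pi * x) ^ 2 - exp (\<i> * of_real pi * y) ^ 2) / (2 * \<i>)"
proof -
  define u v where "u = exp (\<i> * of_real pi * x)" and "v = exp (\<i> * of_real pi * y)"
  have "exp (\<i> * (of_real pi * (x - y))) = u / v" "exp (- (\<i> * (of_real pi * (x - y)))) = v / u"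
    by (simp_all add: u_def v_def algebra_simps flip: exp_diff)
  moreover have "u \<noteq> 0" "v \<noteq> 0" by (simp_all add: u_def v_def)
  ultimately have "sp (x - y) * (u * v) = (u ^ 2 - v ^ 2) / (2 * \<i>)"
    unfolding sp_def sin_exp_eq by (simp add: field_simps power2_eq_square)
  then show ?thesis by (simp add: u_def v_def)
qed

text \<open>Each letter stands for the square of the exponential of one parameter; the hypothesis is
  the squared balancing condition, which carries no sign. The six products correspond to the six
  sine products of \<open>sp_identity_x\<close> after clearing denominators.\<close>

lemma sp_polynomial_identity:
  fixes A B C D E F G :: complex
  assumes "G * E * F = A * B * C * D"
  shows "B*C*E*F*((F-E)*(G-D)*(G-A*D)*(G-C)*(E-A)*(F-A)) - G*A*C*E*F*((F-E)*(G-D)*(E-B)*(F-B)*(C-A)*(D-1))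
   + E*F^2*G*((G-C*D)*(E-B)*(E-C)*(B-A)*(C-A)*(D-A)) - B*C*D*F*((G-C*D)*(E-B)*(E-C)*(E-A^2)*(F-A)*(G-A))
   - E^2*F*G*((G-C*D)*(F-B)*(F-C)*(B-A)*(C-A)*(D-A)) + B*C*D*E*((G-C*D)*(F-B)*(F-C)*(F-A^2)*(E-A)*(G-A)) = 0"
  using assms by algebra

text \<open>The coefficient of \<open>X\<close> in \<open>relation6p14_algebra\<close>. It expands
  into six products of six sines each.\<close>

lemma sp_identity_x:
  fixes a b c d e f g :: complex
  assumes V: "e + f + g - a - b - c - d = 1"
  shows "sp (f - e) * (sp (g - a - d) * sp (g - c) * sp (g - d) * sp (e - a) * sp (f - a)
        - sp (e - b) * sp (f - b) * sp (c - a) * sp (g - d) * sp d)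
    + sp (g - c - d) * (sp (e - b) * (sp (b - a) * sp (c - a) * sp (d - a) + sp (e - 2 * a) * sp (f - a) * sp (g - a)) * sp (e - c)
        - sp (f - b) * (sp (b - a) * sp (c - a) * sp (d - a) + sp (f - 2 * a) * sp (e - a) * sp (g - a)) * sp (f - c)) = 0"
proof -
  define H where "H x = exp (\<i> * of_real pi * x)" for x :: complex
  define q where "q = 1 / (2 * \<i>)"
  define \<alpha> \<beta> \<gamma> \<delta> where "\<alpha> = H a" and "\<beta> = H b" and "\<gamma> = H c" and "\<delta> = H d"
  define \<epsilon> \<phi> \<eta> where "\<epsilon> = H e" and "\<phi> = H f" and "\<eta> = H g"
  note defs = \<alpha>_def \<beta>_def \<gamma>_def \<delta>_def \<epsilon>_def \<phi>_def \<eta>_def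
  have sp: "sp (x - y) * (H x * H y) = q * (H x ^ 2 - H y ^ 2)" for x y
    using sp_diff_exp[of x y] by (simp add: H_def q_def)
  have Hadd: "H (x + y) = H x * H y" for x y by (simp add: H_def distrib_left exp_add)
  have H2: "H (2 * a) = \<alpha>\<^sup>2" using Hadd[of a a] by (simp add: \<alpha>_def power2_eq_square)
  have H0: "H 0 = 1" by (simp add: H_def)
  have H1: "H 1 = - 1" by (simp add: H_def exp_pi_i' mult.commute)
  have "e + f + g = 1 + a + b + c + d" using V by (simp add: algebra_simps)
  then have "H (e + f + g) = H (1 + a + b + c + d)" by simp
  then have rel: "\<epsilon> * \<phi> * \<eta> = - (\<alpha> * \<beta> * \<gamma> * \<delta>)" unfolding Hadd H1 defs by simp
  have nz: "\<alpha> \<noteq> 0" "\<beta> \<noteq> 0" "\<gamma> \<noteq> 0" "\<delta> \<noteq> 0" "\<epsilon> \<noteq> 0" "\<phi> \<noteq> 0" "\<eta> \<noteq> 0"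
    by (simp_all add: defs H_def)
  have s: "sp (f - e) * (\<phi> * \<epsilon>) = q * (\<phi>\<^sup>2 - \<epsilon>\<^sup>2)" "sp (g - c) * (\<eta> * \<gamma>) = q * (\<eta>\<^sup>2 - \<gamma>\<^sup>2)"
    "sp (g - d) * (\<eta> * \<delta>) = q * (\<eta>\<^sup>2 - \<delta>\<^sup>2)" "sp (e - a) * (\<epsilon> * \<alpha>) = q * (\<epsilon>\<^sup>2 - \<alpha>\<^sup>2)"
    "sp (f - a) * (\<phi> * \<alpha>) = q * (\<phi>\<^sup>2 - \<alpha>\<^sup>2)" "sp (e - b) * (\<epsilon> * \<beta>) = q * (\<epsilon>\<^sup>2 - \<beta>\<^sup>2)"
    "sp (f - b) * (\<phi> * \<beta>) = q * (\<phi>\<^sup>2 - \<beta>\<^sup>2)" "sp (c - a) * (\<gamma> * \<alpha>) = q * (\<gamma>\<^sup>2 - \<alpha>\<^sup>2)"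
    "sp (b - a) * (\<beta> * \<alpha>) = q * (\<beta>\<^sup>2 - \<alpha>\<^sup>2)" "sp (d - a) * (\<delta> * \<alpha>) = q * (\<delta>\<^sup>2 - \<alpha>\<^sup>2)"
    "sp (g - a) * (\<eta> * \<alpha>) = q * (\<eta>\<^sup>2 - \<alpha>\<^sup>2)" "sp (e - c) * (\<epsilon> * \<gamma>) = q * (\<epsilon>\<^sup>2 - \<gamma>\<^sup>2)"
    "sp (f - c) * (\<phi> * \<gamma>) = q * (\<phi>\<^sup>2 - \<gamma>\<^sup>2)"
    unfolding defs by (rule sp)+
  have s': "sp (e - 2 * a) * (\<epsilon> * \<alpha>\<^sup>2) = q * (\<epsilon>\<^sup>2 - (\<alpha>\<^sup>2)\<^sup>2)" "sp (f - 2 * a) * (\<phi> * \<alpha>\<^sup>2) = q * (\<phi>\<^sup>2 - (\<alpha>\<^sup>2)\<^sup>2)"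
    "sp (g - a - d) * (\<eta> * (\<alpha> * \<delta>)) = q * (\<eta>\<^sup>2 - \<alpha>\<^sup>2 * \<delta>\<^sup>2)"
    "sp (g - c - d) * (\<eta> * (\<gamma> * \<delta>)) = q * (\<eta>\<^sup>2 - \<gamma>\<^sup>2 * \<delta>\<^sup>2)"
    "sp d * \<delta> = q * (\<delta>\<^sup>2 - 1)"
    using sp[of e "2 * a"] sp[of f "2 * a"] sp[of g "a + d"] sp[of g "c + d"] sp[of d 0]
    unfolding H2 H0 Hadd defs[symmetric] by (simp_all add: diff_diff_eq power_mult_distrib)
  \<comment> \<open>A common multiplier that clears the exponentials from all six products; for two
    of them only modulo \<open>rel\<close>.\<close>
  define N where "N = \<phi>^2 * \<epsilon>^2 * \<eta>^3 * \<delta>^2 * \<alpha>^3 * \<gamma> * (\<beta>^2 * \<gamma>^2 * \<epsilon>^2 * \<phi>^2)"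
  have p1: "sp (f - e) * sp (g - d) * sp (g - a - d) * sp (g - c) * sp (e - a) * sp (f - a) * N
    = q^6 * (\<beta>^2 * \<gamma>^2 * \<epsilon>^2 * \<phi>^2 * ((\<phi>^2-\<epsilon>^2)*(\<eta>^2-\<delta>^2)*(\<eta>^2-\<alpha>^2*\<delta>^2)*(\<eta>^2-\<gamma>^2)*(\<epsilon>^2-\<alpha>^2)*(\<phi>^2-\<alpha>^2)))"
  proof -
    have "sp (f - e) * sp (g - d) * sp (g - a - d) * sp (g - c) * sp (e - a) * sp (f - a) * N
      = (sp (f - e) * (\<phi> * \<epsilon>)) * (sp (g - d) * (\<eta> * \<delta>)) * (sp (g - a - d) * (\<eta> * (\<alpha> * \<delta>)))
        * (sp (g - c) * (\<eta> * \<gamma>)) * (sp (e - a) * (\<epsilon> * \<alpha>)) * (sp (f - a) * (\<phi> * \<alpha>)) * (\<beta>^2 * \<gamma>^2 * \<epsilon>^2 * \<phi>^2)"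
      unfolding N_def by algebra
    then show ?thesis unfolding s s' by algebra
  qed
  have p2: "sp (f - e) * sp (g - d) * sp (e - b) * sp (f - b) * sp (c - a) * sp d * N
    = q^6 * (\<eta>^2 * \<alpha>^2 * \<gamma>^2 * \<epsilon>^2 * \<phi>^2 * ((\<phi>^2-\<epsilon>^2)*(\<eta>^2-\<delta>^2)*(\<epsilon>^2-\<beta>^2)*(\<phi>^2-\<beta>^2)*(\<gamma>^2-\<alpha>^2)*(\<delta>^2-1)))"
  proof -
    have "sp (f - e) * sp (g - d) * sp (e - b) * sp (f - b) * sp (c - a) * sp d * N
      = (sp (f - e) * (\<phi> * \<epsilon>)) * (sp (g - d) * (\<eta> * \<delta>)) * (sp (e - b) * (\<epsilon> * \<beta>)) * (sp (f - b) * (\<phi> * \<beta>))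
        * (sp (c - a) * (\<gamma> * \<alpha>)) * (sp d * \<delta>) * (\<eta>^2 * \<alpha>^2 * \<gamma>^2 * \<epsilon>^2 * \<phi>^2)"
      unfolding N_def by algebra
    then show ?thesis unfolding s s' by algebra
  qed
  have p3: "sp (g - c - d) * sp (e - b) * sp (e - c) * sp (b - a) * sp (c - a) * sp (d - a) * N
    = q^6 * (\<epsilon>^2 * (\<phi>^2)^2 * \<eta>^2 * ((\<eta>^2-\<gamma>^2*\<delta>^2)*(\<epsilon>^2-\<beta>^2)*(\<epsilon>^2-\<gamma>^2)*(\<beta>^2-\<alpha>^2)*(\<gamma>^2-\<alpha>^2)*(\<delta>^2-\<alpha>^2)))"
  proof -
    have "sp (g - c - d) * sp (e - b) * sp (e - c) * sp (b - a) * sp (c - a) * sp (d - a) * N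
      = (sp (g - c - d) * (\<eta> * (\<gamma> * \<delta>))) * (sp (e - b) * (\<epsilon> * \<beta>)) * (sp (e - c) * (\<epsilon> * \<gamma>))
        * (sp (b - a) * (\<beta> * \<alpha>)) * (sp (c - a) * (\<gamma> * \<alpha>)) * (sp (d - a) * (\<delta> * \<alpha>)) * (\<epsilon>^2 * (\<phi>^2)^2 * \<eta>^2)"
      unfolding N_def by algebra
    then show ?thesis unfolding s s' by algebra
  qed
  have p5: "sp (g - c - d) * sp (f - b) * sp (f - c) * sp (b - a) * sp (c - a) * sp (d - a) * N
    = q^6 * ((\<epsilon>^2)^2 * \<phi>^2 * \<eta>^2 * ((\<eta>^2-\<gamma>^2*\<delta>^2)*(\<phi>^2-\<beta>^2)*(\<phi>^2-\<gamma>^2)*(\<beta>^2-\<alpha>^2)*(\<gamma>^2-\<alpha>^2)*(\<delta>^2-\<alpha>^2)))"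
  proof -
    have "sp (g - c - d) * sp (f - b) * sp (f - c) * sp (b - a) * sp (c - a) * sp (d - a) * N
      = (sp (g - c - d) * (\<eta> * (\<gamma> * \<delta>))) * (sp (f - b) * (\<phi> * \<beta>)) * (sp (f - c) * (\<phi> * \<gamma>))
        * (sp (b - a) * (\<beta> * \<alpha>)) * (sp (c - a) * (\<gamma> * \<alpha>)) * (sp (d - a) * (\<delta> * \<alpha>)) * ((\<epsilon>^2)^2 * \<phi>^2 * \<eta>^2)"
      unfolding N_def by algebra
    then show ?thesis unfolding s s' by algebra
  qed
  have p4: "sp (g - c - d) * sp (e - b) * sp (e - c) * sp (e - 2 * a) * sp (f - a) * sp (g - a) * N
    = - (q^6 * (\<beta>^2 * \<gamma>^2 * \<delta>^2 * \<phi>^2 * ((\<eta>^2-\<gamma>^2*\<delta>^2)*(\<epsilon>^2-\<beta>^2)*(\<epsilon>^2-\<gamma>^2)*(\<epsilon>^2-(\<alpha>^2)^2)*(\<phi>^2-\<alpha>^2)*(\<eta>^2-\<alpha>^2))))"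
  proof -
    \<comment> \<open>For this product the multiplier matches the clearing monomial after one use of
      \<open>rel\<close>, whose sign comes from exp(i pi) = -1.\<close>
    have "N = - ((\<eta> * (\<gamma> * \<delta>)) * (\<epsilon> * \<beta>) * (\<epsilon> * \<gamma>) * (\<epsilon> * \<alpha>\<^sup>2) * (\<phi> * \<alpha>) * (\<eta> * \<alpha>) * (\<beta>^2 * \<gamma>^2 * \<delta>^2 * \<phi>^2))"
      unfolding N_def using rel by algebra
    then have "sp (g - c - d) * sp (e - b) * sp (e - c) * sp (e - 2 * a) * sp (f - a) * sp (g - a) * N
      = - ((sp (g - c - d) * (\<eta> * (\<gamma> * \<delta>))) * (sp (e - b) * (\<epsilon> * \<beta>)) * (sp (e - c) * (\<epsilon> * \<gamma>))
        * (sp (e - 2 * a) * (\<epsilon> * \<alpha>\<^sup>2)) * (sp (f - a) * (\<phi> * \<alpha>)) * (sp (g - a) * (\<eta> * \<alpha>)) * (\<beta>^2 * \<gamma>^2 * \<delta>^2 * \<phi>^2))"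
      by (simp only: mult_ac mult_minus_right)
    then show ?thesis unfolding s s' by algebra
  qed
  have p6: "sp (g - c - d) * sp (f - b) * sp (f - c) * sp (f - 2 * a) * sp (e - a) * sp (g - a) * N
    = - (q^6 * (\<beta>^2 * \<gamma>^2 * \<delta>^2 * \<epsilon>^2 * ((\<eta>^2-\<gamma>^2*\<delta>^2)*(\<phi>^2-\<beta>^2)*(\<phi>^2-\<gamma>^2)*(\<phi>^2-(\<alpha>^2)^2)*(\<epsilon>^2-\<alpha>^2)*(\<eta>^2-\<alpha>^2))))"
  proof -
    have "N = - ((\<eta> * (\<gamma> * \<delta>)) * (\<phi> * \<beta>) * (\<phi> * \<gamma>) * (\<phi> * \<alpha>\<^sup>2) * (\<epsilon> * \<alpha>) * (\<eta> * \<alpha>) * (\<beta>^2 * \<gamma>^2 * \<delta>^2 * \<epsilon>^2))"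
      unfolding N_def using rel by algebra
    then have "sp (g - c - d) * sp (f - b) * sp (f - c) * sp (f - 2 * a) * sp (e - a) * sp (g - a) * N
      = - ((sp (g - c - d) * (\<eta> * (\<gamma> * \<delta>))) * (sp (f - b) * (\<phi> * \<beta>)) * (sp (f - c) * (\<phi> * \<gamma>))
        * (sp (f - 2 * a) * (\<phi> * \<alpha>\<^sup>2)) * (sp (e - a) * (\<epsilon> * \<alpha>)) * (sp (g - a) * (\<eta> * \<alpha>)) * (\<beta>^2 * \<gamma>^2 * \<delta>^2 * \<epsilon>^2))"
      by (simp only: mult_ac mult_minus_right)
    then show ?thesis unfolding s s' by algebra
  qed
  have "\<eta>\<^sup>2 * \<epsilon>\<^sup>2 * \<phi>\<^sup>2 = \<alpha>\<^sup>2 * \<beta>\<^sup>2 * \<gamma>\<^sup>2 * \<delta>\<^sup>2" using rel by algebra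
  note poly = sp_polynomial_identity[OF this]
  let ?P1 = "sp (f - e) * sp (g - d) * sp (g - a - d) * sp (g - c) * sp (e - a) * sp (f - a)"
  let ?P2 = "sp (f - e) * sp (g - d) * sp (e - b) * sp (f - b) * sp (c - a) * sp d"
  let ?P3 = "sp (g - c - d) * sp (e - b) * sp (e - c) * sp (b - a) * sp (c - a) * sp (d - a)"
  let ?P4 = "sp (g - c - d) * sp (e - b) * sp (e - c) * sp (e - 2 * a) * sp (f - a) * sp (g - a)"
  let ?P5 = "sp (g - c - d) * sp (f - b) * sp (f - c) * sp (b - a) * sp (c - a) * sp (d - a)"
  let ?P6 = "sp (g - c - d) * sp (f - b) * sp (f - c) * sp (f - 2 * a) * sp (e - a) * sp (g - a)"
  have "(?P1 - ?P2 + ?P3 + ?P4 - ?P5 - ?P6) * N = ?P1 * N - ?P2 * N + ?P3 * N + ?P4 * N - ?P5 * N - ?P6 * N"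
    by (simp only: left_diff_distrib distrib_right)
  also have "\<dots> = 0"
  proof -
    have "Q * X1 - Q * X2 + Q * X3 + - (Q * X4) - Q * X5 - - (Q * X6) = Q * (X1 - X2 + X3 - X4 - X5 + X6)"
      for Q X1 X2 X3 X4 X5 X6 :: complex
      by (simp add: algebra_simps)
    then show ?thesis unfolding p1 p2 p3 p4 p5 p6 by (simp only: poly mult_zero_right)
  qed
  finally have "?P1 - ?P2 + ?P3 + ?P4 - ?P5 - ?P6 = 0" using nz by (simp add: N_def)
  then show ?thesis by (simp add: algebra_simps)
qed

text \<open>The coefficient of \<open>Y\<close> in \<open>relation6p14_algebra\<close>.\<close>

lemma sp_identity_y:
  "sp (f - e) * sp a = sp (f - 2 * a) * sp (e - a) - sp (e - 2 * a) * sp (f - a)"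
proof -
  have "sin u * sin (w - v) = sin (w - u) * sin v - sin (v - u) * sin w" for u v w :: complex
    by (simp add: sin_diff algebra_simps)
  from this[of "of_real pi * a" "of_real pi * (f - a)" "of_real pi * (e - a)"]
  show ?thesis by (simp add: sp_def algebra_simps)
qed

text \<open>In \<open>ell4F3_three_term\<close> this collapses the coefficient of \<open>x\<close>,
  a difference of two products, to a single product.\<close>

lemma sp_identity_z:
  "sp (g - a - d) * sp (g - c) - sp (g - c - d) * sp (g - a) = sp d * sp (c - a)"
proof -
  have "sin (x - u) * sin y - sin (y - u) * sin x = sin u * sin (x - y)" for u x y :: complex
    by (simp add: sin_diff algebra_simps)
  from this[of "of_real pi * (g - a)" "of_real pi * d" "of_real pi * (g - c)"]
  show ?thesis by (simp add: sp_def algebra_simps)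
qed

section \<open>The three-term relation\<close>

lemma rGamma_reflection_sp:
  assumes "x + y = 1"
  shows "rGamma x * rGamma y = sp x / of_real pi"
proof -
  have "y = 1 - x" using assms by (simp add: algebra_simps)
  then show ?thesis using rGamma_reflection_complex[of x] by (simp add: sp_def)
qed

lemma sp_minus: "sp (- x) = - sp x"
  by (simp add: sp_def)

lemma sp_one_plus: "sp (1 + x) = - sp x"
  by (simp add: sp_def distrib_left sin_add)

lemma ell4F3_swap67: "ell4F3 a b c d e f g = ell4F3 a b c d e g f"
  by (simp add: ell4F3_def lam4F3_def hyp4F3_reg_def hyp4F3_term_def mult_ac)

text \<open>The shift is an involution that exchanges the two series of \<open>lam4F3\<close> and so
  changes its sign; the sine in the denominator changes sign as well.\<close>

lemma ell4F3_shift: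
  "ell4F3 (1 + a - e) (1 + b - e) (1 + c - e) (1 + d - e) (2 - e) (1 + f - e) (1 + g - e) = ell4F3 a b c d e f g"
proof -
  have e: "1 + (1 + x - e) - (2 - e) = x" "2 - (2 - e) = e" for x by simp_all
  have "sp (2 - e) = - sp e"
    using sp_one_plus[of "1 + - e"] sp_one_plus[of "- e"] by (simp add: sp_def)
  then show ?thesis
    unfolding ell4F3_def lam4F3_def e sp_def[symmetric] by (simp add: minus_divide_left)
qed

text \<open>The function \<open>kap4F3 b a c d g e f\<close> has two expressions by \<open>kap4F3_eq_ell4F3\<close>, one for each choice of the
  special upper parameter; it is eliminated between them.\<close>

lemma ell4F3_three_term:
  fixes a b c d e f g :: complex
  assumes V: "e + f + g - a - b - c - d = 1"
    and nz: "sp g \<noteq> 0" "sp d \<noteq> 0" "sp (a - b) \<noteq> 0" "sp (b - c) \<noteq> 0"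
  shows "sp (c - a) * (rGamma (1 + b - e) * rGamma (1 + b - f) * rGamma (g - d) * rGamma (1 - d)) * ell4F3 a b c d g e f
    = sp (g - a - d) * (rGamma (1 + c - g) * rGamma c * rGamma (e - a) * rGamma (f - a))
        * ell4F3 a (1 + a - e) (1 + a - f) (1 + a - g) (1 + a - b) (1 + a - c) (1 + a - d)
    - sp (g - c - d) * (rGamma (1 + a - g) * rGamma a * rGamma (e - c) * rGamma (f - c))
        * ell4F3 b (1 + b - e) (1 + b - f) (1 + b - g) (1 + b - c) (1 + b - a) (1 + b - d)"
proof -
  define x where "x = ell4F3 a b c d g e f"
  define z where "z = ell4F3 a (1 + a - e) (1 + a - f) (1 + a - g) (1 + a - b) (1 + a - c) (1 + a - d)"
  define y where "y = ell4F3 b (1 + b - e) (1 + b - f) (1 + b - g) (1 + b - c) (1 + b - a) (1 + b - d)"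
  define k where "k = kap4F3 b a c d g e f"
  have V': "g + e + f - b - c - d - a = 1" "g + e + f - b - a - d - c = 1" using V by (simp_all add: algebra_simps)
  have nz': "sp (1 + b - a) \<noteq> 0" "sp (1 + b - c) \<noteq> 0"
    using nz sp_one_plus[of "b - a"] sp_one_plus[of "b - c"] sp_minus[of "a - b"] by (simp_all add: add_diff_eq)
  have px: "ell4F3 b c d a g e f = x" "ell4F3 b a d c g e f = x"
    unfolding x_def by (simp_all add: ell4F3_def lam4F3_def hyp4F3_reg_def hyp4F3_term_def mult_ac)
  have pk: "kap4F3 b c d a g e f = k" "kap4F3 b a d c g e f = k"
    unfolding k_def by (simp_all add: kap4F3_def hyp4F3_reg_def hyp4F3_term_def mult_ac)
  have py: "ell4F3 b (1 + b - g) (1 + b - e) (1 + b - f) (1 + b - c) (1 + b - a) (1 + b - d) = y"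
    unfolding y_def by (simp add: ell4F3_def lam4F3_def hyp4F3_reg_def hyp4F3_term_def mult_ac)
  \<comment> \<open>\<open>z\<close> is defined from the parameters around \<open>a\<close>; one
    shift with fifth parameter \<open>1 + a - b\<close> moves it to those around \<open>b\<close>,
    where it meets \<open>y\<close>.\<close>
  have pz: "ell4F3 b (1 + b - g) (1 + b - e) (1 + b - f) (1 + b - a) (1 + b - c) (1 + b - d) = z"
  proof -
    have e: "1 + a - (1 + a - b) = b" "1 + (1 + a - u) - (1 + a - b) = 1 + b - u" "2 - (1 + a - b) = 1 + b - a" for u
      by simp_all
    have "z = ell4F3 b (1 + b - e) (1 + b - f) (1 + b - g) (1 + b - a) (1 + b - c) (1 + b - d)"
      unfolding z_def ell4F3_shift[of a "1 + a - b", symmetric] e ..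
    then show ?thesis by (simp add: ell4F3_def lam4F3_def hyp4F3_reg_def hyp4F3_term_def mult_ac)
  qed
  have k2: "sp (g - c - d) * (k * rGamma (1 + a - g)) = of_real pi ^ 2 *
      ((rGamma (1 + b - e) * rGamma (1 + b - f) * rGamma (g - c) * rGamma (g - d)) * x
       - (rGamma c * rGamma d * rGamma (e - a) * rGamma (f - a)) * z)"
    using kap4F3_eq_ell4F3[OF V'(1)] nz(1) nz' unfolding sp_def[symmetric] px py pz pk by blast
  have k3: "sp (g - a - d) * (k * rGamma (1 + c - g)) = of_real pi ^ 2 *
      ((rGamma (1 + b - e) * rGamma (1 + b - f) * rGamma (g - a) * rGamma (g - d)) * x
       - (rGamma a * rGamma d * rGamma (e - c) * rGamma (f - c)) * y)"
    using kap4F3_eq_ell4F3[OF V'(2)] nz(1) nz' unfolding sp_def[symmetric] px py pz pk by blast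
  have r: "rGamma (g - c) * rGamma (1 + c - g) = sp (g - c) / of_real pi"
    "rGamma (g - a) * rGamma (1 + a - g) = sp (g - a) / of_real pi" "rGamma d * rGamma (1 - d) = sp d / of_real pi"
    by (rule rGamma_reflection_sp; simp)+
  define E where "E = rGamma (1 + b - e) * rGamma (1 + b - f) * rGamma (g - d)"
  have "of_real pi ^ 2 * (sp (g - a - d) * (E * x * (rGamma (g - c) * rGamma (1 + c - g))
        - rGamma d * (rGamma (1 + c - g) * rGamma c * rGamma (e - a) * rGamma (f - a)) * z))
    = sp (g - a - d) * rGamma (1 + c - g) * (of_real pi ^ 2 *
      ((rGamma (1 + b - e) * rGamma (1 + b - f) * rGamma (g - c) * rGamma (g - d)) * x
       - (rGamma c * rGamma d * rGamma (e - a) * rGamma (f - a)) * z))"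
    by (simp add: E_def algebra_simps)
  also have "\<dots> = sp (g - c - d) * rGamma (1 + a - g) * (of_real pi ^ 2 *
      ((rGamma (1 + b - e) * rGamma (1 + b - f) * rGamma (g - a) * rGamma (g - d)) * x
       - (rGamma a * rGamma d * rGamma (e - c) * rGamma (f - c)) * y))"
    unfolding k2[symmetric] k3[symmetric] by (simp only: mult_ac)
  also have "\<dots> = of_real pi ^ 2 * (sp (g - c - d) * (E * x * (rGamma (g - a) * rGamma (1 + a - g))
        - rGamma d * (rGamma (1 + a - g) * rGamma a * rGamma (e - c) * rGamma (f - c)) * y))"
    by (simp add: E_def algebra_simps)
  finally have "sp (g - a - d) * (E * x * (sp (g - c) / of_real pi)
        - rGamma d * (rGamma (1 + c - g) * rGamma c * rGamma (e - a) * rGamma (f - a)) * z)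
    = sp (g - c - d) * (E * x * (sp (g - a) / of_real pi)
        - rGamma d * (rGamma (1 + a - g) * rGamma a * rGamma (e - c) * rGamma (f - c)) * y)"
    unfolding r by simp
  then have "E * x * ((sp (g - a - d) * sp (g - c) - sp (g - c - d) * sp (g - a)) / of_real pi)
     = rGamma d * (sp (g - a - d) * (rGamma (1 + c - g) * rGamma c * rGamma (e - a) * rGamma (f - a)) * z
         - sp (g - c - d) * (rGamma (1 + a - g) * rGamma a * rGamma (e - c) * rGamma (f - c)) * y)"
    by (simp add: algebra_simps diff_divide_distrib)
  \<comment> \<open>The collapsed coefficient contains \<open>sp d\<close>, hence a factor
    \<open>rGamma d\<close> by reflection, which is common to all terms and can be
    cancelled.\<close>
  also have "(sp (g - a - d) * sp (g - c) - sp (g - c - d) * sp (g - a)) / of_real pi = rGamma d * rGamma (1 - d) * sp (c - a)"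
    unfolding sp_identity_z r by simp
  finally have "rGamma d * (sp (c - a) * (E * rGamma (1 - d)) * x)
     = rGamma d * (sp (g - a - d) * (rGamma (1 + c - g) * rGamma c * rGamma (e - a) * rGamma (f - a)) * z
         - sp (g - c - d) * (rGamma (1 + a - g) * rGamma a * rGamma (e - c) * rGamma (f - c)) * y)"
    by (simp only: mult_ac)
  moreover have "rGamma d \<noteq> 0" using r(3) nz(2) by auto
  ultimately show ?thesis
    unfolding x_def[symmetric] y_def[symmetric] z_def[symmetric] E_def by (simp only: mult_cancel_left) (simp add: mult_ac)
qed

text \<open>Multiplication by the three sines in the denominators of the \<open>K\<close> functions makes the relation
  an identity between entire functions on \<open>V\<close>.\<close>

definition relation6p14 :: "complex \<Rightarrow> complex \<Rightarrow> complex \<Rightarrow> complex \<Rightarrow> complex \<Rightarrow> complex \<Rightarrow> complex \<Rightarrow> complex" where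
  "relation6p14 a b c d e f g =
     sp (e - a) * sp (f - a) * (sinpi_prod [f - e]
       * rGamma4 (1 - a) (1 - b) (1 + c - g) (1 + d - g)
       * rGamma4 b (1 + b - e) (1 + b - f) (1 + b - g)
       * rGamma4 (1 - a) (e - a) (f - a) (g - a)
       * (rGamma a * kap4F3 a b c d e f g))
     - sp a * sp (f - a) * (rGamma4 (1 + a - e) (1 + b - e) (f - c) (f - d)
       * B5 a b c d f e g
       * (rGamma (e - a) * kap4F3 (e - a) (e - b) (e - c) (e - d) (1 + e - f) (1 + e - g) e))
     + sp a * sp (e - a) * (rGamma4 (1 + a - f) (1 + b - f) (e - c) (e - d)
       * B5 a b c d e f g
       * (rGamma (f - a) * kap4F3 (f - a) (f - b) (f - c) (f - d) (1 + f - g) f (1 + f - e)))"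

lemma sinpi_prod_single: "sinpi_prod [x] = sp x"
  by (simp add: sinpi_prod_def sp_def)

lemma B5_eq: "B5 a b c d e f g = 1 / of_real pi ^ 4 * (sp b * sp (e - b))
    * (sp (b - a) * sp (c - a) * sp (d - a) + sp (e - 2 * a) * sp (f - a) * sp (g - a))"
  by (simp add: B5_def sinpi_prod_def sp_def)

text \<open>\<open>sfe\<close> stands for \<open>sp (f - e)\<close> and so on, \<open>se2a\<close>
  for \<open>sp (e - 2 * a)\<close>, \<open>M\<close> for the product of sines shared by both
  \<open>B5\<close> factors, \<open>S1\<close> for \<open>sp (g - c - d)\<close>, \<open>S2\<close>
  for \<open>sp (g - a - d)\<close>. After multiplication by \<open>S1\<close> and \<open>S2\<close>
  the relation is linear in \<open>X\<close> and \<open>Y\<close>: \<open>idx\<close> kills the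
  coefficient of \<open>X\<close>; in that of \<open>Y\<close> the terms with \<open>M\<close>
  cancel and \<open>idy\<close> kills the rest.\<close>

lemma relation6p14_algebra:
  fixes X Y :: complex
  assumes idx: "sfe * (S2 * sgc * sgd * sea * sfa - seb * sfb * sca * sgd * sd)
      + S1 * (seb * (M + se2a * sfa * sga) * sec - sfb * (M + sf2a * sea * sga) * sfc) = 0"
    and idy: "sfe * sa = sf2a * sea - se2a * sfa"
    and t1: "S2 * (S1 * T1) = sfe * sb * sa / P * (S2 * sgc * sgd * sea * sfa * X - seb * sfb * (sca * sgd * sd * X + S1 * sa * sga * Y))"
    and t2: "S2 * T2 = sea * (sfc * X - seb * Y)"
    and t3: "S2 * T3 = sfa * (sec * X - sfb * Y)"
    and nz: "S1 \<noteq> 0" "S2 \<noteq> 0"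
  shows "sea * sfa * T1 - sa * sfa * (1 / P * (sb * sfb) * (M + sf2a * sea * sga) * T2)
    + sa * sea * (1 / P * (sb * seb) * (M + se2a * sfa * sga) * T3) = 0"
proof -
  define I where "I = 1 / P"
  have "S2 * (S1 * (sea * sfa * T1 - sa * sfa * (I * (sb * sfb) * (M + sf2a * sea * sga) * T2)
    + sa * sea * (I * (sb * seb) * (M + se2a * sfa * sga) * T3)))
    = sea * sfa * (S2 * (S1 * T1)) - sa * sfa * (I * (sb * sfb) * (M + sf2a * sea * sga) * S1 * (S2 * T2))
      + sa * sea * (I * (sb * seb) * (M + se2a * sfa * sga) * S1 * (S2 * T3))"
    by (simp add: algebra_simps)
  also have "\<dots> = I * sa * sb * sea * sfa * (X * (sfe * (S2 * sgc * sgd * sea * sfa - seb * sfb * sca * sgd * sd)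
      + S1 * (seb * (M + se2a * sfa * sga) * sec - sfb * (M + sf2a * sea * sga) * sfc))
     - Y * S1 * seb * sfb * sga * (sfe * sa - (sf2a * sea - se2a * sfa)))"
    unfolding t1 t2 t3 by (simp add: I_def algebra_simps add_divide_distrib diff_divide_distrib)
  also have "\<dots> = 0" unfolding idx idy by simp
  finally show ?thesis using nz by (simp add: I_def)
qed

text \<open>Away from the zeros of nine sines every transformation is available. \<open>k1\<close>
  expresses the first function through \<open>x\<close> and \<open>z\<close>, \<open>k4\<close> and
  \<open>k8\<close> express the other two through \<open>x\<close> and \<open>y\<close>, and
  \<open>I\<close> removes \<open>z\<close>.\<close>

lemma relation6p14_generic:
  fixes a b c d e f g :: complex
  assumes V: "e + f + g - a - b - c - d = 1"
    and nz: "sp g \<noteq> 0" "sp d \<noteq> 0" "sp (a - b) \<noteq> 0" "sp (b - c) \<noteq> 0" "sp (a - d) \<noteq> 0" "sp (c - d) \<noteq> 0"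
      "sp (e - f) \<noteq> 0" "sp (g - c - d) \<noteq> 0" "sp (g - a - d) \<noteq> 0"
  shows "relation6p14 a b c d e f g = 0"
proof -
  define x where "x = ell4F3 a b c d g e f"
  define z where "z = ell4F3 a (1 + a - e) (1 + a - f) (1 + a - g) (1 + a - b) (1 + a - c) (1 + a - d)"
  define y where "y = ell4F3 b (1 + b - e) (1 + b - f) (1 + b - g) (1 + b - c) (1 + b - a) (1 + b - d)"
  have nz': "sp (1 + u - v) \<noteq> 0" if "sp (u - v) \<noteq> 0 \<or> sp (v - u) \<noteq> 0" for u v
    using that sp_one_plus[of "u - v"] sp_minus[of "u - v"] by (auto simp: add_diff_eq)
  have I: "sp (c - a) * (rGamma (1 + b - e) * rGamma (1 + b - f) * rGamma (g - d) * rGamma (1 - d)) * x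
    = sp (g - a - d) * (rGamma (1 + c - g) * rGamma c * rGamma (e - a) * rGamma (f - a)) * z
    - sp (g - c - d) * (rGamma (1 + a - g) * rGamma a * rGamma (e - c) * rGamma (f - c)) * y"
    unfolding x_def y_def z_def by (rule ell4F3_three_term[OF V nz(1-4)])
  have k1: "sp (g - c - d) * (kap4F3 a b c d e f g * rGamma (1 + b - g)) = of_real pi ^ 2 *
      ((rGamma (1 + a - e) * rGamma (1 + a - f) * rGamma (g - c) * rGamma (g - d)) * x
       - (rGamma c * rGamma d * rGamma (e - b) * rGamma (f - b)) * z)"
  proof -
    have p: "kap4F3 a c d b g e f = kap4F3 a b c d e f g" "ell4F3 a c d b g e f = x"
      "ell4F3 a (1 + a - g) (1 + a - e) (1 + a - f) (1 + a - b) (1 + a - c) (1 + a - d) = z"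
      unfolding x_def z_def
      by (simp_all add: kap4F3_def ell4F3_def lam4F3_def hyp4F3_reg_def hyp4F3_term_def mult_ac)
    have V': "g + e + f - a - c - d - b = 1" using V by (simp add: algebra_simps)
    show ?thesis
      using kap4F3_eq_ell4F3[OF V'] nz(1) nz'[of a b] nz(3) unfolding sp_def[symmetric] p by blast
  qed
  have n: "sp (1 + e - f) \<noteq> 0" "sp (1 + f - e) \<noteq> 0" "sp (1 + d - c) \<noteq> 0" "sp (1 + b - c) \<noteq> 0" "sp (1 + d - a) \<noteq> 0"
    by (rule nz'; use nz in simp)+
  have V': "g + f + e - a - b - c - d = 1" "g + e + f - a - b - c - d = 1" using V by (simp_all add: algebra_simps)
  \<comment> \<open>\<open>x\<close> is also the value of \<open>ell4F3\<close> attached to the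
    first series of each of the other two functions.\<close>
  have xe: "ell4F3 (e - a) (e - b) (e - c) (e - d) (1 + e - f) (1 + e - g) e = x"
    using ell4F3_transform[OF V'(1), folded sp_def] nz n ell4F3_swap67 unfolding x_def by metis
  have xf: "ell4F3 (f - a) (f - b) (f - c) (f - d) (1 + f - e) (1 + f - g) f = x"
    using ell4F3_transform[OF V'(2), folded sp_def] nz n unfolding x_def by metis
  \<comment> \<open>Up to permutations of the arguments, this is the value attached to the second
    series of both other functions, which is why \<open>k4\<close> and \<open>k8\<close> share
    \<open>y\<close>.\<close>
  have yy: "ell4F3 (1 - a) (g - a) (e - a) (f - a) (1 + d - a) (1 + c - a) (1 + b - a) = y"
  proof -
    have V'': "1 + b - c + (1 + b - d) + (1 + b - a) - b - (1 + b - g) - (1 + b - e) - (1 + b - f) = 1"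
      using V by (simp add: algebra_simps)
    have e: "1 + (1 + b - a) - (1 + b - d) = 1 + d - a" "1 + (1 + b - f) - (1 + b - e) = 1 + e - f"
      "1 + b - a - b = 1 - a" "1 + b - a - (1 + b - u) = u - a" "1 + (1 + b - a) - (1 + b - c) = 1 + c - a" for u
      by simp_all
    have "y = ell4F3 b (1 + b - g) (1 + b - e) (1 + b - f) (1 + b - c) (1 + b - d) (1 + b - a)"
      unfolding y_def by (simp add: ell4F3_def lam4F3_def hyp4F3_reg_def hyp4F3_term_def mult_ac)
    also have "\<dots> = ell4F3 (1 - a) (g - a) (e - a) (f - a) (1 + d - a) (1 + c - a) (1 + b - a)"
      using ell4F3_transform[OF V'', folded sp_def, unfolded e] n by blast
    finally show ?thesis ..
  qed
  have k4: "sp (g - a - d) * (kap4F3 (e - a) (e - b) (e - c) (e - d) (1 + e - f) (1 + e - g) e * rGamma (f - d)) = of_real pi ^ 2 *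
      ((rGamma (g - a) * rGamma (1 - a) * rGamma (1 + b - f) * rGamma (1 + c - f)) * x
       - (rGamma (e - b) * rGamma (e - c) * rGamma (1 + d - g) * rGamma d) * y)"
  proof -
    have e: "1 + b - f - (e - c) = g - a - d" "1 + (e - d) - (1 + e - f) = f - d"
      "1 + (e - a) - (1 + e - g) = g - a" "1 + (e - a) - e = 1 - a" "1 + e - f - (e - b) = 1 + b - f"
      "1 + e - f - (e - c) = 1 + c - f" "1 + e - g - (e - d) = 1 + d - g" "e - (e - d) = d"
      "1 + (e - a) - (1 + e - f) = f - a" "1 + (e - a) - (e - d) = 1 + d - a" "1 + (e - a) - (e - b) = 1 + b - a"
      "1 + (e - a) - (e - c) = 1 + c - a"
      using V by (simp_all add: algebra_simps)
    have p: "ell4F3 (e - a) (f - a) (g - a) (1 - a) (1 + d - a) (1 + b - a) (1 + c - a) = y"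
      unfolding yy[symmetric] by (simp add: ell4F3_def lam4F3_def hyp4F3_reg_def hyp4F3_term_def mult_ac)
    have "1 + e - f + (1 + e - g) + e - (e - a) - (e - b) - (e - c) - (e - d) = 1"
      using V by (simp add: algebra_simps)
    from kap4F3_eq_ell4F3[OF this, folded sp_def, unfolded e xe p] n show ?thesis by blast
  qed
  have k8: "sp (g - a - d) * (kap4F3 (f - a) (f - b) (f - c) (f - d) (1 + f - g) f (1 + f - e) * rGamma (e - d)) = of_real pi ^ 2 *
      ((rGamma (g - a) * rGamma (1 - a) * rGamma (1 + b - e) * rGamma (1 + c - e)) * x
       - (rGamma (f - b) * rGamma (f - c) * rGamma (1 + d - g) * rGamma d) * y)"
  proof -
    have e: "1 + b - e - (f - c) = g - a - d" "1 + (f - d) - (1 + f - e) = e - d"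
      "1 + (f - a) - (1 + f - g) = g - a" "1 + (f - a) - f = 1 - a" "1 + f - e - (f - b) = 1 + b - e"
      "1 + f - e - (f - c) = 1 + c - e" "1 + f - g - (f - d) = 1 + d - g" "f - (f - d) = d"
      "1 + (f - a) - (1 + f - e) = e - a" "1 + (f - a) - (f - d) = 1 + d - a" "1 + (f - a) - (f - b) = 1 + b - a"
      "1 + (f - a) - (f - c) = 1 + c - a"
      using V by (simp_all add: algebra_simps)
    have p: "ell4F3 (f - a) (e - a) (g - a) (1 - a) (1 + d - a) (1 + b - a) (1 + c - a) = y"
      unfolding yy[symmetric] by (simp add: ell4F3_def lam4F3_def hyp4F3_reg_def hyp4F3_term_def mult_ac)
    have pk: "kap4F3 (f - a) (f - b) (f - c) (f - d) (1 + f - g) f (1 + f - e)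
        = kap4F3 (f - a) (f - b) (f - c) (f - d) (1 + f - e) (1 + f - g) f"
      by (simp add: kap4F3_def hyp4F3_reg_def hyp4F3_term_def mult_ac)
    have "1 + f - e + (1 + f - g) + f - (f - a) - (f - b) - (f - c) - (f - d) = 1"
      using V by (simp add: algebra_simps)
    from kap4F3_eq_ell4F3[OF this, folded sp_def, unfolded e xf p] n show ?thesis unfolding pk by blast
  qed
  define Q where "Q = rGamma (1 + c - g) * rGamma (1 + d - g) * rGamma (1 + b - e) * rGamma (1 + b - f) * rGamma (1 - a)
    * rGamma (e - a) * rGamma (f - a) * rGamma (g - a)"
  \<comment> \<open>\<open>X\<close> and \<open>Y\<close> carry exactly the Gamma factors that make
    all remaining ones in \<open>t1\<close>, \<open>t2\<close>, \<open>t3\<close> pair up by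
    reflection.\<close>
  define X where "X = rGamma (1 + b - e) * rGamma (1 + b - f) * rGamma (1 - a) * rGamma (g - a) * x"
  define Y where "Y = rGamma (e - c) * rGamma (f - c) * rGamma (1 + d - g) * rGamma d * y"
  define D where "D = rGamma (1 + d - g) * rGamma (1 - a) * rGamma (g - a) * rGamma d"
  define Z where "Z = (rGamma (1 + c - g) * rGamma c * rGamma (e - a) * rGamma (f - a)) * z"
  define T1 where "T1 = sp (f - e)
       * rGamma4 (1 - a) (1 - b) (1 + c - g) (1 + d - g)
       * rGamma4 b (1 + b - e) (1 + b - f) (1 + b - g)
       * rGamma4 (1 - a) (e - a) (f - a) (g - a)
       * (rGamma a * kap4F3 a b c d e f g)"
  define T2 where "T2 = rGamma4 (1 + a - e) (1 + b - e) (f - c) (f - d)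
       * (rGamma (e - a) * kap4F3 (e - a) (e - b) (e - c) (e - d) (1 + e - f) (1 + e - g) e)"
  define T3 where "T3 = rGamma4 (1 + a - f) (1 + b - f) (e - c) (e - d)
       * (rGamma (f - a) * kap4F3 (f - a) (f - b) (f - c) (f - d) (1 + f - g) f (1 + f - e))"
  let ?p = "complex_of_real pi"
  have r: "rGamma b * rGamma (1 - b) = sp b / ?p" "rGamma a * rGamma (1 - a) = sp a / ?p" "rGamma d * rGamma (1 - d) = sp d / ?p"
    "rGamma (g - c) * rGamma (1 + c - g) = sp (g - c) / ?p" "rGamma (g - d) * rGamma (1 + d - g) = sp (g - d) / ?p"
    "rGamma (g - a) * rGamma (1 + a - g) = sp (g - a) / ?p"
    "rGamma (e - a) * rGamma (1 + a - e) = sp (e - a) / ?p" "rGamma (f - a) * rGamma (1 + a - f) = sp (f - a) / ?p"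
    "rGamma (e - b) * rGamma (1 + b - e) = sp (e - b) / ?p" "rGamma (f - b) * rGamma (1 + b - f) = sp (f - b) / ?p"
    "rGamma (e - c) * rGamma (1 + c - e) = sp (e - c) / ?p" "rGamma (f - c) * rGamma (1 + c - f) = sp (f - c) / ?p"
    by (rule rGamma_reflection_sp; simp)+
  \<comment> \<open>The three-term relation \<open>I\<close> multiplied by \<open>D\<close>; this is
    where \<open>z\<close> disappears from the first term.\<close>
  have DZ: "sp (g - a - d) * (D * Z) = sp (c - a) * (sp (g - d) / ?p) * (sp d / ?p) * X + sp (g - c - d) * (sp a / ?p) * (sp (g - a) / ?p) * Y"
  proof -
    have "sp (g - a - d) * (D * Z) = D * (sp (c - a) * (rGamma (1 + b - e) * rGamma (1 + b - f) * rGamma (g - d) * rGamma (1 - d)) * x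
        + sp (g - c - d) * (rGamma (1 + a - g) * rGamma a * rGamma (e - c) * rGamma (f - c)) * y)"
      unfolding I by (simp add: Z_def algebra_simps)
    also have "\<dots> = sp (c - a) * (rGamma (g - d) * rGamma (1 + d - g)) * (rGamma d * rGamma (1 - d)) * X
        + sp (g - c - d) * (rGamma a * rGamma (1 - a)) * (rGamma (g - a) * rGamma (1 + a - g)) * Y"
      by (simp add: D_def X_def Y_def distrib_left mult_ac)
    finally show ?thesis unfolding r .
  qed
  have "sp (g - c - d) * T1 = sp (f - e) * (rGamma b * rGamma (1 - b)) * (rGamma a * rGamma (1 - a))
      * (Q * (sp (g - c - d) * (kap4F3 a b c d e f g * rGamma (1 + b - g))))"
    by (simp only: T1_def rGamma4_def Q_def mult_ac)
  also have "\<dots> = sp (f - e) * (rGamma b * rGamma (1 - b)) * (rGamma a * rGamma (1 - a)) * (?p ^ 2 *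
      ((rGamma (g - c) * rGamma (1 + c - g)) * (rGamma (g - d) * rGamma (1 + d - g)) * (rGamma (e - a) * rGamma (1 + a - e))
         * (rGamma (f - a) * rGamma (1 + a - f)) * X
       - (rGamma (e - b) * rGamma (1 + b - e)) * (rGamma (f - b) * rGamma (1 + b - f)) * (D * Z)))"
    unfolding k1 by (simp only: Q_def X_def D_def Z_def right_diff_distrib mult_ac)
  finally have "sp (g - a - d) * (sp (g - c - d) * T1) = sp (f - e) * (sp b / ?p) * (sp a / ?p) * (?p ^ 2 *
      (sp (g - a - d) * (sp (g - c) / ?p) * (sp (g - d) / ?p) * (sp (e - a) / ?p) * (sp (f - a) / ?p) * X
       - (sp (e - b) / ?p) * (sp (f - b) / ?p) * (sp (g - a - d) * (D * Z))))"
    unfolding r by (simp only: right_diff_distrib mult_ac)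
  note T1 = this
  have t1: "sp (g - a - d) * (sp (g - c - d) * T1) = sp (f - e) * sp b * sp a / ?p ^ 4 *
      (sp (g - a - d) * sp (g - c) * sp (g - d) * sp (e - a) * sp (f - a) * X
       - sp (e - b) * sp (f - b) * (sp (c - a) * sp (g - d) * sp d * X + sp (g - c - d) * sp a * sp (g - a) * Y))"
  proof -
    have gen: "u * (v / p) * (w / p) * (p ^ 2 * (S * (p1 / p) * (p2 / p) * (p3 / p) * (p4 / p) * X
        - (q1 / p) * (q2 / p) * (q3 * (p2 / p) * (q4 / p) * X + S' * (w / p) * (q5 / p) * Y)))
      = u * v * w / p ^ 4 * (S * p1 * p2 * p3 * p4 * X - q1 * q2 * (q3 * p2 * q4 * X + S' * w * q5 * Y))"
      if "p \<noteq> 0" for u v w p S p1 p2 p3 p4 q1 q2 q3 q4 q5 S' X Y :: complex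
    proof -
      define i where "i = inverse p"
      have "p * i = 1" using that by (simp add: i_def)
      then show ?thesis unfolding divide_inverse power_inverse[symmetric] i_def[symmetric] by algebra
    qed
    show ?thesis using T1 unfolding DZ by (simp only: gen of_real_eq_0_iff pi_neq_zero not_False_eq_True)
  qed
  have gen2: "u / ?p * ?p ^ 2 * (v / ?p * X - w / ?p * Y) = u * (v * X - w * Y)" for u v w
    by (simp add: field_simps power2_eq_square)
  have "sp (g - a - d) * T2 = (rGamma (e - a) * rGamma (1 + a - e)) * rGamma (1 + b - e) * rGamma (f - c)
      * (sp (g - a - d) * (kap4F3 (e - a) (e - b) (e - c) (e - d) (1 + e - f) (1 + e - g) e * rGamma (f - d)))"
    by (simp only: T2_def rGamma4_def mult_ac)
  also have "\<dots> = (rGamma (e - a) * rGamma (1 + a - e)) * ?p ^ 2 * ((rGamma (f - c) * rGamma (1 + c - f)) * X - (rGamma (e - b) * rGamma (1 + b - e)) * Y)"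
    unfolding k4 by (simp only: X_def Y_def right_diff_distrib mult_ac)
  finally have t2: "sp (g - a - d) * T2 = sp (e - a) * (sp (f - c) * X - sp (e - b) * Y)"
    unfolding r by (simp only: gen2)
  have "sp (g - a - d) * T3 = (rGamma (f - a) * rGamma (1 + a - f)) * rGamma (1 + b - f) * rGamma (e - c)
      * (sp (g - a - d) * (kap4F3 (f - a) (f - b) (f - c) (f - d) (1 + f - g) f (1 + f - e) * rGamma (e - d)))"
    by (simp only: T3_def rGamma4_def mult_ac)
  also have "\<dots> = (rGamma (f - a) * rGamma (1 + a - f)) * ?p ^ 2 * ((rGamma (e - c) * rGamma (1 + c - e)) * X - (rGamma (f - b) * rGamma (1 + b - f)) * Y)"
    unfolding k8 by (simp only: X_def Y_def right_diff_distrib mult_ac)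
  finally have t3: "sp (g - a - d) * T3 = sp (f - a) * (sp (e - c) * X - sp (f - b) * Y)"
    unfolding r by (simp only: gen2)
  have "relation6p14 a b c d e f g = sp (e - a) * sp (f - a) * T1
      - sp a * sp (f - a) * (B5 a b c d f e g * T2) + sp a * sp (e - a) * (B5 a b c d e f g * T3)"
    by (simp add: relation6p14_def T1_def T2_def T3_def sinpi_prod_def mult_ac flip: sp_def)
  also have "\<dots> = sp (e - a) * sp (f - a) * T1
      - sp a * sp (f - a) * (1 / ?p ^ 4 * (sp b * sp (f - b)) * (sp (b - a) * sp (c - a) * sp (d - a) + sp (f - 2 * a) * sp (e - a) * sp (g - a)) * T2)
      + sp a * sp (e - a) * (1 / ?p ^ 4 * (sp b * sp (e - b)) * (sp (b - a) * sp (c - a) * sp (d - a) + sp (e - 2 * a) * sp (f - a) * sp (g - a)) * T3)"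
    unfolding B5_eq ..
  also have "\<dots> = 0"
    by (rule relation6p14_algebra[OF sp_identity_x[OF V] sp_identity_y t1 t2 t3 nz(8,9)])
  finally show ?thesis .
qed

text \<open>Zeros of the sine are isolated: if \<open>sp (u + t * k) = 0\<close>, then
  \<open>sp\<close> does not vanish at the points \<open>t + of_real (h n) / k\<close> with
  \<open>h n\<close> strictly between 0 and 1. There \<open>F\<close> vanishes, and continuity
  carries this to \<open>t\<close>.\<close>

lemma continuous_zero_of_sp_mult_zero:
  fixes F :: "complex \<Rightarrow> complex"
  assumes F: "continuous_on UNIV F" and k: "k \<noteq> 0" and z: "\<And>t. sp (u + t * k) * F t = 0"
  shows "F t = 0"
proof (cases "sp (u + t * k) = 0")
  case False
  then show ?thesis using z[of t] by simp
next
  case True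
  define h where "h n = inverse (real (Suc (Suc n)))" for n
  have h: "0 < h n" "h n < 1" for n by (simp_all add: h_def inverse_less_1_iff)
  have h0: "(\<lambda>n. complex_of_real (h n)) \<longlonglongrightarrow> of_real 0"
    unfolding h_def by (intro tendsto_of_real LIMSEQ_Suc[OF LIMSEQ_inverse_real_of_nat])
  have "F (t + of_real (h n) / k) = 0" for n
  proof -
    let ?w = "of_real pi * (u + t * k) :: complex"
    have s0: "sin ?w = 0" using True by (simp add: sp_def)
    then have "cos ?w \<noteq> 0" using sin_cos_squared_add[of ?w] by auto
    moreover have "sin (complex_of_real pi * of_real (h n)) = of_real (sin (pi * h n))"
      by (metis of_real_mult sin_of_real)
    moreover have "sin (pi * h n) > 0" using h[of n] by (intro sin_gt_zero) auto
    moreover have arg: "of_real pi * (u + (t + of_real (h n) / k) * k) = ?w + of_real pi * of_real (h n)"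
      using k by (simp add: field_simps)
    have "sp (u + (t + of_real (h n) / k) * k) = cos ?w * sin (complex_of_real pi * of_real (h n))"
      unfolding sp_def arg sin_add s0 by simp
    ultimately have "sp (u + (t + of_real (h n) / k) * k) \<noteq> 0" by simp
    then show ?thesis using z[of "t + of_real (h n) / k"] by simp
  qed
  moreover have "(\<lambda>n. F (t + of_real (h n) / k)) \<longlonglongrightarrow> F (t + of_real 0 / k)"
    by (intro continuous_on_tendsto_compose[OF F] tendsto_intros h0) (use k in auto)
  ultimately show ?thesis by (simp add: LIMSEQ_const_iff)
qed

lemma continuous_zero_of_sp_mult_zero':
  assumes "\<forall>t. sp (u + t * k) * F t = 0" "k \<noteq> 0" "continuous_on UNIV F"
  shows "\<forall>t. F t = 0"
  using assms continuous_zero_of_sp_mult_zero by blast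

text \<open>On a line through the given point, the generic case shows that \<open>F\<close> times
  nine sines vanishes identically; each sine is then cancelled by continuity.\<close>

lemma relation6p14_eq_0:
  fixes a b c d e f g :: complex
  assumes V: "e + f + g - a - b - c - d = 1"
  shows "relation6p14 a b c d e f g = 0"
proof -
  \<comment> \<open>The direction stays inside \<open>V\<close>, and none of the nine forms excluded at generic points is constant along it.\<close>
  define F where "F t = relation6p14 (a + t * 2) b (c + t * 5) (d + t * 1) e (f + t * 20) (g + t * (- 12))" for t
  have "F holomorphic_on UNIV"
    unfolding F_def relation6p14_def rGamma4_def sinpi_prod_single B5_eq sp_def
    by (intro holomorphic_intros holomorphic_kap4F3) (use V in \<open>simp_all add: algebra_simps\<close>)
  then have F: "continuous_on UNIV F" by (rule holomorphic_on_imp_continuous_on)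
  have sp: "continuous_on UNIV (\<lambda>t. sp (u + t * k))" for u k
    unfolding sp_def by (intro continuous_intros)
  have "\<forall>t. sp (g + t * (- 12)) * (sp (d + t * 1) * (sp (a - b + t * 2) * (sp (b - c + t * (- 5)) * (sp (a - d + t * 1)
      * (sp (c - d + t * 4) * (sp (e - f + t * (- 20)) * (sp (g - c - d + t * (- 18)) * (sp (g - a - d + t * (- 15)) * F t)))))))) = 0"
  proof
    fix t
    define a' c' d' f' g' where "a' = a + t * 2" and "c' = c + t * 5" and "d' = d + t * 1" and "f' = f + t * 20"
      and "g' = g + t * (- 12)"
    have "e + f' + g' - a' - b - c' - d' = 1"
      using V by (simp add: a'_def c'_def d'_def f'_def g'_def algebra_simps)
    note generic = relation6p14_generic[OF this]
    have e: "a - b + t * 2 = a' - b" "b - c + t * (- 5) = b - c'" "a - d + t * 1 = a' - d'" "c - d + t * 4 = c' - d'"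
      "e - f + t * (- 20) = e - f'" "g - c - d + t * (- 18) = g' - c' - d'" "g - a - d + t * (- 15) = g' - a' - d'"
      by (simp_all add: a'_def c'_def d'_def f'_def g'_def algebra_simps)
    show "sp (g + t * (- 12)) * (sp (d + t * 1) * (sp (a - b + t * 2) * (sp (b - c + t * (- 5)) * (sp (a - d + t * 1)
      * (sp (c - d + t * 4) * (sp (e - f + t * (- 20)) * (sp (g - c - d + t * (- 18)) * (sp (g - a - d + t * (- 15)) * F t)))))))) = 0"
      using generic unfolding e F_def a'_def[symmetric] c'_def[symmetric] d'_def[symmetric] f'_def[symmetric] g'_def[symmetric]
      by (simp only: mult_eq_0_iff) blast
  qed
  \<comment> \<open>The outermost sine is removed repeatedly; what remains each time is a continuous
    product.\<close>
  then have "\<forall>t. F t = 0"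
    by - ((drule continuous_zero_of_sp_mult_zero', simp, (intro continuous_on_mult sp F)[1])+, assumption)
  then have "F 0 = 0" by blast
  then show ?thesis by (simp add: F_def)
qed

section \<open>Return to the unregularised series and to \<open>K\<close>\<close>

lemma hyp4F3_1_eq_reg:
  assumes V: "e + f + g - a - b - c - d = 1" and "e \<notin> \<int>\<^sub>\<le>\<^sub>0" "f \<notin> \<int>\<^sub>\<le>\<^sub>0" "g \<notin> \<int>\<^sub>\<le>\<^sub>0"
  shows "hyp4F3_1 a b c d e f g * (rGamma e * rGamma f * rGamma g) = hyp4F3_reg a b c d e f g"
proof -
  let ?r = "rGamma e * rGamma f * rGamma g"
  have r: "?r \<noteq> 0" using assms by (simp add: rGamma_eq_zero_iff)
  have "hyp4F3_term a b c d e f g n / ?r = (pochhammer a n * pochhammer b n * pochhammer c n * pochhammer d n) /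
           (fact n * pochhammer e n * pochhammer f n * pochhammer g n)" for n
  proof -
    have "pochhammer e n \<noteq> 0" "pochhammer f n \<noteq> 0" "pochhammer g n \<noteq> 0"
      using assms by (auto simp: pochhammer_eq_0_iff)
    then show ?thesis
      using r pochhammer_rGamma[of e n] pochhammer_rGamma[of f n] pochhammer_rGamma[of g n]
      by (simp add: hyp4F3_term_def field_simps)
  qed
  with sums_divide[OF hyp4F3_reg_sums[OF V], of ?r]
  have "hyp4F3_1 a b c d e f g = hyp4F3_reg a b c d e f g / ?r"
    unfolding hyp4F3_1_def by (simp add: sums_iff)
  then show ?thesis using r by simp
qed

text \<open>The reciprocal Gamma factors of the lower parameters in \<open>K\<close> are exactly
  those that regularise its two series.\<close>

lemma K_eq_kap4F3:
  assumes V: "e + f + g - a - b - c - d = 1" and K: "K_defined a b c d e f g"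
  shows "sp a * K a b c d e f g = rGamma a * kap4F3 a b c d e f g"
proof -
  have V': "1 + a - b + (1 + a - c) + (1 + a - d) - a - (1 + a - e) - (1 + a - f) - (1 + a - g) = 1"
    using V by (simp add: algebra_simps)
  have "sp a * K a b c d e f g =
      rGamma a * (rGamma (1 + a - e) * rGamma (1 + a - f) * rGamma (1 + a - g)
        * (hyp4F3_1 a b c d e f g * (rGamma e * rGamma f * rGamma g))
      + rGamma b * rGamma c * rGamma d
        * (hyp4F3_1 a (1 + a - e) (1 + a - f) (1 + a - g) (1 + a - b) (1 + a - c) (1 + a - d)
            * (rGamma (1 + a - b) * rGamma (1 + a - c) * rGamma (1 + a - d))))"
    using K by (simp add: K_def K_defined_def sp_def field_simps)
  then show ?thesis
    using K by (simp add: kap4F3_def hyp4F3_1_eq_reg[OF V] hyp4F3_1_eq_reg[OF V'] K_defined_def)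
qed

theorem proposition6p14:
  fixes a b c d e f g :: complex
  assumes "(a, b, c, d, e, f, g) \<in> V"
    and "K_defined a b c d e f g"
    and "K_defined (e - a) (e - b) (e - c) (e - d) (1 + e - f) (1 + e - g) e"
    and "K_defined (f - a) (f - b) (f - c) (f - d) (1 + f - g) f (1 + f - e)"
  shows
    "sinpi_prod [f - e]
       * rGamma4 (1 - a) (1 - b) (1 + c - g) (1 + d - g)
       * rGamma4 b (1 + b - e) (1 + b - f) (1 + b - g)
       * rGamma4 (1 - a) (e - a) (f - a) (g - a)
       * K a b c d e f g
     - rGamma4 (1 + a - e) (1 + b - e) (f - c) (f - d)
       * B5 a b c d f e g
       * K (e - a) (e - b) (e - c) (e - d) (1 + e - f) (1 + e - g) e
     + rGamma4 (1 + a - f) (1 + b - f) (e - c) (e - d)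
       * B5 a b c d e f g
       * K (f - a) (f - b) (f - c) (f - d) (1 + f - g) f (1 + f - e)
     = 0" (is "?p * ?K1 - ?q * ?K2 + ?r * ?K3 = 0")
proof -
  have V: "e + f + g - a - b - c - d = 1" using assms(1) by (simp add: V_def)
  have V': "1 + e - f + (1 + e - g) + e - (e - a) - (e - b) - (e - c) - (e - d) = 1"
    "1 + f - g + f + (1 + f - e) - (f - a) - (f - b) - (f - c) - (f - d) = 1"
    using V by (simp_all add: algebra_simps)
  have nz: "sp a \<noteq> 0" "sp (e - a) \<noteq> 0" "sp (f - a) \<noteq> 0"
    using assms(2-4) by (simp_all add: K_defined_def sp_def)
  have "sp a * sp (e - a) * sp (f - a) * (?p * ?K1 - ?q * ?K2 + ?r * ?K3)
      = sp (e - a) * sp (f - a) * (?p * (sp a * ?K1)) - sp a * sp (f - a) * (?q * (sp (e - a) * ?K2))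
        + sp a * sp (e - a) * (?r * (sp (f - a) * ?K3))"
    by (simp add: algebra_simps)
  also have "\<dots> = relation6p14 a b c d e f g"
    unfolding K_eq_kap4F3[OF V assms(2)] K_eq_kap4F3[OF V'(1) assms(3)] K_eq_kap4F3[OF V'(2) assms(4)]
      relation6p14_def ..
  also have "\<dots> = 0" by (rule relation6p14_eq_0[OF V])
  finally show ?thesis using nz by simp
qed

end
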